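(* Assume the standing assumptions (A) and (B) of the context. Consider the adaptive stochastic heavy ball method with noisy data described in the context, with fixed parameters satisfying $0<\mu_0<4\sigma$, $\mu_1>0$, $\upsilon_0>0$, $\upsilon_1>0$, $0\le \beta<1$ and $\tau>(1+\eta)/(1-\eta)$. Let $\{y^{(l)}:=(y_1^{(l)},\dots,y_N^{(l)})\}_{l\ge 1}$ be a sequence of noisy data satisfying $\|y_i^{(l)}-y_i\|\le \delta_i^{(l)}$ with $\delta_i^{(l)}>0$ for $i=1,\dots,N$ and $\delta^{(l)}:=\max\{\delta_i^{(l)}: i=1,\dots,N\}\to 0$ as $l\to\infty$. For each $l$, let $(\xi_n^{\delta^{(l)}},x_n^{\delta^{(l)}})$ be the iterates and $n_l:=n_{\delta^{(l)}}$ the stopping index produced by the method with data $y^{(l)}$ and noise levels $\delta_i^{(l)}$. Then there exists a random solution $x_*\in B_{2\rho}(x_0)\cap \mathrm{dom}(\Theta)$ of the system $F_i(x)=y_i$, $i=1,\dots,N$, such that $$\lim_{l\to\infty}\left\|x_{n_l}^{\delta^{(l)}}-x_*\right\|=0\quad\text{and}\quad \lim_{l\to\infty}D_{\xi_{n_l}^{\delta^{(l)}}}\Theta\left(x_*,x_{n_l}^{\delta^{(l)}}\right)=0\quad\text{almost surely}$$ and $$\lim_{l\to\infty}\mathbb{E}\left[\left\|x_{n_l}^{\delta^{(l)}}-x_*\right\|^2\right]=0\quad\text{and}\quad \lim_{l\to\infty}\mathbb{E}\left[D_{\xi_{n_l}^{\delta^{(l)}}}\Theta\left(x_*,x_{n_l}^{\delta^{(l)}}\right)\right]=0.$$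 If, further, $\mathrm{Ran}(L_i(x)^* )\subset\overline{\mathrm{Ran}(L_i(x^\dagger)^* )}$ for all $x\in B_{2\rho}(x_0)$ and $i=1,\dots,N$, then $x_*=x^\dagger$ almost surely.
   Context: Setting. Consider the system $F_i(x)=y_i$, $i=1,\dots,N$, where $F_i:\mathrm{dom}(F_i)\subset\mathcal X\to\mathcal Y_i$ are (possibly nonlinear) operators. Put $\mathcal D:=\bigcap_{i=1}^N\mathrm{dom}(F_i)\neq\emptyset$ and $B_\rho(x_0):=\{x\in\mathcal X:\|x-x_0\|\le\rho\}$. $\mathrm{Ran}$ denotes range and $^*$ the adjoint. For a convex $\Theta:\mathcal X\to(-\infty,\infty]$, $\mathrm{dom}(\Theta)=\{x:\Theta(x)<\infty\}$, $\partial\Theta$ is the subdifferential, $\mathrm{dom}(\partial\Theta)$ is the set of $x\in\mathrm{dom}(\Theta)$ with $\partial\Theta(x)\ne\emptyset$, and for $\xi\in\partial\Theta(x)$ the Bregman distance is $D_\xi\Theta(\bar x,x):=\Theta(\bar x)-\Theta(x)-\langle\xi,\bar x-x\rangle$. Fix an initial guess $x_0\in\mathrm{dom}(\partial\Theta)$, $\xi_0\in\partial\Theta(x_0)$. Assumption (A): $\Theta:\mathcal X\to(-\infty,\infty]$ is proper, lower semi-continuous and strongly convex, satisfying $D_\xi\Theta(\bar x,x)\ge\sigma\|\bar x-x\|^2$ for all $\bar x\in\mathcal X$, $x\in\mathrm{dom}(\partial\Theta)$, $\xi\in\partial\Theta(x)$, with a constant $\sigma>0$. Assumption (B): (a) $\mathcal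 X$ is a Hilbert space and each $\mathcal Y_i$ is a uniformly smooth Banach space. (b) There is $\rho>0$ with $B_{2\rho}(x_0)\subset\mathcal D$ and the system has a solution $\tilde x\in\mathrm{dom}(\Theta)$ with $D_{\xi_0}\Theta(\tilde x,x_0)\le\sigma\rho^2$. (c) For each $i$ there is a family of bounded linear operators $\{L_i(x):\mathcal X\to\mathcal Y_i\}_{x\in B_{2\rho}(x_0)}$ such that $x\mapsto L_i(x)$ is continuous on $B_{2\rho}(x_0)$, $\|L_i(x)\|\le B_0$ for all $x\in B_{2\rho}(x_0)$ and all $i$, for some constant $B_0>0$, and there is $0\le\eta<1$ with $\|F_i(x)-F_i(\bar x)-L_i(x)(x-\bar x)\|\le\eta\|F_i(x)-F_i(\bar x)\|$ for all $x,\bar x\in B_{2\rho}(x_0)$ and all $i$. $x^\dagger$ denotes the (unique) solution of the system that minimizes $D_{\xi_0}\Theta(x,x_0)$ over all solutions $x\in\mathrm{dom}(\Theta)\cap\mathcal D$ of the system. Duality mapping: for fixed $1<r<\infty$, $J_r^{\mathcal Y}(y)$ is the element $\zeta\in\mathcal Y^*$ with $\|\zeta\|=\|y\|^{r-1}$ and $\langle\zeta,y\rangle=\|y\|^r$ (single valued for uniformly smooth $\mathcal Y$). Method with noisy data. Given $y^\delta=(y_1^\delta,\dots,y_N^\delta)$ with $\|y_i^\delta-y_i\|\le\delta_i$, $\delta_i>0$, and parameters $\mu_0,\mu_1,\upsilon_0,\upsilon_1>0$, $\tau>1$, $\beta\in[0,\infty]$. Set $\xi_{-1}^\delta=\xi_0^\delta=\xi_0$,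 $x_0^\delta=x_0$, $I_0=\{1,\dots,N\}$, $\tilde\gamma_0^\delta=0$. For $n\ge0$: (i) Sample $i_n\in\{1,\dots,N\}$ uniformly at random (independently over $n$). (ii) Set $\mathfrak r_n^\delta=F_{i_n}(x_n^\delta)-y_{i_n}^\delta$, $\mathfrak g_n^\delta=L_{i_n}(x_n^\delta)^*J_r^{\mathcal Y_{i_n}}(\mathfrak r_n^\delta)$; if $\|\mathfrak r_n^\delta\|>\tau\delta_{i_n}$ set $$t_n^\delta=\min\left\{\frac{\mu_0\left((1-\eta)\|\mathfrak r_n^\delta\|-(1+\eta)\delta_{i_n}\right)\|\mathfrak r_n^\delta\|^{r-1}}{\|\mathfrak g_n^\delta\|^2},\ \mu_1\|\mathfrak r_n^\delta\|^{2-r}\right\},$$ otherwise $t_n^\delta=0$. (iii) Set $\mathfrak m_n^\delta=\xi_n^\delta-\xi_{n-1}^\delta$; for $n\ge1$ set $$\tilde\gamma_n^\delta=\langle\mathfrak m_n^\delta,x_n^\delta-x_{n-1}^\delta\rangle-(1-\eta)t_{n-1}^\delta\|\mathfrak r_{n-1}^\delta\|^r+(1+\eta)\delta_{i_{n-1}}t_{n-1}^\delta\|\mathfrak r_{n-1}^\delta\|^{r-1}+\beta_{n-1}^\delta\tilde\gamma_{n-1}^\delta.$$ If $\|\mathfrak m_n^\delta\|>\upsilon_0\delta_{i_n}$ and $\tilde\gamma_n^\delta-\frac{t_n^\delta}{2\sigma}\langle\mathfrak g_n^\delta,\mathfrak m_n^\delta\rangle<-\upsilon_1\delta_{i_n}\|\mathfrak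 m_n^\delta\|^2$, set $\beta_n^\delta=\min\left\{\frac{t_n^\delta\langle\mathfrak g_n^\delta,\mathfrak m_n^\delta\rangle-2\sigma\tilde\gamma_n^\delta}{\|\mathfrak m_n^\delta\|^2},\beta\right\}$; otherwise $\beta_n^\delta=0$. (iv) $\xi_{n+1}^\delta=\xi_n^\delta-t_n^\delta\mathfrak g_n^\delta+\beta_n^\delta\mathfrak m_n^\delta$ and $x_{n+1}^\delta=\arg\min_{x\in\mathcal X}\{\Theta(x)-\langle\xi_{n+1}^\delta,x\rangle\}$. (v) $I_{n+1}=I_n\setminus\{i_n\}$ if $t_n^\delta=0$ and $\beta_n^\delta=0$; otherwise $I_{n+1}=\{1,\dots,N\}$. (vi) The stopping index $n_\delta$ is the first integer with $I_{n_\delta}=\emptyset$ ($n_\delta=\infty$ if there is none). All runs of the method (for different data $y^{(l)}$) are driven by one and the same random index sequence $(i_0,i_1,\dots)$, with the same $x_0$, $\xi_0$ and parameters; almost sure statements and expectations refer to this sequence. *)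

theory Defs
  imports "HOL-Probability.Probability"
begin

section \<open>Convex analysis for functions with values in the extended reals\<close>

text \<open>The dual of the Hilbert space \<open>\<X>\<close> is identified with \<open>\<X>\<close>, so subgradients are vectors of
  \<open>\<X>\<close> and the pairing is the inner product.\<close>

definition edom :: "('a \<Rightarrow> ereal) \<Rightarrow> 'a set" where
  "edom \<Theta> = {x. \<Theta> x < \<infinity>}"

definition proper :: "('a \<Rightarrow> ereal) \<Rightarrow> bool" where
  "proper \<Theta> \<longleftrightarrow> (\<forall>x. \<Theta> x \<noteq> -\<infinity>) \<and> edom \<Theta> \<noteq> {}"

definition lower_semicont :: "('a::topological_space \<Rightarrow> ereal) \<Rightarrow> bool" where
  "lower_semicont \<Theta> \<longleftrightarrow> (\<forall>x. \<Theta> x \<le> Liminf (at x) \<Theta>)"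

definition strongly_convex :: "('a::real_normed_vector \<Rightarrow> ereal) \<Rightarrow> bool" where
  "strongly_convex \<Theta> \<longleftrightarrow> (\<exists>\<kappa>>0. \<forall>x z s. 0 < s \<and> s < 1 \<longrightarrow>
     \<Theta> (s *\<^sub>R x + (1 - s) *\<^sub>R z) + ereal (\<kappa> * s * (1 - s) * (norm (x - z))\<^sup>2)
       \<le> ereal s * \<Theta> x + ereal (1 - s) * \<Theta> z)"

definition subdifferential :: "('a::real_inner \<Rightarrow> ereal) \<Rightarrow> 'a \<Rightarrow> 'a set" where
  "subdifferential \<Theta> x = {\<xi>. \<forall>z. \<Theta> x + ereal (inner \<xi> (z - x)) \<le> \<Theta> z}"

definition dom_subdifferential :: "('a::real_inner \<Rightarrow> ereal) \<Rightarrow> 'a set" where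
  "dom_subdifferential \<Theta> = {x \<in> edom \<Theta>. subdifferential \<Theta> x \<noteq> {}}"

text \<open>\<open>bregman \<Theta> \<xi> z x\<close> is the distance from \<open>x\<close> to \<open>z\<close>; it is meaningful for \<open>x \<in> edom \<Theta>\<close>.\<close>

definition bregman :: "('a::real_inner \<Rightarrow> ereal) \<Rightarrow> 'a \<Rightarrow> 'a \<Rightarrow> 'a \<Rightarrow> ereal" where
  "bregman \<Theta> \<xi> z x = \<Theta> z - \<Theta> x - ereal (inner \<xi> (z - x))"

definition assumption_A :: "('a::real_inner \<Rightarrow> ereal) \<Rightarrow> real \<Rightarrow> bool" where
  "assumption_A \<Theta> \<sigma> \<longleftrightarrow>
     proper \<Theta> \<and> lower_semicont \<Theta> \<and> strongly_convex \<Theta> \<and> \<sigma> > 0 \<and>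
     (\<forall>z. \<forall>x \<in> dom_subdifferential \<Theta>. \<forall>\<xi> \<in> subdifferential \<Theta> x.
        ereal (\<sigma> * (norm (z - x))\<^sup>2) \<le> bregman \<Theta> \<xi> z x)"


section \<open>Uniformly smooth Banach spaces, duals, duality mappings\<close>

text \<open>The spaces \<open>\<Y>\<^sub>1, \<dots>, \<Y>\<^sub>N\<close> are different Banach spaces, whereas a family of types indexed by
  numbers is not available. They are represented as complete linear subspaces, with the inherited norm, of
  one real normed vector space. This is no restriction: finitely many Banach spaces embed
  isometrically as coordinate subspaces into their direct sum. No property of the ambient space is used:
  dual space, dual norm, duality mapping and uniform smoothness are those of the subspace.\<close>

definition banach_subspace :: "'b::real_normed_vector set \<Rightarrow> bool" where
  "banach_subspace V \<longleftrightarrow> subspace V \<and> uniform_space_class.complete V"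

definition uniformly_smooth :: "'b::real_normed_vector set \<Rightarrow> bool" where
  "uniformly_smooth V \<longleftrightarrow> (\<forall>\<epsilon>>0. \<exists>d>0. \<forall>u\<in>V. \<forall>v\<in>V. norm u = 1 \<and> norm v \<le> d \<longrightarrow>
     norm (u + v) + norm (u - v) \<le> 2 + \<epsilon> * norm v)"

text \<open>Functionals on \<open>V\<close> are made unique as HOL functions by the value \<open>undefined\<close> outside \<open>V\<close>.\<close>

definition dual_space :: "'b::real_normed_vector set \<Rightarrow> ('b \<Rightarrow> real) set" where
  "dual_space V = {f \<in> extensional V.
     (\<forall>u\<in>V. \<forall>v\<in>V. f (u + v) = f u + f v) \<and>
     (\<forall>c. \<forall>v\<in>V. f (c *\<^sub>R v) = c * f v) \<and>
     (\<exists>C. \<forall>v\<in>V. \<bar>f v\<bar> \<le> C * norm v)}"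

definition dual_norm :: "'b::real_normed_vector set \<Rightarrow> ('b \<Rightarrow> real) \<Rightarrow> real" where
  "dual_norm V f = (SUP v \<in> {v \<in> V. norm v \<le> 1}. \<bar>f v\<bar>)"

definition duality_map :: "real \<Rightarrow> 'b::real_normed_vector set \<Rightarrow> 'b \<Rightarrow> ('b \<Rightarrow> real)" where
  "duality_map r V v = (THE \<zeta>. \<zeta> \<in> dual_space V \<and>
     dual_norm V \<zeta> = norm v powr (r - 1) \<and> \<zeta> v = norm v powr r)"

text \<open>The adjoint \<open>L\<^sup>* : V\<^sup>* \<rightarrow> \<X>\<close> of \<open>L : \<X> \<rightarrow> V\<close>, where \<open>\<X>\<^sup>*\<close> is identified with \<open>\<X>\<close> by Riesz
  representation. (The library's \<open>adjoint\<close> is for inner product spaces only.)\<close>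

definition dual_adjoint ::
    "('a::{real_inner,complete_space} \<Rightarrow>\<^sub>L 'b::real_normed_vector) \<Rightarrow> ('b \<Rightarrow> real) \<Rightarrow> 'a" where
  "dual_adjoint L \<zeta> = (THE g. \<forall>h. inner g h = \<zeta> (blinfun_apply L h))"

definition ran_adjoint ::
    "'b set \<Rightarrow> ('a::{real_inner,complete_space} \<Rightarrow>\<^sub>L 'b::real_normed_vector) \<Rightarrow> 'a set" where
  "ran_adjoint V L = dual_adjoint L ` dual_space V"


section \<open>The system of equations\<close>

text \<open>\<open>F i\<close> is an operator with domain \<open>A i\<close>, \<open>i \<in> {1..N}\<close>; its values outside \<open>A i\<close> are irrelevant.\<close>

definition solutions ::
    "nat \<Rightarrow> (nat \<Rightarrow> 'a set) \<Rightarrow> (nat \<Rightarrow> 'a \<Rightarrow> 'b) \<Rightarrow> (nat \<Rightarrow> 'b) \<Rightarrow> 'a set" where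
  "solutions N A F y = {x \<in> (\<Inter>i\<in>{1..N}. A i). \<forall>i\<in>{1..N}. F i x = y i}"

definition x_dagger ::
    "nat \<Rightarrow> (nat \<Rightarrow> 'a::real_inner set) \<Rightarrow> (nat \<Rightarrow> 'a \<Rightarrow> 'b) \<Rightarrow> (nat \<Rightarrow> 'b) \<Rightarrow>
     ('a \<Rightarrow> ereal) \<Rightarrow> 'a \<Rightarrow> 'a \<Rightarrow> 'a" where
  "x_dagger N A F y \<Theta> x0 \<xi>0 = (THE x. x \<in> solutions N A F y \<inter> edom \<Theta> \<and>
     (\<forall>z \<in> solutions N A F y \<inter> edom \<Theta>. bregman \<Theta> \<xi>0 x x0 \<le> bregman \<Theta> \<xi>0 z x0))"

definition assumption_B ::
    "nat \<Rightarrow> (nat \<Rightarrow> 'b::real_normed_vector set) \<Rightarrow> (nat \<Rightarrow> 'a::{real_inner,complete_space} set) \<Rightarrow>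
     (nat \<Rightarrow> 'a \<Rightarrow> 'b) \<Rightarrow> (nat \<Rightarrow> 'a \<Rightarrow> 'a \<Rightarrow>\<^sub>L 'b) \<Rightarrow> (nat \<Rightarrow> 'b) \<Rightarrow>
     ('a \<Rightarrow> ereal) \<Rightarrow> real \<Rightarrow> real \<Rightarrow> real \<Rightarrow> 'a \<Rightarrow> 'a \<Rightarrow> bool" where
  "assumption_B N Y A F L y \<Theta> \<sigma> \<rho> \<eta> x0 \<xi>0 \<longleftrightarrow>
     \<comment> \<open>(a)\<close>
     (\<forall>i\<in>{1..N}. banach_subspace (Y i) \<and> uniformly_smooth (Y i)) \<and>
     \<comment> \<open>(b)\<close>
     \<rho> > 0 \<and> cball x0 (2 * \<rho>) \<subseteq> (\<Inter>i\<in>{1..N}. A i) \<and>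
     (\<exists>z \<in> solutions N A F y \<inter> edom \<Theta>. bregman \<Theta> \<xi>0 z x0 \<le> ereal (\<sigma> * \<rho>\<^sup>2)) \<and>
     \<comment> \<open>(c)\<close>
     (\<forall>i\<in>{1..N}. \<forall>x \<in> cball x0 (2 * \<rho>). range (blinfun_apply (L i x)) \<subseteq> Y i) \<and>
     (\<forall>i\<in>{1..N}. continuous_on (cball x0 (2 * \<rho>)) (L i)) \<and>
     (\<exists>B0>0. \<forall>i\<in>{1..N}. \<forall>x \<in> cball x0 (2 * \<rho>). norm (L i x) \<le> B0) \<and>
     0 \<le> \<eta> \<and> \<eta> < 1 \<and>
     (\<forall>i\<in>{1..N}. \<forall>x \<in> cball x0 (2 * \<rho>). \<forall>z \<in> cball x0 (2 * \<rho>).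
        norm (F i x - F i z - blinfun_apply (L i x) (x - z)) \<le> \<eta> * norm (F i x - F i z))"


section \<open>The adaptive stochastic heavy ball method with noisy data\<close>

text \<open>State before step \<open>n\<close>: \<open>\<xi>\<^sub>n\<close>, \<open>x\<^sub>n\<close>, \<open>m\<^sub>n = \<xi>\<^sub>n - \<xi>\<^sub>n\<^sub>-\<^sub>1\<close>, \<open>\<gamma>\<^sub>n\<close> (the paper's tilde-gamma) and \<open>I\<^sub>n\<close>.\<close>

datatype 'a shb_state =
  Shb (dual_it: 'a) (primal_it: 'a) (momentum: 'a) (gam: real) (active: "nat set")

text \<open>\<open>ydelta\<close> and \<open>\<delta>\<close> are the noisy data and the noise levels, \<open>\<iota>\<close> is a realisation of the random index
  sequence.\<close>

locale heavy_ball =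
  fixes N :: nat
    and Y :: "nat \<Rightarrow> 'b::real_normed_vector set"
    and F :: "nat \<Rightarrow> 'a::{real_inner,complete_space} \<Rightarrow> 'b"
    and L :: "nat \<Rightarrow> 'a \<Rightarrow> 'a \<Rightarrow>\<^sub>L 'b"
    and \<Theta> :: "'a \<Rightarrow> ereal"
    and r \<sigma> \<eta> \<mu>0 \<mu>1 \<upsilon>0 \<upsilon>1 \<tau> \<beta> :: real
    and x0 \<xi>0 :: 'a
    and ydelta :: "nat \<Rightarrow> 'b"
    and \<delta> :: "nat \<Rightarrow> real"
    and \<iota> :: "nat \<Rightarrow> nat"
begin

definition resid :: "nat \<Rightarrow> 'a \<Rightarrow> 'b" where
  "resid i x = F i x - ydelta i"

definition grad :: "nat \<Rightarrow> 'a \<Rightarrow> 'a" where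
  "grad i x = dual_adjoint (L i x) (duality_map r (Y i) (resid i x))"

text \<open>The quotient in the minimum is read as \<open>+\<infinity>\<close> when the gradient vanishes.\<close>

definition step_size :: "nat \<Rightarrow> 'a \<Rightarrow> real" where
  "step_size i x =
     (let R = norm (resid i x); g = grad i x; b = \<mu>1 * R powr (2 - r) in
      if R > \<tau> * \<delta> i then
        if g = 0 then b
        else min (\<mu>0 * ((1 - \<eta>) * R - (1 + \<eta>) * \<delta> i) * R powr (r - 1) / (norm g)\<^sup>2) b
      else 0)"

definition momentum_coeff :: "nat \<Rightarrow> 'a shb_state \<Rightarrow> real" where
  "momentum_coeff i s =
     (let x = primal_it s; m = momentum s; \<gamma> = gam s; t = step_size i x; g = grad i x in
      if norm m > \<upsilon>0 * \<delta> i \<and>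
         \<gamma> - t / (2 * \<sigma>) * inner g m < - \<upsilon>1 * \<delta> i * (norm m)\<^sup>2
      then min ((t * inner g m - 2 * \<sigma> * \<gamma>) / (norm m)\<^sup>2) \<beta>
      else 0)"

definition shb_step :: "nat \<Rightarrow> 'a shb_state \<Rightarrow> 'a shb_state" where
  "shb_step i s =
     (let x = primal_it s; \<xi> = dual_it s; m = momentum s;
          R = norm (resid i x); g = grad i x;
          t = step_size i x; b = momentum_coeff i s;
          \<xi>' = \<xi> - t *\<^sub>R g + b *\<^sub>R m;
          x' = arg_min (\<lambda>z. \<Theta> z - ereal (inner \<xi>' z)) (\<lambda>z. True);
          m' = \<xi>' - \<xi>;
          \<gamma>' = inner m' (x' - x) - (1 - \<eta>) * t * R powr r
               + (1 + \<eta>) * \<delta> i * t * R powr (r - 1) + b * gam s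
      in Shb \<xi>' x' m' \<gamma>' (if t = 0 \<and> b = 0 then active s - {i} else {1..N}))"

fun shb :: "nat \<Rightarrow> 'a shb_state" where
  "shb 0 = Shb \<xi>0 x0 0 0 {1..N}"
| "shb (Suc n) = shb_step (\<iota> n) (shb n)"

definition stop_index :: enat where
  "stop_index = Inf (enat ` {n. active (shb n) = {}})"

text \<open>The state at the stopping index; meaningful if the latter is finite.\<close>

definition shb_stopped :: "'a shb_state" where
  "shb_stopped = shb (the_enat stop_index)"

end


section \<open>The random index sequence\<close>

definition uniform_iid_indices :: "'w measure \<Rightarrow> nat \<Rightarrow> (nat \<Rightarrow> 'w \<Rightarrow> nat) \<Rightarrow> bool" where
  "uniform_iid_indices M N \<iota> \<longleftrightarrow>
     prob_space M \<and>
     prob_space.indep_vars M (\<lambda>_. count_space {1..N}) \<iota> UNIV \<and>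
     (\<forall>n. distr M (count_space {1..N}) (\<iota> n) = uniform_count_measure {1..N})"

end

theory Submission
  imports Defs
begin

text \<open>
The proof compares the noisy runs with the run for exact data, path by path of the index sequence.

Monotonicity. Write \<open>x\<^sub>n\<close> for the gradient at \<open>\<xi>\<^sub>n\<close> of the convex conjugate of \<open>\<Theta>\<close>, which is Lipschitz
continuous because \<open>\<Theta>\<close> is strongly convex. Therefore the Bregman distance from \<open>x\<^sub>n\<close> to a solution \<open>z\<close>
changes in one step by at most \<open>\<langle>m, x\<^sub>n - z\<rangle> + \<parallel>m\<parallel>\<^sup>2 / (4 * \<sigma>)\<close> with \<open>m = \<xi>\<^sub>n\<^sub>+\<^sub>1 - \<xi>\<^sub>n\<close>. The gradient part of \<open>m\<close>
makes this negative by the tangential cone condition, and the momentum coefficient is chosen such that the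
momentum part lowers it further. Hence Bregman distances to solutions decrease, by at least a multiple of
the squared residual of the drawn equation if this residual exceeds the discrepancy threshold
(\<open>breg_decrease\<close>, \<open>loss_lower\<close>).

Exact data. The squared residuals of the drawn equations have a bounded sum on every path. As the next
index is uniform given the past, the squared residuals of the whole system have a finite expected sum, and
so are summable almost surely (\<open>AE_summable_Phi\<close>). On a path where they are summable, the iterates
converge to a solution \<open>xs\<close> and the Bregman distance to \<open>xs\<close> tends to zero (\<open>exact_convergence\<close>): the
increments of \<open>\<xi>\<close>, tested against the difference of a good iterate and a solution, are bounded by a
convolution of the squared residuals with the powers of \<open>\<beta> < 1\<close>.

Noisy data. For a fixed number of steps the noisy iterates depend continuously on the data at noise level
zero (\<open>stability\<close>), which rests on the norm continuity of duality mappings of uniformly smooth spaces. The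
method stops on every path on which each index is drawn infinitely often (\<open>terminates\<close>). Monotonicity
carries the closeness to \<open>xs\<close> at a fixed late step to the stopping time; a run that stops early does so
near a solution (\<open>stopped_convergence\<close>). Dominated convergence gives the expectations.

Identification. Under the range condition all increments of \<open>\<xi>\<close> are orthogonal to the difference of \<open>xs\<close>
and \<open>x\<^sup>\<dagger>\<close>, so the Bregman distances of both from \<open>x0\<close> can be compared through the limit
(\<open>limit_eq_xdag\<close>).
\<close>

section \<open>Strongly convex functions and Bregman distances\<close>

text \<open>A minimising sequence of a uniformly midpoint-convex function is Cauchy, because the value at the
  midpoint of two almost minimal points cannot drop below the infimum. The lemma provides the minimiser defining \<open>x\<^sub>n\<^sub>+\<^sub>1\<close>, Riesz representatives and the
  solution \<open>x\<^sup>\<dagger>\<close>.\<close>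
lemma uniformly_convex_minimizer:
  fixes f :: "'a::{real_normed_vector,complete_space} \<Rightarrow> real"
  assumes ne: "S \<noteq> {}" and bdd: "\<And>x. x \<in> S \<Longrightarrow> B \<le> f x" and \<kappa>: "\<kappa> > 0"
    and mid: "\<And>x z. x \<in> S \<Longrightarrow> z \<in> S \<Longrightarrow>
      (1/2) *\<^sub>R (x + z) \<in> S \<and> f ((1/2) *\<^sub>R (x + z)) + \<kappa> * (norm (x - z))\<^sup>2 \<le> (f x + f z) / 2"
    and lsc: "\<And>X x a. (\<And>n. X n \<in> S) \<Longrightarrow> X \<longlonglongrightarrow> x \<Longrightarrow> (\<lambda>n. f (X n)) \<longlonglongrightarrow> a \<Longrightarrow> x \<in> S \<and> f x \<le> a"
  shows "\<exists>x\<in>S. \<forall>z\<in>S. f x \<le> f z"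
proof -
  define I where "I = Inf (f ` S)"
  have bb: "bdd_below (f ` S)" using bdd by (auto intro!: bdd_belowI2)
  have I_le: "I \<le> f z" if "z \<in> S" for z
    unfolding I_def using bb that by (simp add: cInf_lower)
  have "\<exists>x\<in>S. f x < I + inverse (real (Suc n))" for n
  proof -
    have "I < I + inverse (real (Suc n))" by simp
    then show ?thesis using cInf_less_iff[of "f ` S" "I + inverse (real (Suc n))"] bb ne
      unfolding I_def by auto
  qed
  then obtain X where X: "\<And>n. X n \<in> S" "\<And>n. f (X n) < I + inverse (real (Suc n))" by metis
  have cauchy: "Cauchy X"
  proof (rule metric_CauchyI)
    fix e :: real assume "0 < e"
    then have "0 < \<kappa> * e\<^sup>2" using \<kappa> by simp
    then obtain n0 where n0: "inverse (real (Suc n0)) < \<kappa> * e\<^sup>2" using reals_Archimedean by blast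
    show "\<exists>M. \<forall>m\<ge>M. \<forall>n\<ge>M. dist (X m) (X n) < e"
    proof (intro exI allI impI)
      fix m n assume mn: "n0 \<le> m" "n0 \<le> n"
      have "inverse (real (Suc m)) \<le> inverse (real (Suc n0))" "inverse (real (Suc n)) \<le> inverse (real (Suc n0))"
        using mn by (auto intro!: le_imp_inverse_le)
      moreover have "I + \<kappa> * (norm (X m - X n))\<^sup>2 \<le> (f (X m) + f (X n)) / 2"
        using mid[OF X(1)[of m] X(1)[of n]] I_le by fastforce
      moreover from calculation have "f (X m) < I + inverse (real (Suc n0))" "f (X n) < I + inverse (real (Suc n0))"
        using X(2)[of m] X(2)[of n] by linarith+
      ultimately have "\<kappa> * (norm (X m - X n))\<^sup>2 < \<kappa> * e\<^sup>2"
        using n0 by argo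
      then have "(norm (X m - X n))\<^sup>2 < e\<^sup>2" using \<kappa> by simp
      then show "dist (X m) (X n) < e" using \<open>0 < e\<close>
        by (simp add: dist_norm power_less_imp_less_base)
    qed
  qed
  then obtain x where x: "X \<longlonglongrightarrow> x" using Cauchy_convergent convergent_def by blast
  have "(\<lambda>n. f (X n)) \<longlonglongrightarrow> I"
  proof (rule tendsto_sandwich)
    show "\<forall>\<^sub>F n in sequentially. I \<le> f (X n)" using I_le X by auto
    show "\<forall>\<^sub>F n in sequentially. f (X n) \<le> I + inverse (real (Suc n))"
      using X(2) by (auto intro!: always_eventually less_imp_le)
    show "(\<lambda>n. I + inverse (real (Suc n))) \<longlonglongrightarrow> I"
      using tendsto_add[OF tendsto_const LIMSEQ_inverse_real_of_nat, of I] by simp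
  qed simp
  then have "x \<in> S \<and> f x \<le> I" using lsc X x by blast
  then show ?thesis using I_le by force
qed

lemma lower_semicont_iff_eventually:
  "lower_semicont f \<longleftrightarrow> (\<forall>x c. c < f x \<longrightarrow> (\<forall>\<^sub>F z in nhds x. c < f z))"
proof -
  have "(\<forall>\<^sub>F z in nhds x. c < f z) \<longleftrightarrow> (\<forall>\<^sub>F z in at x. c < f z)" if "c < f x" for c x
  proof
    show "\<forall>\<^sub>F z in at x. c < f z \<Longrightarrow> \<forall>\<^sub>F z in nhds x. c < f z"
      unfolding eventually_at_filter by (erule eventually_mono) (use that in auto)
  qed (auto simp: eventually_at_filter elim: eventually_mono)
  then show ?thesis unfolding lower_semicont_def le_Liminf_iff by blast
qed

lemma lower_semicont_borel_measurable:
  fixes f :: "'a::topological_space \<Rightarrow> ereal"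
  assumes "lower_semicont f" shows "f \<in> borel_measurable borel"
proof (rule borel_measurableI_greater)
  fix c
  have "open {x. c < f x}"
    using assms unfolding lower_semicont_iff_eventually
    by (subst open_subopen) (fastforce simp: eventually_nhds)
  then show "{x \<in> space borel. c < f x} \<in> sets borel" by simp
qed

text \<open>The functions \<open>th\<close>, \<open>subgrad\<close> and \<open>breg\<close> below are real-valued versions of \<open>\<Theta>\<close>, of subgradients and
  of the Bregman distance, faithful on \<open>edom \<Theta>\<close>. The growth condition of assumption (A) is built
  into \<open>subgrad\<close>. The base point \<open>(x0, \<xi>0)\<close> makes every tilted function \<open>\<Theta> - \<langle>\<xi>, \<cdot>\<rangle>\<close> bounded below.\<close>
locale regularizer =
  fixes \<Theta> :: "'a::{real_inner,complete_space} \<Rightarrow> ereal" and \<sigma> :: real and x0 \<xi>0 :: 'a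
  assumes A: "assumption_A \<Theta> \<sigma>"
    and x0: "x0 \<in> dom_subdifferential \<Theta>" and \<xi>0: "\<xi>0 \<in> subdifferential \<Theta> x0"
begin

definition th :: "'a \<Rightarrow> real" where "th x = real_of_ereal (\<Theta> x)"

definition subgrad :: "'a \<Rightarrow> 'a \<Rightarrow> bool" where
  "subgrad \<xi> x \<longleftrightarrow> x \<in> edom \<Theta> \<and>
     (\<forall>z\<in>edom \<Theta>. th x + inner \<xi> (z - x) + \<sigma> * (norm (z - x))\<^sup>2 \<le> th z)"

definition breg :: "'a \<Rightarrow> 'a \<Rightarrow> 'a \<Rightarrow> real" where
  "breg \<xi> z x = th z - th x - inner \<xi> (z - x)"

text \<open>The gradient at \<open>\<xi>\<close> of the convex conjugate of \<open>\<Theta>\<close>.\<close>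
definition conj_grad :: "'a \<Rightarrow> 'a" where
  "conj_grad \<xi> = arg_min (\<lambda>z. \<Theta> z - ereal (inner \<xi> z)) (\<lambda>z. True)"

lemma \<sigma>: "\<sigma> > 0" using A by (simp add: assumption_A_def)

lemma \<Theta>_eq: "x \<in> edom \<Theta> \<Longrightarrow> \<Theta> x = ereal (th x)"
  using A by (cases "\<Theta> x") (auto simp: edom_def th_def assumption_A_def proper_def)

lemma \<Theta>_not_edom: "x \<notin> edom \<Theta> \<Longrightarrow> \<Theta> x = \<infinity>"
  by (auto simp: edom_def)

lemma subgrad_edom: "subgrad \<xi> x \<Longrightarrow> x \<in> edom \<Theta>" by (simp add: subgrad_def)

lemma bregman_eq:
  assumes "z \<in> edom \<Theta>" "x \<in> edom \<Theta>" shows "bregman \<Theta> \<xi> z x = ereal (breg \<xi> z x)"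
  by (simp add: bregman_def breg_def \<Theta>_eq assms)

lemma subgradI:
  assumes "x \<in> edom \<Theta>" "\<xi> \<in> subdifferential \<Theta> x" shows "subgrad \<xi> x"
proof -
  have "x \<in> dom_subdifferential \<Theta>" using assms by (auto simp: dom_subdifferential_def)
  then have "ereal (\<sigma> * (norm (z - x))\<^sup>2) \<le> bregman \<Theta> \<xi> z x" for z
    using A assms by (auto simp: assumption_A_def)
  then have "\<sigma> * (norm (z - x))\<^sup>2 \<le> breg \<xi> z x" if "z \<in> edom \<Theta>" for z
    using bregman_eq[OF that assms(1)] by (metis ereal_less_eq(3))
  then show ?thesis using assms(1) by (force simp: subgrad_def breg_def)
qed

lemma subgrad0: "subgrad \<xi>0 x0"
  using x0 \<xi>0 by (auto intro!: subgradI simp: dom_subdifferential_def)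

lemma th_lsc:
  assumes X: "\<And>n. X n \<in> edom \<Theta>" "X \<longlonglongrightarrow> x" and a: "\<And>n. th (X n) \<le> a n" "a \<longlonglongrightarrow> b"
  shows "x \<in> edom \<Theta> \<and> th x \<le> b"
proof -
  have le: "\<Theta> x \<le> ereal b"
  proof (rule ccontr)
    assume "\<not> \<Theta> x \<le> ereal b"
    then obtain c where c: "ereal b < c" "c < \<Theta> x" using dense by (metis not_le)
    have "lower_semicont \<Theta>" using A by (simp add: assumption_A_def)
    then have "\<forall>\<^sub>F z in nhds x. c < \<Theta> z" using c by (simp add: lower_semicont_iff_eventually)
    then have "\<forall>\<^sub>F n in sequentially. c < \<Theta> (X n)" using X(2) by (rule eventually_compose_filterlim)
    moreover have "\<forall>\<^sub>F n in sequentially. ereal (a n) < c"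
      using a(2) c(1) by (intro order_tendstoD) auto
    ultimately have "\<forall>\<^sub>F n in sequentially. False"
    proof eventually_elim
      case (elim n)
      have "\<Theta> (X n) \<le> ereal (a n)" using \<Theta>_eq[OF X(1)] a(1)[of n] by simp
      then show ?case using elim by (meson leD less_trans)
    qed
    then show False by simp
  qed
  then have e: "x \<in> edom \<Theta>" by (auto simp: edom_def)
  then show ?thesis using le \<Theta>_eq by simp
qed

lemma th_midpoint:
  obtains \<kappa> where "\<kappa> > 0" "\<And>x z. x \<in> edom \<Theta> \<Longrightarrow> z \<in> edom \<Theta> \<Longrightarrow>
     (1/2) *\<^sub>R (x + z) \<in> edom \<Theta> \<and> th ((1/2) *\<^sub>R (x + z)) + \<kappa> * (norm (x - z))\<^sup>2 \<le> (th x + th z) / 2"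
proof -
  from A obtain \<kappa> where \<kappa>: "\<kappa> > 0" "\<And>x z s. 0 < s \<and> s < 1 \<Longrightarrow>
     \<Theta> (s *\<^sub>R x + (1 - s) *\<^sub>R z) + ereal (\<kappa> * s * (1 - s) * (norm (x - z))\<^sup>2)
       \<le> ereal s * \<Theta> x + ereal (1 - s) * \<Theta> z"
    unfolding assumption_A_def strongly_convex_def by blast
  have "(1/2) *\<^sub>R (x + z) \<in> edom \<Theta> \<and> th ((1/2) *\<^sub>R (x + z)) + (\<kappa>/4) * (norm (x - z))\<^sup>2 \<le> (th x + th z) / 2"
    if "x \<in> edom \<Theta>" "z \<in> edom \<Theta>" for x z
  proof -
    let ?m = "(1/2) *\<^sub>R (x + z)"
    have le: "\<Theta> ?m + ereal (\<kappa>/4 * (norm (x - z))\<^sup>2) \<le> ereal ((th x + th z) / 2)"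
      using \<kappa>(2)[of "1/2" x z] by (simp add: \<Theta>_eq that scaleR_right_distrib add_divide_distrib)
    then have "?m \<in> edom \<Theta>" by (cases "\<Theta> ?m") (auto simp: edom_def)
    then show ?thesis using le \<Theta>_eq[of ?m] by simp
  qed
  then show ?thesis using that[of "\<kappa>/4"] \<kappa>(1) by simp
qed

lemma weighted_young: "a * b \<le> a\<^sup>2 / (4 * \<sigma>) + \<sigma> * b\<^sup>2"
proof -
  have "0 \<le> (a - 2 * \<sigma> * b)\<^sup>2 / (4 * \<sigma>)" using \<sigma> by simp
  also have "\<dots> = a\<^sup>2 / (4 * \<sigma>) + \<sigma> * b\<^sup>2 - a * b"
    using \<sigma> by (simp add: field_simps power2_eq_square)
  finally show ?thesis by simp
qed

text \<open>The quadratic growth of \<open>\<Theta>\<close> around \<open>x0\<close> absorbs the linear function \<open>\<langle>\<xi>0 - \<xi>, \<cdot>\<rangle>\<close>.\<close>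
lemma tilted_bounded_below:
  assumes "z \<in> edom \<Theta>"
  shows "th x0 - inner \<xi>0 x0 - (norm (\<xi>0 - \<xi>))\<^sup>2 / (4 * \<sigma>) + inner (\<xi>0 - \<xi>) x0 \<le> th z - inner \<xi> z"
proof -
  have 1: "th x0 + inner \<xi>0 (z - x0) + \<sigma> * (norm (z - x0))\<^sup>2 \<le> th z"
    using subgrad0 assms by (simp add: subgrad_def)
  have "inner (\<xi>0 - \<xi>) (z - x0) \<ge> - (norm (\<xi>0 - \<xi>) * norm (z - x0))"
    using Cauchy_Schwarz_ineq2[of "\<xi>0 - \<xi>" "z - x0"] by linarith
  then show ?thesis using 1 weighted_young[of "norm (\<xi>0 - \<xi>)" "norm (z - x0)"]
    by (simp add: algebra_simps)
qed

text \<open>With \<open>C = UNIV\<close> this gives the primal iterates; with \<open>C\<close> the solutions in a ball it gives the solution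
  nearest to \<open>x0\<close> in the Bregman distance. The midpoint condition is what is known of \<open>C\<close> there.\<close>
lemma minimizer_on:
  assumes ne: "C \<inter> edom \<Theta> \<noteq> {}" and C: "closed C"
    and mid: "\<And>x z. x \<in> C \<Longrightarrow> z \<in> C \<Longrightarrow> (1/2) *\<^sub>R (x + z) \<in> C"
  shows "\<exists>!x. x \<in> C \<inter> edom \<Theta> \<and> (\<forall>z\<in>C \<inter> edom \<Theta>. th x - inner \<xi> x \<le> th z - inner \<xi> z)"
proof -
  let ?f = "\<lambda>z. th z - inner \<xi> z"
  obtain \<kappa> where \<kappa>: "\<kappa> > 0" "\<And>x z. x \<in> edom \<Theta> \<Longrightarrow> z \<in> edom \<Theta> \<Longrightarrow>
     (1/2) *\<^sub>R (x + z) \<in> edom \<Theta> \<and> th ((1/2) *\<^sub>R (x + z)) + \<kappa> * (norm (x - z))\<^sup>2 \<le> (th x + th z) / 2"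
    using th_midpoint by metis
  have tilted: "(1/2) *\<^sub>R (x + z) \<in> edom \<Theta> \<and>
      ?f ((1/2) *\<^sub>R (x + z)) + \<kappa> * (norm (x - z))\<^sup>2 \<le> (?f x + ?f z) / 2"
    if "x \<in> edom \<Theta>" "z \<in> edom \<Theta>" for x z
  proof -
    have "inner \<xi> ((1/2) *\<^sub>R (x + z)) = (inner \<xi> x + inner \<xi> z) / 2"
      by (simp add: inner_add_right)
    then show ?thesis using \<kappa>(2)[OF that] by argo
  qed
  have "\<exists>x\<in>C \<inter> edom \<Theta>. \<forall>z\<in>C \<inter> edom \<Theta>. ?f x \<le> ?f z"
  proof (rule uniformly_convex_minimizer[OF ne _ \<kappa>(1)])
    show "th x0 - inner \<xi>0 x0 - (norm (\<xi>0 - \<xi>))\<^sup>2 / (4 * \<sigma>) + inner (\<xi>0 - \<xi>) x0 \<le> ?f x"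
      if "x \<in> C \<inter> edom \<Theta>" for x using tilted_bounded_below that by blast
    show "(1/2) *\<^sub>R (x + z) \<in> C \<inter> edom \<Theta> \<and>
           ?f ((1/2) *\<^sub>R (x + z)) + \<kappa> * (norm (x - z))\<^sup>2 \<le> (?f x + ?f z) / 2"
      if "x \<in> C \<inter> edom \<Theta>" "z \<in> C \<inter> edom \<Theta>" for x z
      using that mid tilted by blast
    show "x \<in> C \<inter> edom \<Theta> \<and> ?f x \<le> a"
      if X: "\<And>n. X n \<in> C \<inter> edom \<Theta>" "X \<longlonglongrightarrow> x" and a: "(\<lambda>n. ?f (X n)) \<longlonglongrightarrow> a" for X x a
    proof -
      have "(\<lambda>n. ?f (X n) + inner \<xi> (X n)) \<longlonglongrightarrow> a + inner \<xi> x"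
        by (intro tendsto_add a tendsto_inner tendsto_const X)
      then have "x \<in> edom \<Theta> \<and> th x \<le> a + inner \<xi> x"
        using X th_lsc[of X x "\<lambda>n. ?f (X n) + inner \<xi> (X n)"] by auto
      moreover have "x \<in> C" using C X closed_sequentially by blast
      ultimately show ?thesis by auto
    qed
  qed
  then obtain x where x: "x \<in> C \<inter> edom \<Theta>" "\<And>z. z \<in> C \<inter> edom \<Theta> \<Longrightarrow> ?f x \<le> ?f z" by blast
  show ?thesis
  proof (rule ex1I[of _ x])
    show "x \<in> C \<inter> edom \<Theta> \<and> (\<forall>z\<in>C \<inter> edom \<Theta>. ?f x \<le> ?f z)" using x by blast
    fix z assume z: "z \<in> C \<inter> edom \<Theta> \<and> (\<forall>u\<in>C \<inter> edom \<Theta>. ?f z \<le> ?f u)"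
    let ?m = "(1/2) *\<^sub>R (x + z)"
    have "?m \<in> C \<inter> edom \<Theta>" "?f ?m + \<kappa> * (norm (x - z))\<^sup>2 \<le> (?f x + ?f z) / 2"
      using x z mid tilted by blast+
    moreover have "?f x = ?f z" using x z by (meson order_antisym)
    ultimately have "\<kappa> * (norm (x - z))\<^sup>2 \<le> 0" using x(2)[of ?m] by simp
    then show "z = x" using \<kappa>(1) by (simp add: mult_le_0_iff)
  qed
qed

lemma subgrad_conj_grad:
  "subgrad \<xi> (conj_grad \<xi>)"
proof -
  let ?f = "\<lambda>z. \<Theta> z - ereal (inner \<xi> z)"
  have "UNIV \<inter> edom \<Theta> \<noteq> {}" using subgrad0 by (auto simp: subgrad_def)
  from ex1_implies_ex[OF minimizer_on[OF this, of \<xi>]] obtain x where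
    x: "x \<in> edom \<Theta>" "\<And>z. z \<in> edom \<Theta> \<Longrightarrow> th x - inner \<xi> x \<le> th z - inner \<xi> z" by auto
  have "?f x \<le> ?f z" for z
    using x \<Theta>_eq \<Theta>_not_edom by (cases "z \<in> edom \<Theta>") auto
  then have "is_arg_min ?f (\<lambda>z. True) x" by (auto simp: is_arg_min_def not_less)
  then have "is_arg_min ?f (\<lambda>z. True) (conj_grad \<xi>)"
    unfolding conj_grad_def arg_min_def by (rule someI)
  then have min: "?f (conj_grad \<xi>) \<le> ?f z" for z by (auto simp: is_arg_min_def not_less)
  have e: "conj_grad \<xi> \<in> edom \<Theta>"
    using min[of x] \<Theta>_eq[OF x(1)] by (cases "\<Theta> (conj_grad \<xi>)") (auto simp: edom_def)
  have "th (conj_grad \<xi>) - inner \<xi> (conj_grad \<xi>) \<le> th z - inner \<xi> z" if "z \<in> edom \<Theta>" for z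
    using min[of z] \<Theta>_eq e that by simp
  then have "\<Theta> (conj_grad \<xi>) + ereal (inner \<xi> (z - conj_grad \<xi>)) \<le> \<Theta> z" for z
    using \<Theta>_eq \<Theta>_not_edom e by (cases "z \<in> edom \<Theta>") (auto simp: inner_diff_right algebra_simps)
  then show ?thesis using e by (intro subgradI) (auto simp: subdifferential_def)
qed

lemma breg_lower: "subgrad \<xi> x \<Longrightarrow> z \<in> edom \<Theta> \<Longrightarrow> \<sigma> * (norm (z - x))\<^sup>2 \<le> breg \<xi> z x"
  by (force simp: subgrad_def breg_def)

lemma breg_nonneg: "subgrad \<xi> x \<Longrightarrow> z \<in> edom \<Theta> \<Longrightarrow> 0 \<le> breg \<xi> z x"
  using breg_lower[of \<xi> x z] \<sigma> by (smt (verit) mult_nonneg_nonneg zero_le_power2)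

text \<open>Strong convexity of \<open>\<Theta>\<close> is Lipschitz continuity of the gradient of its conjugate: add the growth
  inequalities at the two points.\<close>
lemma subgrad_lipschitz:
  assumes "subgrad \<xi> x" "subgrad \<xi>' x'"
  shows "norm (x - x') \<le> norm (\<xi> - \<xi>') / (2 * \<sigma>)"
proof -
  have "\<sigma> * (norm (x' - x))\<^sup>2 \<le> breg \<xi> x' x" "\<sigma> * (norm (x - x'))\<^sup>2 \<le> breg \<xi>' x x'"
    using assms breg_lower subgrad_edom by blast+
  then have "2 * \<sigma> * (norm (x - x'))\<^sup>2 \<le> inner (\<xi> - \<xi>') (x - x')"
    by (simp add: breg_def norm_minus_commute inner_diff_left inner_diff_right)
  also have "\<dots> \<le> norm (\<xi> - \<xi>') * norm (x - x')" by (rule norm_cauchy_schwarz)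
  finally have *: "(2 * \<sigma> * norm (x - x')) * norm (x - x') \<le> norm (\<xi> - \<xi>') * norm (x - x')"
    by (simp add: power2_eq_square)
  show ?thesis
  proof (cases "x = x'")
    case False
    then have "2 * \<sigma> * norm (x - x') \<le> norm (\<xi> - \<xi>')"
      using * by (meson mult_le_cancel_right zero_less_norm_iff right_minus_eq)
    then show ?thesis using \<sigma> by (simp add: field_simps)
  qed (use \<sigma> in simp)
qed

lemma subgrad_unique: "subgrad \<xi> x \<Longrightarrow> subgrad \<xi> x' \<Longrightarrow> x = x'"
  using subgrad_lipschitz[of \<xi> x \<xi> x'] by simp

lemma breg_self [simp]: "breg \<xi> x x = 0" by (simp add: breg_def)

text \<open>The dual counterpart of \<open>breg_lower\<close>: the Bregman distance between two primal points is at most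
  quadratic in the distance of their subgradients.\<close>
lemma breg_upper:
  assumes "subgrad \<xi> x" "subgrad \<xi>' x'"
  shows "breg \<xi>' x x' \<le> (norm (\<xi>' - \<xi>))\<^sup>2 / (4 * \<sigma>)"
proof -
  have "\<sigma> * (norm (x' - x))\<^sup>2 \<le> breg \<xi> x' x"
    using assms breg_lower subgrad_edom by blast
  moreover have "breg \<xi>' x x' + breg \<xi> x' x = inner (\<xi>' - \<xi>) (x' - x)"
    by (simp add: breg_def inner_diff_left inner_diff_right)
  moreover have "inner (\<xi>' - \<xi>) (x' - x) \<le> norm (\<xi>' - \<xi>) * norm (x' - x)" by (rule norm_cauchy_schwarz)
  ultimately show ?thesis using weighted_young[of "norm (\<xi>' - \<xi>)" "norm (x' - x)"] by linarith
qed

lemma breg_step: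
  "breg \<xi>' z x' = breg \<xi> z x + breg \<xi>' x x' + inner (\<xi>' - \<xi>) (x - z)"
  by (simp add: breg_def inner_diff_left inner_diff_right)

text \<open>How the distance to a fixed \<open>z\<close> changes when the subgradient moves: a first-order term, to be made
  negative by the choice of direction, and a second-order term bounded by smoothness of the conjugate.\<close>
lemma breg_descent:
  assumes "subgrad \<xi> x" "subgrad \<xi>' x'"
  shows "breg \<xi>' z x' \<le> breg \<xi> z x + inner (\<xi>' - \<xi>) (x - z) + (norm (\<xi>' - \<xi>))\<^sup>2 / (4 * \<sigma>)"
  using breg_step[of \<xi>' z x' \<xi> x] breg_upper[OF assms] by simp

lemma tendsto_of_breg_tendsto_0:
  assumes "\<And>l. subgrad (\<xi> l) (x l)" "z \<in> edom \<Theta>" "(\<lambda>l. breg (\<xi> l) z (x l)) \<longlonglongrightarrow> 0"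
  shows "x \<longlonglongrightarrow> z"
proof -
  have "(\<lambda>l. (norm (x l - z))\<^sup>2) \<longlonglongrightarrow> 0"
  proof (rule tendsto_sandwich[OF _ _ tendsto_const])
    show "\<forall>\<^sub>F l in sequentially. (norm (x l - z))\<^sup>2 \<le> breg (\<xi> l) z (x l) / \<sigma>"
      using breg_lower[OF assms(1,2)] \<sigma> by (auto simp: field_simps norm_minus_commute)
    show "(\<lambda>l. breg (\<xi> l) z (x l) / \<sigma>) \<longlonglongrightarrow> 0"
      using tendsto_divide[OF assms(3) tendsto_const, of \<sigma>] \<sigma> by simp
  qed auto
  then have "(\<lambda>l. norm (x l - z)) \<longlonglongrightarrow> 0"
    using tendsto_real_sqrt[of "\<lambda>l. (norm (x l - z))\<^sup>2" 0] by simp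
  then show ?thesis by (simp add: tendsto_norm_zero_iff LIM_zero_iff)
qed

text \<open>\<open>\<Theta>\<close> is merely lower semicontinuous, but along points with convergent subgradients the Bregman
  distance to a fixed \<open>z\<close> is continuous, since it is determined by the conjugate.\<close>
lemma breg_tendsto:
  assumes "\<And>l. subgrad (\<xi>' l) (x' l)" "subgrad \<xi> x" "\<xi>' \<longlonglongrightarrow> \<xi>"
  shows "x' \<longlonglongrightarrow> x" and "(\<lambda>l. breg (\<xi>' l) z (x' l)) \<longlonglongrightarrow> breg \<xi> z x"
proof -
  have n: "(\<lambda>l. norm (\<xi>' l - \<xi>)) \<longlonglongrightarrow> 0" using assms(3) by (simp add: LIM_zero tendsto_norm_zero)
  show x': "x' \<longlonglongrightarrow> x"
  proof (rule LIM_zero_cancel, rule Lim_null_comparison)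
    show "\<forall>\<^sub>F l in sequentially. norm (x' l - x) \<le> norm (\<xi>' l - \<xi>) / (2 * \<sigma>)"
      using subgrad_lipschitz[OF assms(1,2)] by auto
    show "(\<lambda>l. norm (\<xi>' l - \<xi>) / (2 * \<sigma>)) \<longlonglongrightarrow> 0" using tendsto_divide[OF n tendsto_const, of "2*\<sigma>"] \<sigma> by simp
  qed
  have b: "(\<lambda>l. breg (\<xi>' l) x (x' l)) \<longlonglongrightarrow> 0"
  proof (rule tendsto_sandwich[OF _ _ tendsto_const])
    show "\<forall>\<^sub>F l in sequentially. 0 \<le> breg (\<xi>' l) x (x' l)"
      using breg_nonneg[OF assms(1) subgrad_edom[OF assms(2)]] by simp
    show "\<forall>\<^sub>F l in sequentially. breg (\<xi>' l) x (x' l) \<le> (norm (\<xi>' l - \<xi>))\<^sup>2 / (4 * \<sigma>)"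
      using breg_upper[OF assms(2) assms(1)] by simp
    show "(\<lambda>l. (norm (\<xi>' l - \<xi>))\<^sup>2 / (4 * \<sigma>)) \<longlonglongrightarrow> 0"
      using tendsto_divide[OF tendsto_power[OF n, of 2] tendsto_const, of "4*\<sigma>"] \<sigma> by simp
  qed
  have "(\<lambda>l. breg \<xi> z x + breg (\<xi>' l) x (x' l) + inner (\<xi>' l - \<xi>) (x - z)) \<longlonglongrightarrow> breg \<xi> z x + 0 + inner (\<xi> - \<xi>) (x - z)"
    by (intro tendsto_intros b assms(3))
  then show "(\<lambda>l. breg (\<xi>' l) z (x' l)) \<longlonglongrightarrow> breg \<xi> z x"
    using breg_step[of "\<xi>' _" z "x' _" \<xi> x] by simp
qed

end

section \<open>Riesz representation and adjoints\<close>

text \<open>The representative of \<open>f\<close> minimises \<open>\<parallel>h\<parallel>\<^sup>2 / 2 - f h\<close>.\<close>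
lemma riesz_representation:
  fixes f :: "'a::{real_inner,complete_space} \<Rightarrow> real"
  assumes "bounded_linear f"
  shows "\<exists>g. \<forall>h. inner g h = f h"
proof -
  interpret f: bounded_linear f by fact
  obtain C where C: "C \<ge> 0" "\<And>h. norm (f h) \<le> norm h * C" using f.nonneg_bounded by blast
  let ?J = "\<lambda>h. (norm h)\<^sup>2 / 2 - f h"
  have "\<exists>g\<in>UNIV. \<forall>z\<in>UNIV. ?J g \<le> ?J z"
  proof (rule uniformly_convex_minimizer[where B="- C\<^sup>2 / 2" and \<kappa>="1/8"])
    fix h :: 'a
    have "0 \<le> (norm h - C)\<^sup>2 / 2" by simp
    then show "- C\<^sup>2 / 2 \<le> ?J h" using C(2)[of h]
      by (simp add: power2_eq_square algebra_simps abs_le_iff)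
  next
    fix x z :: 'a
    have "(norm ((1/2) *\<^sub>R (x + z)))\<^sup>2 / 2 + 1/8 * (norm (x - z))\<^sup>2 = ((norm x)\<^sup>2 / 2 + (norm z)\<^sup>2 / 2) / 2"
      unfolding power2_norm_eq_inner
      by (simp add: inner_add_left inner_add_right inner_diff_left inner_diff_right inner_commute field_simps)
    moreover have "f ((1/2) *\<^sub>R (x + z)) = (f x + f z) / 2" by (simp add: f.scaleR f.add)
    ultimately have "?J ((1/2) *\<^sub>R (x + z)) + 1/8 * (norm (x - z))\<^sup>2 \<le> (?J x + ?J z) / 2" by argo
    then show "(1/2) *\<^sub>R (x + z) \<in> UNIV \<and> ?J ((1/2) *\<^sub>R (x + z)) + 1/8 * (norm (x - z))\<^sup>2 \<le> (?J x + ?J z) / 2"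
      by blast
  next
    fix X x a assume "X \<longlonglongrightarrow> x" "(\<lambda>n. ?J (X n)) \<longlonglongrightarrow> a"
    moreover have "(\<lambda>n. ?J (X n)) \<longlonglongrightarrow> ?J x" by (intro tendsto_intros f.tendsto \<open>X \<longlonglongrightarrow> x\<close>) simp
    ultimately show "x \<in> UNIV \<and> ?J x \<le> a" using LIMSEQ_unique by blast
  qed auto
  then obtain g where g: "\<And>z. ?J g \<le> ?J z" by blast
  have "inner g h = f h" for h
  proof (cases "h = 0")
    case False
    define a where "a = inner g h - f h"
    \<comment> \<open>the minimiser of the quadratic polynomial \<open>t \<mapsto> t * a + t\<^sup>2 * \<parallel>h\<parallel>\<^sup>2 / 2\<close>, which is nonnegative\<close>
    define t where "t = - a / (norm h)\<^sup>2"
    have "?J (g + t *\<^sub>R h) = ?J g + t * a + t\<^sup>2 * (norm h)\<^sup>2 / 2"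
      unfolding power2_norm_eq_inner a_def
      by (simp add: f.add f.scaleR inner_add_left inner_add_right inner_commute algebra_simps power2_eq_square)
    then have "0 \<le> t * a + t\<^sup>2 * (norm h)\<^sup>2 / 2" using g[of "g + t *\<^sub>R h"] by simp
    also have "\<dots> = - a\<^sup>2 / (2 * (norm h)\<^sup>2)" using False by (simp add: t_def field_simps power2_eq_square)
    finally have "a\<^sup>2 \<le> 0" using False by (simp add: divide_le_0_iff zero_le_divide_iff)
    then show ?thesis by (simp add: a_def)
  qed simp
  then show ?thesis by blast
qed

lemma dual_spaceD:
  assumes "f \<in> dual_space V"
  shows "u \<in> V \<Longrightarrow> v \<in> V \<Longrightarrow> f (u + v) = f u + f v" "v \<in> V \<Longrightarrow> f (c *\<^sub>R v) = c * f v"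
  using assms by (auto simp: dual_space_def)

lemma dual_space_diff:
  assumes "f \<in> dual_space V" "subspace V" "u \<in> V" "v \<in> V" shows "f (u - v) = f u - f v"
proof -
  have "-1 *\<^sub>R v \<in> V" using assms by (intro subspace_scale)
  then show ?thesis using dual_spaceD(1)[OF assms(1,3), of "-1 *\<^sub>R v"] dual_spaceD(2)[OF assms(1,4), of "-1"] by simp
qed

lemma dual_space_zero: "f \<in> dual_space V \<Longrightarrow> subspace V \<Longrightarrow> f 0 = 0"
  using dual_spaceD(2)[of f V 0 0] subspace_0 by fastforce

lemma dual_norm_bound:
  assumes f: "f \<in> dual_space V" and V: "subspace V" and v: "v \<in> V"
  shows "\<bar>f v\<bar> \<le> dual_norm V f * norm v"
proof (cases "v = 0")
  case True then show ?thesis using dual_space_zero[OF f V] by simp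
next
  case False
  from f obtain C where C: "\<And>v. v \<in> V \<Longrightarrow> \<bar>f v\<bar> \<le> C * norm v" unfolding dual_space_def by blast
  have bdd: "bdd_above ((\<lambda>v. \<bar>f v\<bar>) ` {v \<in> V. norm v \<le> 1})"
  proof (rule bdd_aboveI2)
    fix v assume "v \<in> {v \<in> V. norm v \<le> 1}"
    then have "\<bar>f v\<bar> \<le> C * norm v" "norm v \<le> 1" using C by auto
    moreover have "C * norm v \<le> \<bar>C\<bar> * 1" by (meson abs_ge_self abs_ge_zero calculation(2) mult_mono norm_ge_zero)
    ultimately show "\<bar>f v\<bar> \<le> \<bar>C\<bar>" by simp
  qed
  let ?w = "(1 / norm v) *\<^sub>R v"
  have w: "?w \<in> {v \<in> V. norm v \<le> 1}" using v V False by (auto intro: subspace_scale)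
  have "\<bar>f ?w\<bar> \<le> dual_norm V f" unfolding dual_norm_def by (rule cSUP_upper[OF w bdd])
  then show ?thesis using dual_spaceD(2)[OF f v] False by (simp add: abs_mult field_simps)
qed

lemma dual_norm_le:
  assumes "subspace V" "C \<ge> 0" "\<And>v. v \<in> V \<Longrightarrow> \<bar>f v\<bar> \<le> C * norm v"
  shows "dual_norm V f \<le> C"
  unfolding dual_norm_def
proof (rule cSUP_least)
  show "{v \<in> V. norm v \<le> 1} \<noteq> {}" using subspace_0[OF assms(1)] by force
  fix v assume "v \<in> {v \<in> V. norm v \<le> 1}"
  then show "\<bar>f v\<bar> \<le> C" using assms(3)[of v] mult_left_mono[of "norm v" 1 C] assms(2) by auto
qed

lemma dual_adjoint_inner:
  fixes L :: "'a::{real_inner,complete_space} \<Rightarrow>\<^sub>L 'b::real_normed_vector"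
  assumes f: "f \<in> dual_space V" and L: "range (blinfun_apply L) \<subseteq> V"
  shows "inner (dual_adjoint L f) h = f (blinfun_apply L h)"
proof -
  have LV: "blinfun_apply L h \<in> V" for h using L by blast
  from f obtain C where C: "\<And>v. v \<in> V \<Longrightarrow> \<bar>f v\<bar> \<le> C * norm v" unfolding dual_space_def by blast
  have "bounded_linear (\<lambda>h. f (blinfun_apply L h))"
  proof (rule bounded_linear_intro[where K="\<bar>C\<bar> * norm L"])
    fix h
    have "\<bar>f (L h)\<bar> \<le> C * norm (L h)" using C LV by blast
    also have "\<dots> \<le> \<bar>C\<bar> * (norm L * norm h)" by (intro mult_mono norm_blinfun) auto
    finally show "norm (f (L h)) \<le> norm h * (\<bar>C\<bar> * norm L)" by (simp add: mult_ac)
  qed (use LV f in \<open>simp_all add: blinfun.add_right blinfun.scaleR_right dual_spaceD\<close>)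
  then obtain g where g: "\<forall>h. inner g h = f (L h)" using riesz_representation by blast
  have "\<forall>h. inner (dual_adjoint L f) h = f (L h)"
    unfolding dual_adjoint_def
  proof (rule theI[of "\<lambda>g. \<forall>h. inner g h = f (L h)"], rule g)
    fix g' assume "\<forall>h. inner g' h = f (L h)"
    then have "inner (g' - g) (g' - g) = 0" using g by (simp add: inner_diff_left)
    then show "g' = g" by simp
  qed
  then show ?thesis by blast
qed

section \<open>Duality mappings of uniformly smooth spaces\<close>

text \<open>For a unit vector \<open>u\<close>, these are the elements of the normalised duality set of \<open>u\<close>.\<close>
definition norming :: "'b::real_normed_vector set \<Rightarrow> 'b \<Rightarrow> ('b \<Rightarrow> real) \<Rightarrow> bool" where
  "norming V u f \<longleftrightarrow> f \<in> dual_space V \<and> (\<forall>v\<in>V. \<bar>f v\<bar> \<le> norm v) \<and> f u = 1"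

lemma uniformly_smoothE:
  fixes V :: "'b::real_normed_vector set"
  assumes sm: "uniformly_smooth V" and u: "u \<in> V" "norm u = 1" and e: "e > 0"
  obtains d where "d > 0"
    "\<And>v. v \<in> V \<Longrightarrow> norm v \<le> d \<Longrightarrow> norm (u + v) + norm (u - v) \<le> 2 + e * norm v"
proof -
  from sm[unfolded uniformly_smooth_def, rule_format, OF e] obtain d where "d > 0"
    "\<forall>u\<in>V. \<forall>v\<in>V. norm u = 1 \<and> norm v \<le> d \<longrightarrow> norm (u + v) + norm (u - v) \<le> 2 + e * norm v" by (elim exE conjE)
  then show thesis using that u by auto
qed

text \<open>The functional is the derivative of the norm at \<open>u\<close>: the one-sided directional derivative \<open>d v\<close> is
  sublinear by convexity, and smoothness says \<open>d v + d (- v) \<le> 0\<close>, which makes it linear.\<close>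
lemma norming_exists:
  fixes V :: "'b::real_normed_vector set"
  assumes V: "subspace V" and sm: "uniformly_smooth V" and u: "u \<in> V" "norm u = 1"
  shows "\<exists>f. norming V u f"
proof -
  define q where "q v t = (norm (u + t *\<^sub>R v) - 1) / t" for v :: 'b and t :: real
  define d where "d v = Inf (q v ` {0<..})" for v
  have q_bound: "\<bar>q v t\<bar> \<le> norm v" if "t > 0" for v t
  proof -
    have "\<bar>norm (u + t *\<^sub>R v) - norm u\<bar> \<le> norm (t *\<^sub>R v)"
      using norm_triangle_ineq3[of "u + t *\<^sub>R v" u] by simp
    then show ?thesis using that u by (simp add: q_def abs_divide field_simps)
  qed
  have q_lower: "- norm v \<le> q v t" if "t > 0" for v t
    using q_bound[OF that, of v] by linarith
  have bdd: "bdd_below (q v ` {0<..})" for v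
    by (rule bdd_belowI2[of _ "- norm v"]) (simp add: q_lower)
  have d_le: "d v \<le> q v t" if "t > 0" for v t
    unfolding d_def using bdd that by (auto intro!: cInf_lower)
  have d_ge: "c \<le> d v" if "\<And>t. t > 0 \<Longrightarrow> c \<le> q v t" for c v
    unfolding d_def using that by (intro cInf_greatest) auto
  have q_mono: "q v s \<le> q v t" if st: "0 < s" "s \<le> t" for v s t
  proof -
    have "u + s *\<^sub>R v = (s/t) *\<^sub>R (u + t *\<^sub>R v) + (1 - s/t) *\<^sub>R u"
      using st by (simp add: algebra_simps)
    then have "norm (u + s *\<^sub>R v) \<le> \<bar>s/t\<bar> * norm (u + t *\<^sub>R v) + \<bar>1 - s/t\<bar> * norm u"
      by (metis norm_scaleR norm_triangle_ineq)
    then have "norm (u + s *\<^sub>R v) \<le> (s/t) * norm (u + t *\<^sub>R v) + (1 - s/t) * 1"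
      using st u(2) by simp
    also have "\<dots> = 1 + s * q v t" using st by (simp add: q_def field_simps)
    finally show ?thesis using st by (simp add: q_def field_simps)
  qed
  have d_eps: "\<exists>t>0. \<forall>s. 0 < s \<and> s \<le> t \<longrightarrow> q v s < d v + e" if "e > 0" for v e
  proof -
    have "\<exists>x\<in>q v ` {0<..}. x < d v + e"
      using cInf_less_iff[of "q v ` {0<..}" "d v + e"] bdd that unfolding d_def by auto
    then obtain t where "t > 0" "q v t < d v + e" by auto
    then show ?thesis using q_mono le_less_trans by blast
  qed
  have sub: "d (v + w) \<le> d v + d w" for v w
  proof (rule field_le_epsilon)
    fix e :: real assume "e > 0"
    then obtain a b where a: "a > 0" "\<And>s. 0 < s \<and> s \<le> a \<Longrightarrow> q v s < d v + e/2"
      and b: "b > 0" "\<And>s. 0 < s \<and> s \<le> b \<Longrightarrow> q w s < d w + e/2"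
      using d_eps[of "e/2"] by (metis half_gt_zero)
    define s where "s = min a b"
    have s: "s > 0" "s \<le> a" "s \<le> b" using a b by (auto simp: s_def)
    have "u + (s/2) *\<^sub>R (v + w) = (1/2) *\<^sub>R (u + s *\<^sub>R v) + (1/2) *\<^sub>R (u + s *\<^sub>R w)"
      by (simp add: algebra_simps) (metis scaleR_half_double scaleR_right_distrib)
    then have "norm (u + (s/2) *\<^sub>R (v + w)) \<le> (1/2) * norm (u + s *\<^sub>R v) + (1/2) * norm (u + s *\<^sub>R w)"
      using norm_triangle_ineq[of "(1/2) *\<^sub>R (u + s *\<^sub>R v)" "(1/2) *\<^sub>R (u + s *\<^sub>R w)"] by simp
    then have "2 * (norm (u + (s/2) *\<^sub>R (v + w)) - 1) \<le> (norm (u + s *\<^sub>R v) - 1) + (norm (u + s *\<^sub>R w) - 1)"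
      by simp
    then have "2 * (norm (u + (s/2) *\<^sub>R (v + w)) - 1) / s \<le> ((norm (u + s *\<^sub>R v) - 1) + (norm (u + s *\<^sub>R w) - 1)) / s"
      using s(1) by (intro divide_right_mono) auto
    then have "q (v + w) (s/2) \<le> q v s + q w s" unfolding q_def add_divide_distrib by (simp add: mult.commute)
    moreover have "q v s < d v + e/2" "q w s < d w + e/2" using a b s by auto
    moreover have "d (v + w) \<le> q (v + w) (s/2)" using d_le s by simp
    ultimately show "d (v + w) \<le> d v + d w + e" by linarith
  qed
  have d0: "d 0 = 0" unfolding d_def q_def using u by (simp add: image_constant_conv)
  have neg_le: "d v + d (- v) \<le> 0" if v: "v \<in> V" for v
  proof (cases "v = 0")
    case False
    show ?thesis
    proof (rule field_le_epsilon)
      fix e :: real assume e: "e > 0"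
      then have "e / norm v > 0" using False by simp
      then obtain c where c: "c > 0" "\<And>w. w \<in> V \<Longrightarrow> norm w \<le> c \<Longrightarrow> norm (u + w) + norm (u - w) \<le> 2 + e / norm v * norm w"
        by (rule uniformly_smoothE[OF sm u]) (rule that)
      define t where "t = c / norm v"
      have t: "t > 0" using c False by (simp add: t_def)
      have "t *\<^sub>R v \<in> V" "norm (t *\<^sub>R v) \<le> c" using c(1) False v V by (auto intro: subspace_scale simp: t_def)
      then have "norm (u + t *\<^sub>R v) + norm (u - t *\<^sub>R v) \<le> 2 + e / norm v * norm (t *\<^sub>R v)" by (rule c(2))
      also have "e / norm v * norm (t *\<^sub>R v) = t * e" using t False by simp
      finally have "(norm (u + t *\<^sub>R v) - 1) + (norm (u - t *\<^sub>R v) - 1) \<le> t * e" by simp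
      then have "((norm (u + t *\<^sub>R v) - 1) + (norm (u - t *\<^sub>R v) - 1)) / t \<le> e"
        using t by (simp add: pos_divide_le_eq mult.commute)
      then have "q v t + q (- v) t \<le> e" unfolding q_def add_divide_distrib by simp
      then show "d v + d (- v) \<le> 0 + e" using d_le[OF t, of v] d_le[OF t, of "- v"] by linarith
    qed
  qed (simp add: d0)
  have neg: "d (- v) = - d v" if "v \<in> V" for v
    using neg_le[OF that] sub[of v "- v"] d0 by simp
  have add: "d (v + w) = d v + d w" if "v \<in> V" "w \<in> V" for v w
  proof -
    have "v + w \<in> V" using that V by (intro subspace_add)
    then have "- d (v + w) = d (- v + - w)" using neg[of "v + w"] by simp
    also have "\<dots> \<le> - d v + - d w" using sub[of "- v" "- w"] neg that by simp
    finally show ?thesis using sub[of v w] by simp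
  qed
  have scale_le: "d (c *\<^sub>R v) \<le> c * d v" if c: "c > 0" for c v
  proof -
    have "d (c *\<^sub>R v) / c \<le> d v"
    proof (rule d_ge)
      fix t :: real assume t: "t > 0"
      then have "d (c *\<^sub>R v) \<le> q (c *\<^sub>R v) (t / c)" using c by (intro d_le) simp
      also have "\<dots> = c * q v t" using t c by (simp add: q_def)
      finally show "d (c *\<^sub>R v) / c \<le> q v t" using c by (simp add: field_simps)
    qed
    then show ?thesis using c by (simp add: field_simps)
  qed
  have scale_pos: "d (c *\<^sub>R v) = c * d v" if c: "c > 0" for c v
  proof (rule antisym[OF scale_le[OF c]])
    have "d ((1/c) *\<^sub>R (c *\<^sub>R v)) \<le> (1/c) * d (c *\<^sub>R v)" using c by (intro scale_le) simp
    then show "c * d v \<le> d (c *\<^sub>R v)" using c by (simp add: field_simps)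
  qed
  have scale: "d (c *\<^sub>R v) = c * d v" if v: "v \<in> V" for c v
  proof -
    consider "c > 0" | "c = 0" | "c < 0" by linarith
    then show ?thesis
    proof cases
      case 3
      then have "d ((- c) *\<^sub>R v) = (- c) * d v" by (intro scale_pos) simp
      moreover have "d (- (c *\<^sub>R v)) = - d (c *\<^sub>R v)" using v V by (intro neg subspace_scale)
      ultimately show ?thesis by simp
    qed (auto simp: scale_pos d0)
  qed
  have bound: "\<bar>d v\<bar> \<le> norm v" for v
  proof -
    have "d v \<le> norm v" using d_le[of 1 v] q_bound[of 1 v] by simp
    moreover have "- norm v \<le> d v" by (rule d_ge) (rule q_lower)
    ultimately show ?thesis by simp
  qed
  have du: "d u = 1"
  proof -
    have "q u t = 1" if "t > 0" for t
    proof -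
      have "u + t *\<^sub>R u = (1 + t) *\<^sub>R u" by (simp add: algebra_simps)
      then show ?thesis using that u by (simp add: q_def)
    qed
    then have "q u ` {0<..} = {1}" by (force intro: greaterThan_iff[THEN iffD2] zero_less_one)
    then show ?thesis by (simp add: d_def)
  qed
  have "norming V u (restrict d V)"
    unfolding norming_def dual_space_def using add scale bound du u V
    by (auto simp: subspace_add subspace_scale intro!: exI[of _ 1])
  then show ?thesis by blast
qed

text \<open>Testing \<open>f\<close> on \<open>u + v\<close> and \<open>g\<close> on \<open>u - v\<close> turns the modulus of smoothness of the norm into a modulus
  of continuity of \<open>u \<mapsto> f\<close>. With \<open>w = u\<close> it gives uniqueness of the norming functional, in general it
  gives continuity of the duality mapping.\<close>
lemma norming_modulus:
  fixes V :: "'b::real_normed_vector set"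
  assumes V: "subspace V" and u: "u \<in> V" "norm u = 1" and w: "w \<in> V"
    and f: "norming V u f" and g: "norming V w g"
    and d: "d > 0" "\<And>v. v \<in> V \<Longrightarrow> norm v \<le> d \<Longrightarrow> norm (u + v) + norm (u - v) \<le> 2 + e * norm v"
    and v: "v \<in> V"
  shows "f v - g v \<le> (e + norm (u - w) / d) * norm v"
proof (cases "v = 0")
  case True then show ?thesis using f g V dual_space_zero[of f V] dual_space_zero[of g V] unfolding norming_def by simp
next
  case False
  have fD: "f \<in> dual_space V" and gD: "g \<in> dual_space V" using f g by (auto simp: norming_def)
  define c where "c = d / norm v"
  have c: "c > 0" using d False by (simp add: c_def)
  let ?v = "c *\<^sub>R v"
  have vV: "?v \<in> V" and nv: "norm ?v = d" using v V d False by (auto simp: c_def intro: subspace_scale)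
  have "f (u + ?v) \<le> norm (u + ?v)" "g (u - ?v) \<le> norm (u - ?v)" "g (w - u) \<le> norm (w - u)"
    using f g u vV w V unfolding norming_def by (meson abs_le_D1 subspace_add subspace_diff)+
  moreover have "f (u + ?v) = 1 + c * f v" "g (u - ?v) = g u - c * g v" "g (w - u) = 1 - g u"
    using f g u v vV w V by (auto simp: norming_def dual_spaceD dual_space_diff)
  moreover have "norm (u + ?v) + norm (u - ?v) \<le> 2 + e * d" using d(2)[OF vV] nv by simp
  ultimately have "c * (f v - g v) \<le> e * d + norm (u - w)" by (simp add: algebra_simps norm_minus_commute)
  then have "f v - g v \<le> (e * d + norm (u - w)) / c" using c by (simp add: field_simps)
  also have "\<dots> = (e + norm (u - w) / d) * norm v" using d False by (simp add: c_def field_simps)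
  finally show ?thesis .
qed

lemma norming_unique:
  fixes V :: "'b::real_normed_vector set"
  assumes V: "subspace V" and sm: "uniformly_smooth V" and u: "u \<in> V" "norm u = 1"
    and f: "norming V u f" and g: "norming V u g"
  shows "f = g"
proof -
  have le: "f v \<le> g v" if v: "v \<in> V" and f: "norming V u f" and g: "norming V u g" for v f g
  proof (rule field_le_epsilon)
    fix e :: real assume "e > 0"
    then have "e / (norm v + 1) > 0" by (simp add: add_nonneg_pos)
    then obtain d where d: "d > 0" "\<And>v'. v' \<in> V \<Longrightarrow> norm v' \<le> d \<Longrightarrow>
        norm (u + v') + norm (u - v') \<le> 2 + (e / (norm v + 1)) * norm v'"
      by (rule uniformly_smoothE[OF sm u]) (rule that)
    have "f v - g v \<le> (e / (norm v + 1) + norm (u - u) / d) * norm v"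
      by (rule norming_modulus[OF V u u(1) f g d v])
    also have "\<dots> = e * (norm v / (norm v + 1))" by simp
    also have "\<dots> \<le> e * 1" using \<open>e > 0\<close> by (intro mult_left_mono) (auto simp: divide_le_eq add_nonneg_pos)
    finally show "f v \<le> g v + e" by simp
  qed
  show ?thesis
  proof (rule extensionalityI)
    show "f \<in> extensional V" "g \<in> extensional V" using f g by (auto simp: norming_def dual_space_def)
  qed (use le[OF _ f g] le[OF _ g f] in force)
qed

text \<open>A value of the duality mapping, rescaled, is a norming functional of the normalised argument. So
  uniqueness and continuity carry over from norming functionals.\<close>
lemma norming_duality:
  fixes V :: "'b::real_normed_vector set"
  assumes V: "subspace V" and v: "v \<in> V" "v \<noteq> 0" and z: "\<zeta> \<in> dual_space V"
    "dual_norm V \<zeta> = norm v powr (r - 1)" "\<zeta> v = norm v powr r"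
  shows "norming V ((1 / norm v) *\<^sub>R v) (\<lambda>w\<in>V. \<zeta> w / norm v powr (r - 1))"
proof -
  let ?c = "norm v powr (r - 1)"
  have c: "?c > 0" using v by simp
  have "\<bar>\<zeta> w\<bar> \<le> ?c * norm w" if "w \<in> V" for w using dual_norm_bound[OF z(1) V that] z(2) by simp
  then have b: "\<bar>\<zeta> w / ?c\<bar> \<le> norm w" if "w \<in> V" for w using that c by (simp add: abs_divide field_simps)
  have "norm v powr r = ?c * norm v" using v by (simp add: powr_diff)
  then have one: "\<zeta> ((1 / norm v) *\<^sub>R v) / ?c = 1" using z v c by (simp add: dual_spaceD(2)[OF z(1) v(1)])
  have uV: "(1 / norm v) *\<^sub>R v \<in> V" using v V by (intro subspace_scale)
  have "(\<lambda>w\<in>V. \<zeta> w / ?c) \<in> dual_space V"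
    unfolding dual_space_def using b V
    by (auto simp: subspace_add subspace_scale dual_spaceD[OF z(1)] add_divide_distrib intro!: exI[of _ 1])
  moreover have "\<forall>x\<in>V. \<bar>(\<lambda>w\<in>V. \<zeta> w / ?c) x\<bar> \<le> norm x" using b by auto
  moreover have "(\<lambda>w\<in>V. \<zeta> w / ?c) ((1 / norm v) *\<^sub>R v) = 1" using one uV by (simp only: restrict_apply')
  ultimately show ?thesis unfolding norming_def by blast
qed

lemma duality_map_spec:
  fixes V :: "'b::real_normed_vector set"
  assumes V: "subspace V" and sm: "uniformly_smooth V" and v: "v \<in> V" and r: "1 < r"
  shows "duality_map r V v \<in> dual_space V"
    and "dual_norm V (duality_map r V v) = norm v powr (r - 1)"
    and "duality_map r V v v = norm v powr r"
proof -
  let ?P = "\<lambda>\<zeta>. \<zeta> \<in> dual_space V \<and> dual_norm V \<zeta> = norm v powr (r - 1) \<and> \<zeta> v = norm v powr r"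
  have "\<exists>!\<zeta>. ?P \<zeta>"
  proof (cases "v = 0")
    case True
    have z: "(\<lambda>w\<in>V. 0) \<in> dual_space V"
      unfolding dual_space_def using V by (auto simp: subspace_add subspace_scale intro!: exI[of _ 0])
    have "dual_norm V (\<lambda>w\<in>V. 0) \<le> 0" by (rule dual_norm_le[OF V]) auto
    moreover have "0 \<le> dual_norm V (\<lambda>w\<in>V. 0)"
      unfolding dual_norm_def using subspace_0[OF V] by (intro cSUP_upper2[where x=0] bdd_aboveI2[where M=0]) auto
    ultimately have n: "dual_norm V (\<lambda>w\<in>V. 0) = 0" by simp
    show ?thesis
    proof (rule ex1I[of _ "\<lambda>w\<in>V. 0"])
      show "?P (\<lambda>w\<in>V. 0)" using z n True r v by simp
      fix \<zeta> assume P: "?P \<zeta>"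
      show "\<zeta> = (\<lambda>w\<in>V. 0)"
      proof (rule extensionalityI)
        show "\<zeta> \<in> extensional V" using P by (auto simp: dual_space_def)
        fix w assume "w \<in> V"
        then show "\<zeta> w = (\<lambda>w\<in>V. 0) w" using dual_norm_bound[of \<zeta> V w] P V True r by simp
      qed simp
    qed
  next
    case False
    let ?c = "norm v powr (r - 1)" and ?u = "(1 / norm v) *\<^sub>R v"
    have c: "?c > 0" using False by simp
    have u: "?u \<in> V" "norm ?u = 1" using v V False by (auto intro: subspace_scale)
    obtain f where f: "norming V ?u f" using norming_exists[OF V sm u] by blast
    then have fD: "f \<in> dual_space V" and fb: "\<And>w. w \<in> V \<Longrightarrow> \<bar>f w\<bar> \<le> norm w" and f1: "f ?u = 1"
      by (auto simp: norming_def)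
    have fv: "f v = norm v" using f1 dual_spaceD(2)[OF fD v, of "1 / norm v"] False by (simp add: field_simps)
    define \<zeta> where "\<zeta> = (\<lambda>w\<in>V. ?c * f w)"
    have zb: "\<bar>\<zeta> w\<bar> \<le> ?c * norm w" if "w \<in> V" for w
      using fb[OF that] that c by (simp add: \<zeta>_def abs_mult)
    have zD: "\<zeta> \<in> dual_space V"
      unfolding dual_space_def using zb V unfolding \<zeta>_def
      by (auto simp: subspace_add subspace_scale dual_spaceD[OF fD] algebra_simps intro!: exI[of _ ?c])
    have pw: "norm v powr r = ?c * norm v" using False by (simp add: powr_diff)
    then have zv: "\<zeta> v = norm v powr r" using v by (simp add: \<zeta>_def fv)
    have "dual_norm V \<zeta> \<le> ?c" using dual_norm_le[OF V _ zb] c by simp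
    moreover have "?c * norm v \<le> dual_norm V \<zeta> * norm v"
      using dual_norm_bound[OF zD V v] unfolding zv pw by (rule order_trans[OF abs_ge_self])
    then have "?c \<le> dual_norm V \<zeta>" using False by simp
    ultimately have "dual_norm V \<zeta> = ?c" by (rule antisym)
    then have P: "?P \<zeta>" using zD zv by simp
    show ?thesis
    proof (rule ex1I[of _ \<zeta>], rule P)
      fix \<zeta>' assume P': "?P \<zeta>'"
      have same: "(\<lambda>w\<in>V. \<zeta>' w / ?c) = (\<lambda>w\<in>V. \<zeta> w / ?c)"
        using norming_unique[OF V sm u] norming_duality[OF V v False] P P' by blast
      have eq: "\<zeta>' w = \<zeta> w" if "w \<in> V" for w
      proof -
        have "\<zeta>' w / ?c = \<zeta> w / ?c" using fun_cong[OF same, of w] that by (simp only: restrict_apply')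
        then show ?thesis using c by simp
      qed
      show "\<zeta>' = \<zeta>"
        by (rule extensionalityI[of _ V]) (use P P' eq in \<open>auto simp: dual_space_def\<close>)
    qed
  qed
  then have "?P (duality_map r V v)" unfolding duality_map_def by (rule theI')
  then show "duality_map r V v \<in> dual_space V"
    "dual_norm V (duality_map r V v) = norm v powr (r - 1)"
    "duality_map r V v v = norm v powr r" by auto
qed

lemma duality_map_bound:
  fixes V :: "'b::real_normed_vector set"
  assumes "subspace V" "uniformly_smooth V" "v \<in> V" "1 < r" "w \<in> V"
  shows "\<bar>duality_map r V v w\<bar> \<le> norm v powr (r - 1) * norm w"
  using dual_norm_bound[OF duality_map_spec(1)[OF assms(1-4)] assms(1,5)] duality_map_spec(2)[OF assms(1-4)] by simp

text \<open>Norm-to-norm continuity at nonzero points; the bound relative to \<open>norm w\<close> is the dual norm of the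
  difference without a supremum.\<close>
lemma duality_map_continuous:
  fixes V :: "'b::real_normed_vector set"
  assumes V: "subspace V" and sm: "uniformly_smooth V" and r: "1 < r"
    and v: "v \<in> V" "v \<noteq> 0" and X: "\<And>k. X k \<in> V" "X \<longlonglongrightarrow> v" and e: "e > 0"
  shows "\<forall>\<^sub>F k in sequentially. \<forall>w\<in>V. \<bar>duality_map r V (X k) w - duality_map r V v w\<bar> \<le> e * norm w"
proof -
  define c where "c x = norm x powr (r - 1)" for x :: 'b
  define n where "n x = (1 / norm x) *\<^sub>R x" for x :: 'b
  have cv: "c v > 0" using v by (simp add: c_def)
  have nV: "n v \<in> V" "norm (n v) = 1" using v V by (auto simp: n_def intro: subspace_scale)
  have nX: "n (X k) \<in> V" for k using X V by (auto simp: n_def intro: subspace_scale)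
  have "e / (4 * c v) > 0" using cv e by simp
  then obtain d where d: "d > 0" "\<And>w. w \<in> V \<Longrightarrow> norm w \<le> d \<Longrightarrow>
      norm (n v + w) + norm (n v - w) \<le> 2 + (e / (4 * c v)) * norm w"
    by (rule uniformly_smoothE[OF sm nV]) (rule that)
  have tc: "(\<lambda>k. c (X k)) \<longlonglongrightarrow> c v" unfolding c_def using v by (intro tendsto_intros X) simp
  have tn: "(\<lambda>k. norm (n v - n (X k))) \<longlonglongrightarrow> norm (n v - n v)"
    unfolding n_def using v by (intro tendsto_intros X) simp
  have "\<forall>\<^sub>F k in sequentially. norm (n v - n (X k)) < d * (e / (4 * c v))"
    by (rule order_tendstoD(2)[OF tn]) (use d e cv in simp)
  moreover have "\<forall>\<^sub>F k in sequentially. \<bar>c (X k) - c v\<bar> < e / 2"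
    using tendstoD[OF tc, of "e/2"] e by (simp add: dist_real_def)
  moreover have "\<forall>\<^sub>F k in sequentially. X k \<noteq> 0" using X(2) v(2) by (rule tendsto_imp_eventually_ne)
  ultimately show ?thesis
  proof eventually_elim
    case (elim k)
    define f where "f = (\<lambda>w\<in>V. duality_map r V v w / c v)"
    define g where "g = (\<lambda>w\<in>V. duality_map r V (X k) w / c (X k))"
    have f: "norming V (n v) f" unfolding f_def n_def c_def
      using norming_duality[OF V v] duality_map_spec[OF V sm v(1) r] by blast
    have g: "norming V (n (X k)) g" unfolding g_def n_def c_def
      using norming_duality[OF V X(1) elim(3)] duality_map_spec[OF V sm X(1) r] by blast
    have cX: "c (X k) > 0" using elim(3) by (simp add: c_def)
    show ?case
    proof
      fix w assume w: "w \<in> V"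
      have half: "f w' - g w' \<le> e / (2 * c v) * norm w'" if "w' \<in> V" for w'
      proof -
        have "f w' - g w' \<le> (e / (4 * c v) + norm (n v - n (X k)) / d) * norm w'"
          by (rule norming_modulus[OF V nV nX f g d that])
        also have "\<dots> \<le> (e / (4 * c v) + e / (4 * c v)) * norm w'"
          using elim(1) d(1) by (intro mult_right_mono add_left_mono) (simp_all add: field_simps)
        finally show ?thesis by simp
      qed
      have mw: "- w \<in> V" using w V by (intro subspace_neg)
      have "f (- w) = - f w" "g (- w) = - g w"
        using f g dual_spaceD(2)[of _ V w "-1"] w by (auto simp: norming_def)
      then have "\<bar>g w - f w\<bar> \<le> e / (2 * c v) * norm w"
        using half[OF w] half[OF mw] by simp
      then have "c v * \<bar>g w - f w\<bar> \<le> c v * (e / (2 * c v) * norm w)" using cv by (intro mult_left_mono) auto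
      then have 1: "\<bar>c v * (g w - f w)\<bar> \<le> e / 2 * norm w" using cv by (simp add: abs_mult)
      have "\<bar>g w\<bar> \<le> norm w" using g w by (simp add: norming_def)
      then have 2: "\<bar>(c (X k) - c v) * g w\<bar> \<le> e / 2 * norm w"
        unfolding abs_mult using elim(2) e by (intro mult_mono) auto
      have "duality_map r V (X k) w - duality_map r V v w = (c (X k) - c v) * g w + c v * (g w - f w)"
        using w cv cX by (simp add: f_def g_def field_simps)
      then show "\<bar>duality_map r V (X k) w - duality_map r V v w\<bar> \<le> e * norm w"
        using 1 2 by (smt (verit) field_sum_of_halves distrib_right)
    qed
  qed
qed

section \<open>The setting of the method\<close>

text \<open>One locale serves noisy and exact data. The method is total in the data and the noise levels, and
  with data \<open>y\<close> and noise levels \<open>0\<close> it is the method for exact data; the facts on single steps hold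
  for all noise levels \<open>\<ge> 0\<close>.\<close>
locale shb_setting = regularizer \<Theta> \<sigma> x0 \<xi>0
  for N :: nat
    and Y :: "nat \<Rightarrow> 'b::real_normed_vector set"
    and A :: "nat \<Rightarrow> 'a::{real_inner,complete_space} set"
    and F :: "nat \<Rightarrow> 'a \<Rightarrow> 'b"
    and L :: "nat \<Rightarrow> 'a \<Rightarrow> 'a \<Rightarrow>\<^sub>L 'b"
    and y :: "nat \<Rightarrow> 'b"
    and \<Theta> :: "'a \<Rightarrow> ereal"
    and r \<sigma> \<rho> \<eta> \<mu>0 \<mu>1 \<upsilon>0 \<upsilon>1 \<tau> \<beta> :: real
    and x0 \<xi>0 :: 'a +
  assumes N: "N \<ge> 1"
    and F_range: "\<forall>i\<in>{1..N}. F i ` A i \<subseteq> Y i"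
    and B: "assumption_B N Y A F L y \<Theta> \<sigma> \<rho> \<eta> x0 \<xi>0"
    and r: "1 < r"
    and \<mu>0: "0 < \<mu>0" "\<mu>0 < 4 * \<sigma>" and \<mu>1: "\<mu>1 > 0" and \<upsilon>0: "\<upsilon>0 > 0" and \<upsilon>1: "\<upsilon>1 > 0"
    and \<beta>: "0 \<le> \<beta>" "\<beta> < 1" and \<tau>_gt: "\<tau> > (1 + \<eta>) / (1 - \<eta>)"
begin

abbreviation "Bl \<equiv> cball x0 (2 * \<rho>)"
text \<open>Reference solutions: the tangential cone condition is available only for solutions in the ball, and
  Bregman distances only for solutions in the domain of \<open>\<Theta>\<close>.\<close>
definition "Sol = solutions N A F y \<inter> Bl \<inter> edom \<Theta>"

abbreviation "res \<equiv> heavy_ball.resid F"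
abbreviation "grd \<equiv> heavy_ball.grad Y F L r"
abbreviation "tsz \<equiv> heavy_ball.step_size Y F L r \<eta> \<mu>0 \<mu>1 \<tau>"
abbreviation "mom \<equiv> heavy_ball.momentum_coeff Y F L r \<sigma> \<eta> \<mu>0 \<mu>1 \<upsilon>0 \<upsilon>1 \<tau> \<beta>"
abbreviation "stp \<equiv> heavy_ball.shb_step N Y F L \<Theta> r \<sigma> \<eta> \<mu>0 \<mu>1 \<upsilon>0 \<upsilon>1 \<tau> \<beta>"
abbreviation "run \<equiv> heavy_ball.shb N Y F L \<Theta> r \<sigma> \<eta> \<mu>0 \<mu>1 \<upsilon>0 \<upsilon>1 \<tau> \<beta> x0 \<xi>0"

definition noise :: "(nat \<Rightarrow> 'b) \<Rightarrow> (nat \<Rightarrow> real) \<Rightarrow> bool" where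
  "noise yd d \<longleftrightarrow> (\<forall>i\<in>{1..N}. yd i \<in> Y i \<and> 0 \<le> d i \<and> norm (yd i - y i) \<le> d i)"

lemma \<eta>: "0 \<le> \<eta>" "\<eta> < 1" and \<rho>: "\<rho> > 0" using B by (auto simp: assumption_B_def)

lemma \<tau>: "\<tau> > 0"
proof -
  have "0 < (1 + \<eta>) / (1 - \<eta>)" using \<eta> by simp
  then show ?thesis using \<tau>_gt by linarith
qed

lemma Y_subspace: "i \<in> {1..N} \<Longrightarrow> subspace (Y i)" and Y_smooth: "i \<in> {1..N} \<Longrightarrow> uniformly_smooth (Y i)"
  using B by (auto simp: assumption_B_def banach_subspace_def)

lemma Bl_sub: "i \<in> {1..N} \<Longrightarrow> x \<in> Bl \<Longrightarrow> x \<in> A i"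
  using B unfolding assumption_B_def by blast

lemma F_in_Y: "i \<in> {1..N} \<Longrightarrow> x \<in> Bl \<Longrightarrow> F i x \<in> Y i"
  using F_range Bl_sub by blast

lemma L_range: "i \<in> {1..N} \<Longrightarrow> x \<in> Bl \<Longrightarrow> range (blinfun_apply (L i x)) \<subseteq> Y i"
  using B unfolding assumption_B_def by blast

lemma L_in_Y: "i \<in> {1..N} \<Longrightarrow> x \<in> Bl \<Longrightarrow> blinfun_apply (L i x) h \<in> Y i"
  using L_range by blast

lemma L_continuous: "i \<in> {1..N} \<Longrightarrow> continuous_on Bl (L i)"
  using B unfolding assumption_B_def by blast

lemma tangential_cone:
  assumes "i \<in> {1..N}" "x \<in> Bl" "z \<in> Bl"
  shows "norm (F i x - F i z - blinfun_apply (L i x) (x - z)) \<le> \<eta> * norm (F i x - F i z)"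
  using B assms unfolding assumption_B_def by blast

definition B0 :: real where
  "B0 = (SOME b. b > 0 \<and> (\<forall>i\<in>{1..N}. \<forall>x\<in>Bl. norm (L i x) \<le> b))"

lemma B0: "B0 > 0" "i \<in> {1..N} \<Longrightarrow> x \<in> Bl \<Longrightarrow> norm (L i x) \<le> B0"
proof -
  have "\<exists>b>0. \<forall>i\<in>{1..N}. \<forall>x\<in>Bl. norm (L i x) \<le> b" using B unfolding assumption_B_def by blast
  then have "B0 > 0 \<and> (\<forall>i\<in>{1..N}. \<forall>x\<in>Bl. norm (L i x) \<le> B0)" unfolding B0_def by (rule someI_ex)
  then show "B0 > 0" "i \<in> {1..N} \<Longrightarrow> x \<in> Bl \<Longrightarrow> norm (L i x) \<le> B0" by auto
qed

lemma norm_L_le: "i \<in> {1..N} \<Longrightarrow> x \<in> Bl \<Longrightarrow> norm (blinfun_apply (L i x) h) \<le> B0 * norm h"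
  by (rule order_trans[OF norm_blinfun mult_right_mono]) (simp_all add: B0(2))

lemma L_difference_le:
  assumes "i \<in> {1..N}" "x \<in> Bl" "z \<in> Bl"
  shows "norm (blinfun_apply (L i x) (x - z)) \<le> (1 + \<eta>) * norm (F i x - F i z)"
proof -
  have "norm (blinfun_apply (L i x) (x - z)) \<le> norm (F i x - F i z) + norm (F i x - F i z - blinfun_apply (L i x) (x - z))"
    using norm_triangle_ineq4[of "F i x - F i z" "F i x - F i z - blinfun_apply (L i x) (x - z)"] by simp
  then show ?thesis using tangential_cone[OF assms] by (simp add: algebra_simps)
qed

text \<open>The tangential cone condition makes \<open>\<parallel>F i x - F i z\<parallel>\<close> and \<open>\<parallel>L i x (x - z)\<parallel>\<close> comparable. This half
  gives continuity of \<open>F i\<close>, and convexity of the set of solutions in the ball.\<close>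
lemma F_difference_le:
  assumes "i \<in> {1..N}" "x \<in> Bl" "z \<in> Bl"
  shows "(1 - \<eta>) * norm (F i x - F i z) \<le> norm (blinfun_apply (L i x) (x - z))"
proof -
  have "norm (F i x - F i z) \<le> norm (blinfun_apply (L i x) (x - z)) + norm (F i x - F i z - blinfun_apply (L i x) (x - z))"
    using norm_triangle_ineq[of "blinfun_apply (L i x) (x - z)" "F i x - F i z - blinfun_apply (L i x) (x - z)"] by simp
  then show ?thesis using tangential_cone[OF assms] by (simp add: algebra_simps)
qed

lemma F_tendsto:
  assumes i: "i \<in> {1..N}" and X: "\<And>n. X n \<in> Bl" "X \<longlonglongrightarrow> x"
  shows "x \<in> Bl" "(\<lambda>n. F i (X n)) \<longlonglongrightarrow> F i x"
proof -
  show x: "x \<in> Bl" using X closed_sequentially[OF closed_cball] by blast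
  have le: "norm (F i (X n) - F i x) \<le> B0 / (1 - \<eta>) * norm (X n - x)" for n
    using F_difference_le[OF i X(1) x, of n] norm_L_le[OF i X(1), of n "X n - x"] \<eta>
    by (simp add: field_simps)
  have "(\<lambda>n. B0 / (1 - \<eta>) * norm (X n - x)) \<longlonglongrightarrow> B0 / (1 - \<eta>) * norm (x - x)"
    by (intro tendsto_intros X(2))
  then have "(\<lambda>n. B0 / (1 - \<eta>) * norm (X n - x)) \<longlonglongrightarrow> 0" by simp
  from Lim_null_comparison[OF always_eventually[OF allI[OF le]] this]
  have "(\<lambda>n. F i (X n) - F i x) \<longlonglongrightarrow> 0" .
  then show "(\<lambda>n. F i (X n)) \<longlonglongrightarrow> F i x" by (rule LIM_zero_cancel)
qed

text \<open>A fixed solution close to \<open>x0\<close>; distances to it keep the iterates in the ball.\<close>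
definition zsol :: 'a where
  "zsol = (SOME z. z \<in> solutions N A F y \<inter> edom \<Theta> \<and> breg \<xi>0 z x0 \<le> \<sigma> * \<rho>\<^sup>2)"

lemma near_of_breg:
  assumes "subgrad \<xi> x" "z \<in> edom \<Theta>" "breg \<xi> z x \<le> \<sigma> * \<rho>\<^sup>2" shows "norm (z - x) \<le> \<rho>"
proof -
  have "\<sigma> * (norm (z - x))\<^sup>2 \<le> \<sigma> * \<rho>\<^sup>2" using breg_lower[OF assms(1,2)] assms(3) by simp
  then have "(norm (z - x))\<^sup>2 \<le> \<rho>\<^sup>2" using \<sigma> by simp
  then show ?thesis using \<rho> power2_le_imp_le less_imp_le by blast
qed

lemma zsol_spec: "zsol \<in> solutions N A F y \<inter> edom \<Theta>" "breg \<xi>0 zsol x0 \<le> \<sigma> * \<rho>\<^sup>2" "norm (zsol - x0) \<le> \<rho>"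
proof -
  obtain z where "z \<in> solutions N A F y \<inter> edom \<Theta>" "bregman \<Theta> \<xi>0 z x0 \<le> ereal (\<sigma> * \<rho>\<^sup>2)"
    using B unfolding assumption_B_def by blast
  then have "z \<in> solutions N A F y \<inter> edom \<Theta> \<and> breg \<xi>0 z x0 \<le> \<sigma> * \<rho>\<^sup>2"
    using bregman_eq[of z x0 \<xi>0] subgrad0 subgrad_edom by auto
  then have *: "zsol \<in> solutions N A F y \<inter> edom \<Theta> \<and> breg \<xi>0 zsol x0 \<le> \<sigma> * \<rho>\<^sup>2"
    unfolding zsol_def by (rule someI)
  then show "zsol \<in> solutions N A F y \<inter> edom \<Theta>" "breg \<xi>0 zsol x0 \<le> \<sigma> * \<rho>\<^sup>2" by auto
  show "norm (zsol - x0) \<le> \<rho>" using * near_of_breg[OF subgrad0] by auto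
qed

lemma zsol_Sol: "zsol \<in> Sol"
  using zsol_spec \<rho> by (auto simp: Sol_def dist_norm norm_minus_commute)

lemma Sol_F: "z \<in> Sol \<Longrightarrow> i \<in> {1..N} \<Longrightarrow> F i z = y i"
  and Sol_Bl: "z \<in> Sol \<Longrightarrow> z \<in> Bl" and Sol_edom: "z \<in> Sol \<Longrightarrow> z \<in> edom \<Theta>"
  by (auto simp: Sol_def solutions_def)

lemma SolI: "z \<in> Bl \<Longrightarrow> z \<in> edom \<Theta> \<Longrightarrow> (\<And>i. i \<in> {1..N} \<Longrightarrow> F i z = y i) \<Longrightarrow> z \<in> Sol"
  using Bl_sub by (auto simp: Sol_def solutions_def)

lemma y_in_Y: "i \<in> {1..N} \<Longrightarrow> y i \<in> Y i"
  using F_in_Y[of i zsol] Sol_F[OF zsol_Sol, of i] Sol_Bl[OF zsol_Sol] by simp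

lemma noise_exact: "noise y (\<lambda>_. 0)" by (simp add: noise_def y_in_Y)

lemma res_in_Y: "noise yd d \<Longrightarrow> i \<in> {1..N} \<Longrightarrow> x \<in> Bl \<Longrightarrow> res yd i x \<in> Y i"
  unfolding heavy_ball.resid_def noise_def using F_in_Y Y_subspace by (auto intro!: subspace_diff)

lemma grd_inner:
  assumes "noise yd d" "i \<in> {1..N}" "x \<in> Bl"
  shows "inner (grd yd i x) h = duality_map r (Y i) (res yd i x) (blinfun_apply (L i x) h)"
  unfolding heavy_ball.grad_def
  by (rule dual_adjoint_inner[OF duality_map_spec(1)])
    (use assms Y_subspace Y_smooth r res_in_Y L_range in blast)+

lemma grd_inner_le:
  assumes "noise yd d" "i \<in> {1..N}" "x \<in> Bl"
  shows "\<bar>inner (grd yd i x) h\<bar> \<le> norm (res yd i x) powr (r - 1) * norm (blinfun_apply (L i x) h)"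
  unfolding grd_inner[OF assms]
  by (rule duality_map_bound) (use assms Y_subspace Y_smooth r res_in_Y L_in_Y in blast)+

lemma norm_grd_le:
  assumes "noise yd d" "i \<in> {1..N}" "x \<in> Bl"
  shows "norm (grd yd i x) \<le> norm (res yd i x) powr (r - 1) * B0"
proof -
  let ?g = "grd yd i x" and ?c = "norm (res yd i x) powr (r - 1)"
  have "norm ?g * norm ?g \<le> ?c * norm (blinfun_apply (L i x) ?g)"
    using grd_inner_le[OF assms, of ?g] by (simp add: norm_eq_sqrt_inner)
  also have "\<dots> \<le> ?c * (B0 * norm ?g)" using assms by (intro mult_left_mono norm_L_le) auto
  finally have "norm ?g * norm ?g \<le> (?c * B0) * norm ?g" by (simp add: mult_ac)
  then show ?thesis using B0(1) by (cases "?g = 0") auto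
qed

text \<open>The step direction points away from every reference solution. The pairing is \<open>\<langle>J r, L (x - z)\<rangle>\<close>; by
  the tangential cone condition \<open>L (x - z)\<close> differs from the residual, on which \<open>J r\<close> attains its
  norm, by at most \<open>\<eta> * R + (1 + \<eta>) * d i\<close>.\<close>
lemma grd_pairing_lower:
  assumes nz: "noise yd d" and i: "i \<in> {1..N}" and x: "x \<in> Bl" and z: "z \<in> Sol"
  shows "((1 - \<eta>) * norm (res yd i x) - (1 + \<eta>) * d i) * norm (res yd i x) powr (r - 1) \<le> inner (grd yd i x) (x - z)"
proof -
  let ?R = "norm (res yd i x)" and ?J = "duality_map r (Y i) (res yd i x)" and ?h = "blinfun_apply (L i x) (x - z)"
  note Y = Y_subspace[OF i] Y_smooth[OF i]
  note rY = res_in_Y[OF nz i x]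
  have JD: "?J \<in> dual_space (Y i)" "?J (res yd i x) = ?R powr r"
    using duality_map_spec[OF Y rY r] by auto
  have hY: "?h \<in> Y i" using L_in_Y i x by blast
  have dY: "res yd i x - ?h \<in> Y i" using subspace_diff Y rY hY by blast
  have FR: "norm (F i x - F i z) \<le> ?R + d i"
  proof -
    have "F i x - F i z = res yd i x + (yd i - y i)" using Sol_F[OF z i] by (simp add: heavy_ball.resid_def)
    then have "norm (F i x - F i z) \<le> ?R + norm (yd i - y i)" by (metis norm_triangle_ineq)
    then show ?thesis using nz i by (force simp: noise_def)
  qed
  have "res yd i x - ?h = (F i x - F i z - ?h) - (yd i - y i)"
    using Sol_F[OF z i] by (simp add: heavy_ball.resid_def)
  then have "norm (res yd i x - ?h) \<le> norm (F i x - F i z - ?h) + norm (yd i - y i)"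
    by (metis norm_triangle_ineq4)
  also have "\<dots> \<le> \<eta> * norm (F i x - F i z) + d i"
    using tangential_cone[OF i x Sol_Bl[OF z]] nz i by (auto simp: noise_def intro!: add_mono)
  also have "\<dots> \<le> \<eta> * (?R + d i) + d i"
    using mult_left_mono[OF FR \<eta>(1)] by simp
  finally have "norm (res yd i x - ?h) \<le> \<eta> * ?R + (1 + \<eta>) * d i"
    by (simp add: algebra_simps)
  then have "?R powr (r - 1) * norm (res yd i x - ?h) \<le> ?R powr (r - 1) * (\<eta> * ?R + (1 + \<eta>) * d i)"
    by (intro mult_left_mono) auto
  moreover have "?J (res yd i x - ?h) \<le> ?R powr (r - 1) * norm (res yd i x - ?h)"
    using duality_map_bound[OF Y rY r dY] by linarith
  moreover have "?J (res yd i x - ?h) = ?R powr r - ?J ?h"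
    using dual_space_diff[OF JD(1) Y(1) rY hY] JD(2) by simp
  moreover have "?R powr r = ?R powr (r - 1) * ?R" using r by (cases "?R = 0") (auto simp: powr_diff)
  moreover have "inner (grd yd i x) (x - z) = ?J ?h" by (rule grd_inner[OF nz i x])
  ultimately show ?thesis by (simp add: algebra_simps)
qed

section \<open>Step sizes and the decrease in one step\<close>

text \<open>Above the discrepancy threshold \<open>\<tau> * d i\<close>, the constant \<open>c0\<close> bounds the relative surplus of the
  residual over the noise, and \<open>c1 * R powr (2 - r)\<close> bounds the step size, both from below.\<close>
definition c0 :: real where "c0 = (1 - \<eta>) - (1 + \<eta>) / \<tau>"
definition c1 :: real where "c1 = min (\<mu>0 * c0 / B0\<^sup>2) \<mu>1"

lemma c0: "c0 > 0" using \<tau>_gt \<tau> \<eta> by (simp add: c0_def field_simps)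
lemma c1: "c1 > 0" using c0 \<mu>0 \<mu>1 B0 by (simp add: c1_def)

lemma discrepancy_gap:
  assumes "R > \<tau> * e" shows "c0 * R \<le> (1 - \<eta>) * R - (1 + \<eta>) * e"
proof -
  have "(1 + \<eta>) * e \<le> (1 + \<eta>) * (R / \<tau>)"
    using assms \<tau> \<eta> by (intro mult_left_mono) (auto simp: field_simps)
  then show ?thesis by (simp add: c0_def algebra_simps)
qed

text \<open>The product of \<open>t\<close> and \<open>R powr (r - 1)\<close> is comparable to \<open>R\<close>; it is the natural size of a step since
  \<open>norm g \<le> R powr (r - 1) * B0\<close>. The last claim is the purpose of the first term in the minimum defining
  \<open>t\<close>: the second-order term of a gradient step is at most the fraction \<open>\<mu>0 / (4 * \<sigma>)\<close> of the first-order gain.\<close>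
lemma step_size_bounds:
  assumes nz: "noise yd d" and i: "i \<in> {1..N}" and x: "x \<in> Bl"
  defines "R \<equiv> norm (res yd i x)" and "t \<equiv> tsz yd d i x" and "g \<equiv> grd yd i x"
  shows tsz_nonneg: "0 \<le> t"
    and tsz_upper: "t * R powr (r - 1) \<le> \<mu>1 * R"
    and tsz_lower: "R > \<tau> * d i \<Longrightarrow> c1 * R \<le> t * R powr (r - 1)"
    and tsz_zero: "R \<le> \<tau> * d i \<Longrightarrow> t = 0"
    and tsz_grd: "t\<^sup>2 * (norm g)\<^sup>2 \<le> \<mu>0 * (t * ((1 - \<eta>) * R - (1 + \<eta>) * d i) * R powr (r - 1))"
proof -
  let ?q = "\<mu>0 * ((1 - \<eta>) * R - (1 + \<eta>) * d i) * R powr (r - 1) / (norm g)\<^sup>2" and ?b = "\<mu>1 * R powr (2 - r)"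
  have t: "t = (if R > \<tau> * d i then if g = 0 then ?b else min ?q ?b else 0)"
    unfolding t_def heavy_ball.step_size_def R_def g_def by (simp add: Let_def)
  have d: "0 \<le> d i" using nz i by (auto simp: noise_def)
  show tz: "R \<le> \<tau> * d i \<Longrightarrow> t = 0" using t by simp
  have R0: "R > 0" if "R > \<tau> * d i" using that d \<tau> by (smt (verit) mult_nonneg_nonneg)
  have pw: "R powr (2 - r) * R powr (r - 1) = R" if "R > 0" using that by (simp add: powr_add[symmetric])
  have gap: "c0 * R \<le> (1 - \<eta>) * R - (1 + \<eta>) * d i" if "R > \<tau> * d i"
    using discrepancy_gap that by blast
  have q_lower: "\<mu>0 * c0 / B0\<^sup>2 * R powr (2 - r) \<le> ?q" if *: "R > \<tau> * d i" "g \<noteq> 0"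
  proof -
    note R0 = R0[OF *(1)]
    have "(norm g)\<^sup>2 \<le> (R powr (r - 1) * B0)\<^sup>2"
      using norm_grd_le[OF nz i x] by (intro power_mono) (auto simp: g_def R_def)
    then have gb: "(norm g)\<^sup>2 \<le> (R powr (r - 1))\<^sup>2 * B0\<^sup>2" by (simp add: power_mult_distrib)
    have "\<mu>0 * c0 / B0\<^sup>2 * R powr (2 - r) = \<mu>0 * (c0 * R) * R powr (r - 1) / ((R powr (r - 1))\<^sup>2 * B0\<^sup>2)"
    proof -
      have "R powr (2 - r) = R / R powr (r - 1)" using pw[OF R0] R0 by (simp add: field_simps)
      then show ?thesis using R0 B0(1) by (simp add: field_simps power2_eq_square)
    qed
    also have "\<dots> \<le> ?q"
    proof (rule frac_le)
      show "0 \<le> \<mu>0 * ((1 - \<eta>) * R - (1 + \<eta>) * d i) * R powr (r - 1)"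
        using gap[OF *(1)] c0 R0 \<mu>0 by (smt (verit) mult_nonneg_nonneg mult_pos_pos powr_ge_zero)
      show "\<mu>0 * (c0 * R) * R powr (r - 1) \<le> \<mu>0 * ((1 - \<eta>) * R - (1 + \<eta>) * d i) * R powr (r - 1)"
        using gap[OF *(1)] \<mu>0 by (intro mult_right_mono mult_left_mono) auto
    qed (use gb * in auto)
    finally show ?thesis .
  qed
  have lower: "c1 * R powr (2 - r) \<le> t" if *: "R > \<tau> * d i"
  proof -
    have "c1 * R powr (2 - r) \<le> ?b" "c1 * R powr (2 - r) \<le> \<mu>0 * c0 / B0\<^sup>2 * R powr (2 - r)"
      unfolding c1_def by (intro mult_right_mono; simp)+
    then show ?thesis using t * q_lower by auto
  qed
  show "R > \<tau> * d i \<Longrightarrow> c1 * R \<le> t * R powr (r - 1)"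
    using mult_right_mono[OF lower, of "R powr (r - 1)"] pw R0 by (simp add: mult.assoc)
  show t0: "0 \<le> t"
  proof (cases "R > \<tau> * d i")
    case True
    then show ?thesis using lower c1 by (smt (verit) mult_nonneg_nonneg powr_ge_zero)
  qed (use t in simp)
  show "t * R powr (r - 1) \<le> \<mu>1 * R"
  proof (cases "R > \<tau> * d i")
    case True
    have "t \<le> ?b" using t True by simp
    then have "t * R powr (r - 1) \<le> ?b * R powr (r - 1)" by (intro mult_right_mono) auto
    then show ?thesis using pw[OF R0[OF True]] by (simp add: mult.assoc)
  qed (use t \<mu>1 R_def in simp)
  show "t\<^sup>2 * (norm g)\<^sup>2 \<le> \<mu>0 * (t * ((1 - \<eta>) * R - (1 + \<eta>) * d i) * R powr (r - 1))"
  proof (cases "R > \<tau> * d i")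
    case True
    note R0 = R0[OF True]
    have p: "0 \<le> \<mu>0 * ((1 - \<eta>) * R - (1 + \<eta>) * d i) * R powr (r - 1)"
      using gap[OF True] c0 R0 \<mu>0 by (smt (verit) mult_nonneg_nonneg mult_pos_pos powr_ge_zero)
    have "t * (norm g)\<^sup>2 \<le> \<mu>0 * ((1 - \<eta>) * R - (1 + \<eta>) * d i) * R powr (r - 1)"
    proof (cases "g = 0")
      case False
      then have "t \<le> ?q" using t True by simp
      then show ?thesis using False by (simp add: pos_le_divide_eq)
    qed (use p in simp)
    from mult_left_mono[OF this t0] show ?thesis by (simp add: power2_eq_square mult_ac)
  qed (use t in simp)
qed

text \<open>The guaranteed first-order gain of a gradient step, that is the step size times the lower bound in
  \<open>grd_pairing_lower\<close>.\<close>
definition loss :: "(nat \<Rightarrow> 'b) \<Rightarrow> (nat \<Rightarrow> real) \<Rightarrow> nat \<Rightarrow> 'a \<Rightarrow> real" where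
  "loss yd d i x = tsz yd d i x * ((1 - \<eta>) * norm (res yd i x) - (1 + \<eta>) * d i) * norm (res yd i x) powr (r - 1)"

lemma loss_lower:
  assumes nz: "noise yd d" and i: "i \<in> {1..N}" and x: "x \<in> Bl" and R: "norm (res yd i x) > \<tau> * d i"
  shows "c0 * c1 * (norm (res yd i x))\<^sup>2 \<le> loss yd d i x"
proof -
  let ?R = "norm (res yd i x)"
  have 1: "c1 * ?R \<le> tsz yd d i x * ?R powr (r - 1)" by (rule tsz_lower[OF nz i x R])
  have 2: "c0 * ?R \<le> (1 - \<eta>) * ?R - (1 + \<eta>) * d i" by (rule discrepancy_gap[OF R])
  have "(c0 * ?R) * (c1 * ?R) \<le> ((1 - \<eta>) * ?R - (1 + \<eta>) * d i) * (tsz yd d i x * ?R powr (r - 1))"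
  proof (rule mult_mono[OF 2 1])
    have "0 \<le> c0 * ?R" using c0 by simp
    then show "0 \<le> (1 - \<eta>) * ?R - (1 + \<eta>) * d i" using 2 by linarith
    show "0 \<le> c1 * ?R" using c1 by simp
  qed
  then show ?thesis by (simp add: loss_def power2_eq_square mult_ac)
qed

lemma loss_nonneg:
  assumes nz: "noise yd d" and i: "i \<in> {1..N}" and x: "x \<in> Bl"
  shows "0 \<le> loss yd d i x"
proof (cases "norm (res yd i x) > \<tau> * d i")
  case True
  have "0 \<le> c0 * c1 * (norm (res yd i x))\<^sup>2" using c0 c1 by simp
  then show ?thesis using loss_lower[OF nz i x True] by linarith
next
  case False
  then show ?thesis using tsz_zero[OF nz i x] by (simp add: loss_def)
qed

text \<open>The terms of the descent inequality that contain \<open>b\<close> form a quadratic polynomial in \<open>b\<close> vanishing at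
  \<open>0\<close>. The coefficient is chosen between \<open>0\<close> and its minimiser, so the momentum never hurts and gains
  at least \<open>b\<^sup>2 * \<parallel>m\<parallel>\<^sup>2 / (4 * \<sigma>)\<close>. A nonzero coefficient is bounded away from zero in terms of the noise
  level, which is what forces the method to stop.\<close>
lemma momentum_coeff_bounds:
  fixes s :: "'a shb_state"
  assumes nz: "noise yd d" and i: "i \<in> {1..N}"
  defines "b \<equiv> mom yd d i s" and "m \<equiv> momentum s" and "t \<equiv> tsz yd d i (primal_it s)" and "g \<equiv> grd yd i (primal_it s)"
  shows mom_bounds: "0 \<le> b" "b \<le> \<beta>"
    and mom_descent: "b * gam s + (b\<^sup>2 * (norm m)\<^sup>2 - 2 * t * b * inner g m) / (4 * \<sigma>) \<le> - (b\<^sup>2 * (norm m)\<^sup>2 / (4 * \<sigma>))"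
    and mom_lower: "b \<noteq> 0 \<Longrightarrow> min (2 * \<sigma> * \<upsilon>1 * d i) \<beta> \<le> b \<and> \<upsilon>0 * d i < norm m \<and> \<beta> > 0"
proof -
  let ?c = "norm m > \<upsilon>0 * d i \<and> gam s - t / (2 * \<sigma>) * inner g m < - \<upsilon>1 * d i * (norm m)\<^sup>2"
  let ?bs = "(t * inner g m - 2 * \<sigma> * gam s) / (norm m)\<^sup>2"
  have b: "b = (if ?c then min ?bs \<beta> else 0)"
    unfolding b_def m_def t_def g_def heavy_ball.momentum_coeff_def by (simp add: Let_def)
  have d: "0 \<le> d i" using nz i by (auto simp: noise_def)
  have m0: "norm m > 0" if ?c using that \<upsilon>0 d by (smt (verit) mult_nonneg_nonneg)
  have bs: "?bs > 2 * \<sigma> * \<upsilon>1 * d i" if c: ?c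
  proof -
    have "2 * \<sigma> * (gam s - t / (2 * \<sigma>) * inner g m) < 2 * \<sigma> * (- \<upsilon>1 * d i * (norm m)\<^sup>2)"
      using c \<sigma> by (intro mult_strict_left_mono) auto
    then have "2 * \<sigma> * \<upsilon>1 * d i * (norm m)\<^sup>2 < t * inner g m - 2 * \<sigma> * gam s"
      using \<sigma> by (simp add: algebra_simps)
    then show ?thesis using m0[OF c] by (simp add: pos_less_divide_eq)
  qed
  have nn: "0 \<le> 2 * \<sigma> * \<upsilon>1 * d i" using \<sigma> \<upsilon>1 d by simp
  show b0: "0 \<le> b" and "b \<le> \<beta>" using b bs nn \<beta> by (auto split: if_splits)
  show "b \<noteq> 0 \<Longrightarrow> min (2 * \<sigma> * \<upsilon>1 * d i) \<beta> \<le> b \<and> \<upsilon>0 * d i < norm m \<and> \<beta> > 0"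
    using b bs nn \<beta> by (auto split: if_splits simp: min_def)
  show "b * gam s + (b\<^sup>2 * (norm m)\<^sup>2 - 2 * t * b * inner g m) / (4 * \<sigma>) \<le> - (b\<^sup>2 * (norm m)\<^sup>2 / (4 * \<sigma>))"
  proof (cases ?c)
    case True
    have "b \<le> ?bs" using b True by simp
    then have "b * (norm m)\<^sup>2 \<le> t * inner g m - 2 * \<sigma> * gam s"
      using m0[OF True] by (simp add: pos_le_divide_eq)
    from mult_left_mono[OF this b0]
    have "b\<^sup>2 * (norm m)\<^sup>2 \<le> b * (t * inner g m - 2 * \<sigma> * gam s)" by (simp add: power2_eq_square mult.assoc)
    then have "0 \<le> (b * (t * inner g m - 2 * \<sigma> * gam s) - b\<^sup>2 * (norm m)\<^sup>2) / (2 * \<sigma>)" using \<sigma> by simp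
    moreover have "b * gam s + (b\<^sup>2 * (norm m)\<^sup>2 - 2 * t * b * inner g m) / (4 * \<sigma>) + b\<^sup>2 * (norm m)\<^sup>2 / (4 * \<sigma>)
        = - ((b * (t * inner g m - 2 * \<sigma> * gam s) - b\<^sup>2 * (norm m)\<^sup>2) / (2 * \<sigma>))"
      using \<sigma> by (simp add: field_simps)
    ultimately show ?thesis by linarith
  next
    case False
    then have "b = 0" unfolding b by (rule if_not_P)
    then show ?thesis by simp
  qed
qed

lemma stp_simps:
  fixes s :: "'a shb_state"
  defines "x \<equiv> primal_it s"
  shows "dual_it (stp yd d i s) = dual_it s - tsz yd d i x *\<^sub>R grd yd i x + mom yd d i s *\<^sub>R momentum s"
    and "primal_it (stp yd d i s) = conj_grad (dual_it (stp yd d i s))"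
    and "momentum (stp yd d i s) = - tsz yd d i x *\<^sub>R grd yd i x + mom yd d i s *\<^sub>R momentum s"
    and "gam (stp yd d i s) = inner (momentum (stp yd d i s)) (primal_it (stp yd d i s) - x)
            - loss yd d i x + mom yd d i s * gam s"
    and "active (stp yd d i s) = (if tsz yd d i x = 0 \<and> mom yd d i s = 0 then active s - {i} else {1..N})"
proof -
  show "dual_it (stp yd d i s) = dual_it s - tsz yd d i x *\<^sub>R grd yd i x + mom yd d i s *\<^sub>R momentum s"
    "primal_it (stp yd d i s) = conj_grad (dual_it (stp yd d i s))"
    "momentum (stp yd d i s) = - tsz yd d i x *\<^sub>R grd yd i x + mom yd d i s *\<^sub>R momentum s"
    "active (stp yd d i s) = (if tsz yd d i x = 0 \<and> mom yd d i s = 0 then active s - {i} else {1..N})"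
    unfolding heavy_ball.shb_step_def conj_grad_def x_def by (simp_all add: Let_def)
  let ?R = "norm (res yd i x)"
  have "?R powr r = ?R * ?R powr (r - 1)" using r by (cases "?R = 0") (auto simp: powr_diff)
  then show "gam (stp yd d i s) = inner (momentum (stp yd d i s)) (primal_it (stp yd d i s) - x)
            - loss yd d i x + mom yd d i s * gam s"
    unfolding heavy_ball.shb_step_def loss_def x_def by (simp add: Let_def algebra_simps)
qed

text \<open>The invariant of the iteration. Its last part is the meaning of the recursively computed \<open>gam\<close>: an
  upper bound, free of the unknown solutions, for the pairing of the momentum with the error.\<close>
definition admissible :: "'a shb_state \<Rightarrow> bool" where
  "admissible s \<longleftrightarrow> subgrad (dual_it s) (primal_it s) \<and> breg (dual_it s) zsol (primal_it s) \<le> \<sigma> * \<rho>\<^sup>2 \<and>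
     (\<forall>z\<in>Sol. inner (momentum s) (primal_it s - z) \<le> gam s)"

lemma admissible_Bl: assumes "admissible s" shows "primal_it s \<in> Bl"
proof -
  have "norm (zsol - primal_it s) \<le> \<rho>"
    using assms near_of_breg zsol_Sol Sol_edom unfolding admissible_def by blast
  moreover have "norm (x0 - primal_it s) \<le> norm (zsol - primal_it s) + norm (zsol - x0)"
    by (metis diff_add_cancel add.commute diff_diff_eq2 norm_minus_commute norm_triangle_ineq)
  ultimately show ?thesis using zsol_spec(3) by (simp add: dist_norm)
qed

text \<open>The increment of the dual variable, paired with the error before the step. The right-hand side enters
  both the recursion for \<open>gam\<close> and the descent inequality.\<close>
lemma momentum_step_le:
  assumes nz: "noise yd d" and i: "i \<in> {1..N}" and s: "admissible s" and z: "z \<in> Sol"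
  shows "inner (momentum (stp yd d i s)) (primal_it s - z)
    \<le> mom yd d i s * gam s - loss yd d i (primal_it s)"
proof -
  let ?x = "primal_it s" and ?R = "norm (res yd i (primal_it s))"
  note x = admissible_Bl[OF s]
  have "tsz yd d i ?x * (((1 - \<eta>) * ?R - (1 + \<eta>) * d i) * ?R powr (r - 1))
      \<le> tsz yd d i ?x * inner (grd yd i ?x) (?x - z)"
    by (rule mult_left_mono[OF grd_pairing_lower[OF nz i x z] tsz_nonneg[OF nz i x]])
  moreover have "inner (momentum s) (?x - z) \<le> gam s" using s z by (simp add: admissible_def)
  then have "mom yd d i s * inner (momentum s) (?x - z) \<le> mom yd d i s * gam s"
    by (rule mult_left_mono[OF _ mom_bounds(1)[OF nz i]])
  ultimately show ?thesis
    unfolding stp_simps(3) by (simp add: loss_def mult.assoc inner_diff_left inner_add_left)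
qed

definition "\<theta> = 1 - \<mu>0 / (4 * \<sigma>)"

lemma \<theta>: "\<theta> > 0" using \<mu>0 \<sigma> by (simp add: \<theta>_def field_simps)

text \<open>The basic descent inequality. The condition \<open>\<mu>0 < 4 * \<sigma>\<close> leaves the fraction \<open>\<theta>\<close> of the gain of the
  gradient step.\<close>
lemma breg_decrease:
  assumes nz: "noise yd d" and i: "i \<in> {1..N}" and s: "admissible s" and z: "z \<in> Sol"
  shows "breg (dual_it (stp yd d i s)) z (primal_it (stp yd d i s)) + \<theta> * loss yd d i (primal_it s)
      + (mom yd d i s)\<^sup>2 * (norm (momentum s))\<^sup>2 / (4 * \<sigma>) \<le> breg (dual_it s) z (primal_it s)"
proof -
  let ?x = "primal_it s" and ?s = "stp yd d i s"
  let ?t = "tsz yd d i ?x" and ?g = "grd yd i ?x" and ?b = "mom yd d i s" and ?m = "momentum s"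
  note x = admissible_Bl[OF s]
  have sub: "subgrad (dual_it s) ?x" using s by (simp add: admissible_def)
  have sub': "subgrad (dual_it ?s) (primal_it ?s)" unfolding stp_simps(2) by (rule subgrad_conj_grad)
  have dm: "dual_it ?s - dual_it s = momentum ?s" by (simp add: stp_simps(1,3))
  have "(norm (- ?t *\<^sub>R ?g + ?b *\<^sub>R ?m))\<^sup>2 = ?t\<^sup>2 * (norm ?g)\<^sup>2 + (?b\<^sup>2 * (norm ?m)\<^sup>2 - 2 * ?t * ?b * inner ?g ?m)"
    unfolding power2_norm_eq_inner by (simp add: inner_add_left inner_add_right inner_diff_left inner_diff_right inner_commute power2_eq_square algebra_simps)
  then have n: "(norm (momentum ?s))\<^sup>2 / (4 * \<sigma>)
      = ?t\<^sup>2 * (norm ?g)\<^sup>2 / (4 * \<sigma>) + (?b\<^sup>2 * (norm ?m)\<^sup>2 - 2 * ?t * ?b * inner ?g ?m) / (4 * \<sigma>)"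
    unfolding stp_simps(3) by (simp add: add_divide_distrib)
  have "?t\<^sup>2 * (norm ?g)\<^sup>2 \<le> \<mu>0 * loss yd d i ?x" using tsz_grd[OF nz i x] by (simp add: loss_def)
  then have g: "?t\<^sup>2 * (norm ?g)\<^sup>2 / (4 * \<sigma>) \<le> \<mu>0 * loss yd d i ?x / (4 * \<sigma>)" using \<sigma> by (simp add: divide_right_mono)
  have "\<theta> * loss yd d i ?x = loss yd d i ?x - \<mu>0 * loss yd d i ?x / (4 * \<sigma>)"
    by (simp add: \<theta>_def left_diff_distrib)
  then show ?thesis
    using breg_descent[OF sub sub', of z] n g momentum_step_le[OF nz i s z] mom_descent[OF nz i, of s]
    unfolding dm by linarith
qed

lemma admissible_stp:
  assumes nz: "noise yd d" and i: "i \<in> {1..N}" and s: "admissible s"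
  shows "admissible (stp yd d i s)"
proof -
  let ?x = "primal_it s" and ?s = "stp yd d i s"
  note x = admissible_Bl[OF s]
  have "breg (dual_it ?s) zsol (primal_it ?s) \<le> breg (dual_it s) zsol ?x"
  proof -
    have "0 \<le> \<theta> * loss yd d i ?x" using loss_nonneg[OF nz i x] \<theta> by simp
    moreover have "0 \<le> (mom yd d i s)\<^sup>2 * (norm (momentum s))\<^sup>2 / (4 * \<sigma>)" using \<sigma> by simp
    ultimately show ?thesis using breg_decrease[OF nz i s zsol_Sol] by linarith
  qed
  moreover have "subgrad (dual_it ?s) (primal_it ?s)" unfolding stp_simps(2) by (rule subgrad_conj_grad)
  moreover have "inner (momentum ?s) (primal_it ?s - z) \<le> gam ?s" if z: "z \<in> Sol" for z
  proof -
    have "inner (momentum ?s) (primal_it ?s - z) = inner (momentum ?s) (primal_it ?s - ?x) + inner (momentum ?s) (?x - z)"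
      by (simp add: inner_diff_right)
    then show ?thesis using momentum_step_le[OF nz i s z] unfolding stp_simps(4) by linarith
  qed
  ultimately show ?thesis using s by (auto simp: admissible_def)
qed

lemma admissible_run:
  assumes "noise yd d" "\<forall>n. j n \<in> {1..N}" shows "admissible (run yd d j n)"
proof (induction n)
  case 0
  show ?case using subgrad0 zsol_spec by (simp add: heavy_ball.shb.simps admissible_def)
next
  case (Suc n)
  then show ?case using admissible_stp[OF assms(1)] assms(2) by (simp add: heavy_ball.shb.simps)
qed

lemma run_breg_mono:
  assumes nz: "noise yd d" and j: "\<forall>n. j n \<in> {1..N}" and z: "z \<in> Sol"
  shows "decseq (\<lambda>n. breg (dual_it (run yd d j n)) z (primal_it (run yd d j n)))"
proof (rule decseq_SucI)
  fix n
  let ?s = "run yd d j n"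
  note s = admissible_run[OF nz j, of n]
  have "0 \<le> \<theta> * loss yd d (j n) (primal_it ?s)" using loss_nonneg[OF nz _ admissible_Bl[OF s], of "j n"] j \<theta> by simp
  moreover have "0 \<le> (mom yd d (j n) ?s)\<^sup>2 * (norm (momentum ?s))\<^sup>2 / (4 * \<sigma>)" using \<sigma> by simp
  ultimately show "breg (dual_it (run yd d j (Suc n))) z (primal_it (run yd d j (Suc n)))
      \<le> breg (dual_it (run yd d j n)) z (primal_it (run yd d j n))"
    using breg_decrease[OF nz j[rule_format, of n] s z] by (simp add: heavy_ball.shb.simps)
qed

end

section \<open>Convergence for exact data along a path\<close>

text \<open>The convolution of \<open>f\<close> with the powers of \<open>b\<close>, which is how past gradient steps enter the momentum.\<close>
primrec damped :: "real \<Rightarrow> (nat \<Rightarrow> real) \<Rightarrow> nat \<Rightarrow> real" where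
  "damped b f 0 = 0"
| "damped b f (Suc n) = f n + b * damped b f n"

lemma damped_nonneg: "0 \<le> b \<Longrightarrow> (\<And>n. 0 \<le> f n) \<Longrightarrow> 0 \<le> damped b f n"
  by (induction n) auto

lemma damped_summable:
  assumes b: "0 \<le> b" "b < 1" and f: "\<And>n. 0 \<le> f n" "summable f"
  shows "summable (damped b f)" "suminf (damped b f) \<le> suminf f / (1 - b)"
proof -
  note nn = damped_nonneg[of b f, OF b(1) f(1)]
  have le: "(\<Sum>k<n. damped b f k) \<le> suminf f / (1 - b)" for n
  proof (cases n)
    case 0
    then show ?thesis using b suminf_nonneg[OF f(2) f(1)] by simp
  next
    case (Suc m)
    \<comment> \<open>summing the recursion gives \<open>S \<le> suminf f + b * S\<close> for every partial sum \<open>S\<close>\<close>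
    have "(\<Sum>k<Suc m. damped b f k) = (\<Sum>k<m. damped b f (Suc k))"
      by (simp only: sum.lessThan_Suc_shift damped.simps(1) add_0)
    also have "\<dots> = (\<Sum>k<m. f k) + b * (\<Sum>k<m. damped b f k)"
      by (simp add: sum.distrib sum_distrib_left)
    also have "\<dots> \<le> suminf f + b * (\<Sum>k<Suc m. damped b f k)"
      using f b nn by (intro add_mono mult_left_mono sum_le_suminf sum_mono2) auto
    finally show ?thesis using b Suc by (simp add: field_simps)
  qed
  show s: "summable (damped b f)" by (rule summableI_nonneg_bounded[OF nn le])
  show "suminf (damped b f) \<le> suminf f / (1 - b)" using suminf_le_const[OF s] le by blast
qed

context shb_setting
begin

abbreviation "erun \<equiv> run y (\<lambda>_. 0)"

text \<open>The squared residual of the whole system. A single step sees one of its summands only.\<close>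
definition Phi :: "'a \<Rightarrow> real" where
  "Phi x = (\<Sum>i\<in>{1..N}. (norm (F i x - y i))\<^sup>2)"

definition Cpair :: real where "Cpair = 3 * \<mu>1 * (1 + \<eta>)"

lemma Cpair_nonneg: "Cpair \<ge> 0" using \<mu>1 \<eta> by (simp add: Cpair_def)

lemma Phi_nonneg: "0 \<le> Phi x" by (simp add: Phi_def sum_nonneg)

lemma resid_le_Phi: "i \<in> {1..N} \<Longrightarrow> (norm (F i x - y i))\<^sup>2 \<le> Phi x"
  unfolding Phi_def by (rule member_le_sum) auto

lemma Phi_eq_0: "Phi x = 0 \<longleftrightarrow> (\<forall>i\<in>{1..N}. F i x = y i)"
  unfolding Phi_def by (subst sum_nonneg_eq_0_iff) auto

lemma admissible_erun: "\<forall>n. j n \<in> {1..N} \<Longrightarrow> admissible (erun j n)"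
  using admissible_run[OF noise_exact] by blast

lemma erun_Bl: "\<forall>n. j n \<in> {1..N} \<Longrightarrow> primal_it (erun j n) \<in> Bl"
  using admissible_Bl admissible_erun by blast

lemma erun_subgrad: "\<forall>n. j n \<in> {1..N} \<Longrightarrow> subgrad (dual_it (erun j n)) (primal_it (erun j n))"
  using admissible_erun admissible_def by blast

text \<open>A gradient step at \<open>x\<close> is orthogonal to \<open>w - z\<close> up to the squared residual at \<open>x\<close>, if \<open>w\<close> solves the
  system at least as well as \<open>x\<close>: split \<open>w - z\<close> at \<open>x\<close> and use the tangential cone condition for both
  parts. The factor \<open>3\<close> in \<open>Cpair\<close> counts the residual at \<open>x\<close> twice and the one at \<open>w\<close> once.\<close>
lemma gradient_pairing_le:
  assumes i: "i \<in> {1..N}" and x: "x \<in> Bl" and w: "w \<in> Bl" and z: "z \<in> Sol" and le: "Phi w \<le> Phi x"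
  shows "tsz y (\<lambda>_. 0) i x * \<bar>inner (grd y i x) (w - z)\<bar> \<le> Cpair * Phi x"
proof -
  let ?R = "norm (F i x - y i)"
  have R: "res y i x = F i x - y i" by (simp add: heavy_ball.resid_def)
  have sqx: "?R \<le> sqrt (Phi x)" using resid_le_Phi[OF i, of x] real_le_rsqrt by blast
  have "norm (F i w - y i) \<le> sqrt (Phi w)" using resid_le_Phi[OF i, of w] real_le_rsqrt by blast
  also have "\<dots> \<le> sqrt (Phi x)" using le by simp
  finally have sqw: "norm (F i w - y i) \<le> sqrt (Phi x)" .
  have "norm (F i x - F i w) \<le> ?R + norm (F i w - y i)"
    using norm_triangle_ineq4[of "F i x - y i" "F i w - y i"] by simp
  then have xw: "norm (F i x - F i w) \<le> 2 * sqrt (Phi x)" using sqx sqw by linarith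
  have "w - z = (x - z) - (x - w)" by simp
  then have "norm (blinfun_apply (L i x) (w - z)) \<le> norm (blinfun_apply (L i x) (x - z)) + norm (blinfun_apply (L i x) (x - w))"
    by (metis blinfun.diff_right norm_triangle_ineq4)
  also have "\<dots> \<le> (1 + \<eta>) * norm (F i x - F i z) + (1 + \<eta>) * norm (F i x - F i w)"
    using L_difference_le[OF i x Sol_Bl[OF z]] L_difference_le[OF i x w] by linarith
  also have "\<dots> \<le> (1 + \<eta>) * sqrt (Phi x) + (1 + \<eta>) * (2 * sqrt (Phi x))"
    using sqx xw \<eta> Sol_F[OF z i] by (intro add_mono mult_left_mono) auto
  finally have L: "norm (blinfun_apply (L i x) (w - z)) \<le> 3 * (1 + \<eta>) * sqrt (Phi x)" by (simp add: algebra_simps)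
  have "tsz y (\<lambda>_. 0) i x * \<bar>inner (grd y i x) (w - z)\<bar>
      \<le> tsz y (\<lambda>_. 0) i x * (?R powr (r - 1) * norm (blinfun_apply (L i x) (w - z)))"
    using grd_inner_le[OF noise_exact i x, of "w - z"] tsz_nonneg[OF noise_exact i x] unfolding R
    by (intro mult_left_mono)
  also have "\<dots> = (tsz y (\<lambda>_. 0) i x * ?R powr (r - 1)) * norm (blinfun_apply (L i x) (w - z))" by simp
  also have "\<dots> \<le> (\<mu>1 * sqrt (Phi x)) * (3 * (1 + \<eta>) * sqrt (Phi x))"
  proof (rule mult_mono[OF _ L])
    have "\<mu>1 * ?R \<le> \<mu>1 * sqrt (Phi x)" using sqx \<mu>1 by simp
    then show "tsz y (\<lambda>_. 0) i x * ?R powr (r - 1) \<le> \<mu>1 * sqrt (Phi x)"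
      using tsz_upper[OF noise_exact i x] unfolding R by linarith
  qed (use \<mu>1 Phi_nonneg in auto)
  also have "\<dots> = Cpair * (sqrt (Phi x) * sqrt (Phi x))" unfolding Cpair_def by (simp only: mult_ac)
  also have "\<dots> = Cpair * Phi x" using Phi_nonneg by simp
  finally show ?thesis .
qed

abbreviation drift :: "(nat \<Rightarrow> nat) \<Rightarrow> nat \<Rightarrow> real" where
  "drift j \<equiv> damped \<beta> (\<lambda>n. Cpair * Phi (primal_it (erun j n)))"

lemma drift_nonneg: "0 \<le> drift j n"
  by (rule damped_nonneg) (use \<beta> Cpair_nonneg Phi_nonneg in auto)

lemma momentum_pairing_le:
  assumes j: "\<forall>n. j n \<in> {1..N}" and z: "z \<in> Sol" and w: "w \<in> Bl"
    and le: "\<And>k. k < n \<Longrightarrow> Phi w \<le> Phi (primal_it (erun j k))"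
  shows "k \<le> n \<Longrightarrow> \<bar>inner (momentum (erun j k)) (w - z)\<bar> \<le> drift j k"
proof (induction k)
  case (Suc k)
  let ?s = "erun j k"
  have jk: "j k \<in> {1..N}" using j by blast
  let ?t = "tsz y (\<lambda>_. 0) (j k) (primal_it ?s)" and ?g = "grd y (j k) (primal_it ?s)" and ?b = "mom y (\<lambda>_. 0) (j k) ?s"
  have "?t * \<bar>inner ?g (w - z)\<bar> \<le> Cpair * Phi (primal_it ?s)"
    by (rule gradient_pairing_le[OF jk erun_Bl[OF j] w z le]) (use Suc in simp)
  then have 1: "\<bar>?t * inner ?g (w - z)\<bar> \<le> Cpair * Phi (primal_it ?s)"
    using tsz_nonneg[OF noise_exact jk erun_Bl[OF j], of k] by (simp add: abs_mult)
  have "\<bar>?b * inner (momentum ?s) (w - z)\<bar> = ?b * \<bar>inner (momentum ?s) (w - z)\<bar>"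
    using mom_bounds(1)[OF noise_exact jk] by (simp add: abs_mult)
  also have "\<dots> \<le> \<beta> * drift j k"
    using mom_bounds[OF noise_exact jk] Suc \<beta> by (intro mult_mono) auto
  finally have 2: "\<bar>?b * inner (momentum ?s) (w - z)\<bar> \<le> \<beta> * drift j k" .
  have "inner (momentum (erun j (Suc k))) (w - z) = ?b * inner (momentum ?s) (w - z) - ?t * inner ?g (w - z)"
    by (simp add: heavy_ball.shb.simps stp_simps(3) inner_diff_left inner_add_left)
  then show ?case using 1 2 by simp
qed (simp add: heavy_ball.shb.simps)

text \<open>Summing \<open>momentum_pairing_le\<close>. The bound does not depend on \<open>w\<close>, as long as \<open>w\<close> solves the system at
  least as well as all iterates before step \<open>n\<close>; it is to be applied to the iterate at a record time \<open>n\<close>.\<close>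
lemma dual_pairing_le:
  assumes j: "\<forall>n. j n \<in> {1..N}" and z: "z \<in> Sol" and w: "w \<in> Bl"
    and le: "\<And>k. k < n \<Longrightarrow> Phi w \<le> Phi (primal_it (erun j k))" and m: "m \<le> n"
  shows "\<bar>inner (dual_it (erun j n) - dual_it (erun j m)) (w - z)\<bar> \<le> (\<Sum>k\<le>n. drift j k) - (\<Sum>k\<le>m. drift j k)"
proof -
  have "\<bar>inner (dual_it (erun j k) - dual_it (erun j m)) (w - z)\<bar> \<le> (\<Sum>k\<le>k. drift j k) - (\<Sum>k\<le>m. drift j k)"
    if "m \<le> k" "k \<le> n" for k
    using that
  proof (induction k rule: dec_induct)
    case (step k)
    have "dual_it (erun j (Suc k)) - dual_it (erun j m)
        = (dual_it (erun j k) - dual_it (erun j m)) + momentum (erun j (Suc k))"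
      by (simp add: heavy_ball.shb.simps stp_simps(1,3))
    then have "inner (dual_it (erun j (Suc k)) - dual_it (erun j m)) (w - z)
        = inner (dual_it (erun j k) - dual_it (erun j m)) (w - z) + inner (momentum (erun j (Suc k))) (w - z)"
      by (simp only: inner_add_left)
    moreover have "\<bar>inner (momentum (erun j (Suc k))) (w - z)\<bar> \<le> drift j (Suc k)"
      using momentum_pairing_le[OF j z w le] step by blast
    ultimately show ?case using step by simp
  qed simp
  then show ?thesis using m by blast
qed

text \<open>Once an iterate solves the system it is itself a reference solution, at Bregman distance \<open>0\<close>, and
  by monotonicity the distance stays \<open>0\<close>; the momentum does not move the iterates away.\<close>
lemma erun_stays:
  assumes j: "\<forall>n. j n \<in> {1..N}" and k: "Phi (primal_it (erun j k)) = 0" and n: "k \<le> n"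
  shows "primal_it (erun j n) = primal_it (erun j k)"
proof -
  let ?x = "primal_it (erun j k)"
  have z: "?x \<in> Sol"
    using k erun_Bl[OF j] erun_subgrad[OF j, THEN subgrad_edom] by (intro SolI) (auto simp: Phi_eq_0)
  have "breg (dual_it (erun j n)) ?x (primal_it (erun j n)) \<le> breg (dual_it (erun j k)) ?x ?x"
    using decseqD[OF run_breg_mono[OF noise_exact j z] n] .
  then have "\<sigma> * (norm (?x - primal_it (erun j n)))\<^sup>2 \<le> 0"
    using breg_lower[OF erun_subgrad[OF j] Sol_edom[OF z], of n] by simp
  then show ?thesis using \<sigma> by (simp add: mult_le_0_iff)
qed

text \<open>Since the residuals tend to zero, there are infinitely many record times. If no residual up to \<open>K\<close>
  vanishes, the first time below their minimum is one; otherwise all later residuals vanish.\<close>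
lemma Phi_records:
  assumes j: "\<forall>n. j n \<in> {1..N}" and s: "summable (\<lambda>n. Phi (primal_it (erun j n)))"
  shows "\<exists>n\<ge>K. \<forall>k<n. Phi (primal_it (erun j n)) \<le> Phi (primal_it (erun j k))"
proof (cases "\<exists>k\<le>K. Phi (primal_it (erun j k)) = 0")
  case True
  then obtain k where "k \<le> K" "Phi (primal_it (erun j k)) = 0" by blast
  then have "Phi (primal_it (erun j K)) = 0" using erun_stays[OF j] by metis
  then show ?thesis using Phi_nonneg by (intro exI[of _ K]) simp
next
  case False
  let ?f = "\<lambda>n. Phi (primal_it (erun j n))"
  define e where "e = Min (?f ` {..K})"
  have "e \<in> ?f ` {..K}" unfolding e_def by (rule Min_in) auto
  then obtain k where k: "k \<le> K" "e = ?f k" by blast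
  then have "?f k \<noteq> 0" using False by blast
  then have e: "e > 0" unfolding k(2) using Phi_nonneg[of "primal_it (erun j k)"] by linarith
  have le: "e \<le> ?f k" if "k \<le> K" for k unfolding e_def using that by (intro Min_le) auto
  have "\<forall>\<^sub>F n in sequentially. ?f n < e" using summable_LIMSEQ_zero[OF s] e by (rule order_tendstoD)
  then have ex: "\<exists>n. ?f n < e" by (auto simp: eventually_sequentially)
  define n where "n = (LEAST n. ?f n < e)"
  have "?f n < e" unfolding n_def by (rule LeastI_ex[OF ex])
  moreover have "e \<le> ?f k" if "k < n" for k using not_less_Least[of k "\<lambda>n. ?f n < e"] that unfolding n_def by simp
  moreover have "n \<ge> K" using le calculation(1) by (metis leD linorder_le_cases)
  ultimately show ?thesis by (intro exI[of _ n]) fastforce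
qed

text \<open>The identity \<open>breg \<xi>\<^sub>m x\<^sub>n x\<^sub>m = \<Delta>\<^sub>m - \<Delta>\<^sub>n + \<langle>\<xi>\<^sub>n - \<xi>\<^sub>m, x\<^sub>n - z\<rangle>\<close>, where \<open>\<Delta>\<^sub>n = breg \<xi>\<^sub>n z x\<^sub>n\<close> for a fixed solution
  \<open>z\<close>, reduces the convergence to the monotone sequence \<open>\<Delta>\<close> and to the pairing, which
  \<open>dual_pairing_le\<close> controls at record times \<open>n\<close>. So the iterates converge along record times, and the
  same bound \<open>E m\<close> passes to the limit by lower semicontinuity; it then gives convergence of the
  Bregman distances to the limit along the whole sequence. The bound at \<open>m = 0\<close> is a pathwise majorant for dominated convergence.\<close>
theorem exact_convergence:
  assumes j: "\<forall>n. j n \<in> {1..N}" and s: "summable (\<lambda>n. Phi (primal_it (erun j n)))"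
  shows "\<exists>xs\<in>Sol. (\<lambda>n. primal_it (erun j n)) \<longlonglongrightarrow> xs
    \<and> (\<lambda>n. breg (dual_it (erun j n)) xs (primal_it (erun j n))) \<longlonglongrightarrow> 0
    \<and> breg \<xi>0 xs x0 \<le> \<sigma> * \<rho>\<^sup>2 + Cpair / (1 - \<beta>) * (\<Sum>n. Phi (primal_it (erun j n)))"
proof -
  define X where "X n = primal_it (erun j n)" for n
  define D where "D n = dual_it (erun j n)" for n
  define \<Delta> where "\<Delta> n = breg (D n) zsol (X n)" for n
  have XB: "X n \<in> Bl" for n unfolding X_def by (rule erun_Bl[OF j])
  have sg: "subgrad (D n) (X n)" for n unfolding X_def D_def by (rule erun_subgrad[OF j])
  have Xe: "X n \<in> edom \<Theta>" for n using sg subgrad_edom by blast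
  have \<Delta>0: "0 \<le> \<Delta> n" for n unfolding \<Delta>_def by (rule breg_nonneg[OF sg Sol_edom[OF zsol_Sol]])
  have dec: "decseq \<Delta>" unfolding \<Delta>_def X_def D_def by (rule run_breg_mono[OF noise_exact j zsol_Sol])
  then obtain l where l: "\<Delta> \<longlonglongrightarrow> l" "\<And>n. l \<le> \<Delta> n" using decseq_convergent[of \<Delta> 0] \<Delta>0 by blast
  have l0: "0 \<le> l" using LIMSEQ_le_const[OF l(1)] \<Delta>0 by blast
  have cs: "summable (\<lambda>n. Cpair * Phi (primal_it (erun j n)))" using s by (rule summable_mult)
  have dn: "0 \<le> Cpair * Phi (primal_it (erun j n))" for n using Cpair_nonneg Phi_nonneg by simp
  note ds = damped_summable[OF \<beta> dn cs]
  define T where "T m = suminf (drift j) - (\<Sum>k\<le>m. drift j k)" for m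
  define E where "E m = (\<Delta> m - l) + T m" for m
  have "T \<longlonglongrightarrow> suminf (drift j) - suminf (drift j)"
    unfolding T_def by (intro tendsto_diff tendsto_const summable_LIMSEQ' ds)
  then have E0: "E \<longlonglongrightarrow> 0" unfolding E_def using tendsto_add[OF tendsto_diff[OF l(1) tendsto_const[of l]], of T 0] by simp
  have step: "breg (D m) (X n) (X m) \<le> E m" if mn: "m < n" and rec: "\<forall>k<n. Phi (X n) \<le> Phi (X k)" for m n
  proof -
    have "\<bar>inner (D n - D m) (X n - zsol)\<bar> \<le> (\<Sum>k\<le>n. drift j k) - (\<Sum>k\<le>m. drift j k)"
      unfolding D_def by (rule dual_pairing_le[OF j zsol_Sol XB]) (use rec mn in \<open>auto simp: X_def\<close>)
    moreover have "(\<Sum>k\<le>n. drift j k) \<le> suminf (drift j)" by (rule sum_le_suminf[OF ds(1)]) (auto simp: drift_nonneg)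
    moreover have "breg (D m) (X n) (X m) = \<Delta> m - \<Delta> n + inner (D n - D m) (X n - zsol)"
      by (simp add: \<Delta>_def breg_def inner_diff_left inner_diff_right)
    ultimately show ?thesis using l(2)[of n] unfolding E_def T_def by linarith
  qed
  define Rec where "Rec = {n. \<forall>k<n. Phi (X n) \<le> Phi (X k)}"
  have "infinite Rec" unfolding infinite_nat_iff_unbounded_le Rec_def X_def using Phi_records[OF j s] by blast
  from infinite_enumerate[OF this] obtain q :: "nat \<Rightarrow> nat"
    where q: "strict_mono q" "\<And>n. q n \<in> Rec" by blast
  have stepq: "breg (D m) (X (q n)) (X m) \<le> E m" if "m < q n" for m n
    using step[OF that] q(2)[of n] by (simp add: Rec_def)
  have qge: "n \<le> q n" for n using q(1) by (rule strict_mono_imp_increasing)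
  have Eq0: "(\<lambda>p. E (q p)) \<longlonglongrightarrow> 0" using LIMSEQ_subseq_LIMSEQ[OF E0 q(1)] by (simp add: o_def)
  have "Cauchy (\<lambda>n. X (q n))"
  proof (rule metric_CauchyI)
    fix e :: real assume e: "0 < e"
    have "\<forall>\<^sub>F p in sequentially. E (q p) < \<sigma> * (e / 2)\<^sup>2"
      by (rule order_tendstoD(2)[OF Eq0]) (use e \<sigma> in simp)
    then obtain p where p: "E (q p) < \<sigma> * (e / 2)\<^sup>2" by (auto simp: eventually_sequentially)
    have near: "norm (X (q n) - X (q p)) < e / 2" if "n > p" for n
    proof -
      have "\<sigma> * (norm (X (q n) - X (q p)))\<^sup>2 \<le> E (q p)"
        using breg_lower[OF sg[of "q p"] Xe[of "q n"]] stepq[of "q p" n] strict_monoD[OF q(1) that] by linarith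
      then have "(norm (X (q n) - X (q p)))\<^sup>2 < (e / 2)\<^sup>2" using p \<sigma> mult_less_cancel_left_pos[OF \<sigma>] by fastforce
      then show ?thesis by (rule power_less_imp_less_base) (use e in simp)
    qed
    show "\<exists>M. \<forall>m\<ge>M. \<forall>n\<ge>M. dist (X (q m)) (X (q n)) < e"
    proof (intro exI[of _ "Suc p"] allI impI)
      fix m n assume "Suc p \<le> m" "Suc p \<le> n"
      then have "dist (X (q m)) (X (q p)) < e / 2" "dist (X (q n)) (X (q p)) < e / 2"
        using near unfolding dist_norm by auto
      then show "dist (X (q m)) (X (q n)) < e" by (rule dist_triangle_half_l)
    qed
  qed
  then obtain xs where xs: "(\<lambda>n. X (q n)) \<longlonglongrightarrow> xs" using Cauchy_convergent convergent_def by blast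
  have lim: "xs \<in> edom \<Theta> \<and> breg (D m) xs (X m) \<le> E m" for m
  proof -
    \<comment> \<open>the tail of the record times after \<open>m\<close>\<close>
    define Z where "Z n = X (q (n + Suc m))" for n
    have Z: "Z \<longlonglongrightarrow> xs" unfolding Z_def using xs by (rule LIMSEQ_ignore_initial_segment)
    have mq: "m < q (n + Suc m)" for n using qge[of "n + Suc m"] by linarith
    have le: "th (Z n) \<le> E m + th (X m) + inner (D m) (Z n - X m)" for n
      using stepq[OF mq[of n]] unfolding breg_def Z_def by linarith
    have "(\<lambda>n. E m + th (X m) + inner (D m) (Z n - X m)) \<longlonglongrightarrow> E m + th (X m) + inner (D m) (xs - X m)"
      by (intro tendsto_intros Z)
    then have "xs \<in> edom \<Theta> \<and> th xs \<le> E m + th (X m) + inner (D m) (xs - X m)"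
      using th_lsc[OF _ Z le] Xe unfolding Z_def by blast
    then show ?thesis by (simp add: breg_def)
  qed
  have xsB: "xs \<in> Bl" using F_tendsto(1)[of 1 "\<lambda>n. X (q n)"] N XB xs by auto
  have Phi0: "(\<lambda>n. Phi (X (q n))) \<longlonglongrightarrow> 0"
    using LIMSEQ_subseq_LIMSEQ[OF summable_LIMSEQ_zero[OF s] q(1)] by (simp add: o_def X_def)
  have xsS: "xs \<in> Sol"
  proof (rule SolI)
    fix i assume i: "i \<in> {1..N}"
    have "(\<lambda>n. (norm (F i (X (q n)) - y i))\<^sup>2) \<longlonglongrightarrow> (norm (F i xs - y i))\<^sup>2"
      by (intro tendsto_intros F_tendsto(2)[OF i XB xs])
    moreover have "(\<lambda>n. (norm (F i (X (q n)) - y i))\<^sup>2) \<longlonglongrightarrow> 0"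
      by (rule tendsto_sandwich[OF _ _ tendsto_const Phi0]) (use resid_le_Phi[OF i] in auto)
    ultimately show "F i xs = y i" using LIMSEQ_unique by fastforce
  qed (use xsB lim in auto)
  have b0: "(\<lambda>n. breg (D n) xs (X n)) \<longlonglongrightarrow> 0"
    by (rule tendsto_sandwich[OF _ _ tendsto_const E0]) (use lim breg_nonneg[OF sg] in auto)
  have "X \<longlonglongrightarrow> xs" by (rule tendsto_of_breg_tendsto_0[OF sg Sol_edom[OF xsS] b0])
  moreover have "breg \<xi>0 xs x0 \<le> \<sigma> * \<rho>\<^sup>2 + Cpair / (1 - \<beta>) * (\<Sum>n. Phi (primal_it (erun j n)))"
  proof -
    have "breg \<xi>0 xs x0 \<le> E 0" using lim[of 0] by (simp add: D_def X_def heavy_ball.shb.simps)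
    also have "E 0 \<le> \<Delta> 0 + suminf (drift j)"
      using l0 drift_nonneg[of j 0] by (simp add: E_def T_def)
    also have "\<Delta> 0 \<le> \<sigma> * \<rho>\<^sup>2" using zsol_spec(2) by (simp add: \<Delta>_def D_def X_def heavy_ball.shb.simps)
    also have "suminf (drift j) \<le> (\<Sum>n. Cpair * Phi (primal_it (erun j n))) / (1 - \<beta>)" by (rule ds(2))
    also have "(\<Sum>n. Cpair * Phi (primal_it (erun j n))) = Cpair * (\<Sum>n. Phi (primal_it (erun j n)))" by (rule suminf_mult[OF s])
    finally show ?thesis by simp
  qed
  ultimately show ?thesis using xsS b0 unfolding X_def D_def by blast
qed

text \<open>If all step directions are orthogonal to \<open>w\<close>, the dual variables do not move in the direction \<open>w\<close>.\<close>
lemma erun_orthogonal: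
  assumes j: "\<forall>n. j n \<in> {1..N}" and w: "\<And>i x. i \<in> {1..N} \<Longrightarrow> x \<in> Bl \<Longrightarrow> inner (grd y i x) w = 0"
  shows "inner (dual_it (erun j n) - \<xi>0) w = 0 \<and> inner (momentum (erun j n)) w = 0"
proof (induction n)
  case (Suc n)
  have "inner (grd y (j n) (primal_it (erun j n))) w = 0" using j erun_Bl[OF j] w by blast
  then show ?case using Suc
    by (simp add: heavy_ball.shb.simps stp_simps(1,3) inner_diff_left inner_add_left)
qed (simp add: heavy_ball.shb.simps)

section \<open>Stability with respect to the data\<close>

lemma resid_tendsto:
  assumes i: "i \<in> {1..N}" and x: "\<And>l. x l \<in> Bl" "x \<longlonglongrightarrow> x'" and yd: "(\<lambda>l. yd l i) \<longlonglongrightarrow> y i"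
  shows "(\<lambda>l. res (yd l) i (x l)) \<longlonglongrightarrow> res y i x'"
  unfolding heavy_ball.resid_def by (intro tendsto_diff F_tendsto(2)[OF i x] yd)

lemma grd_difference_le:
  assumes i: "i \<in> {1..N}" and nz: "noise yd d" "noise yd' d'" and x: "x \<in> Bl" and x': "x' \<in> Bl" and e: "e \<ge> 0"
    and J: "\<And>w. w \<in> Y i \<Longrightarrow>
      \<bar>duality_map r (Y i) (res yd i x) w - duality_map r (Y i) (res yd' i x') w\<bar> \<le> e * norm w"
  shows "norm (grd yd i x - grd yd' i x') \<le> e * B0 + norm (res yd' i x') powr (r - 1) * norm (L i x - L i x')"
proof -
  let ?h = "grd yd i x - grd yd' i x'"
  let ?J = "duality_map r (Y i) (res yd i x)" and ?J' = "duality_map r (Y i) (res yd' i x')"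
  let ?c = "norm (res yd' i x') powr (r - 1)"
  note Y = Y_subspace[OF i] Y_smooth[OF i]
  note r' = res_in_Y[OF nz(2) i x']
  have LY: "L i x ?h \<in> Y i" "L i x' ?h \<in> Y i" using L_in_Y i x x' by auto
  have dY: "L i x ?h - L i x' ?h \<in> Y i" by (rule subspace_diff[OF Y(1) LY])
  have "norm ?h * norm ?h = inner ?h ?h" by (simp add: norm_eq_sqrt_inner)
  also have "\<dots> = ?J (L i x ?h) - ?J' (L i x' ?h)"
    using grd_inner[OF nz(1) i x, of ?h] grd_inner[OF nz(2) i x', of ?h] by (simp add: inner_diff_left)
  also have "\<dots> = (?J (L i x ?h) - ?J' (L i x ?h)) + ?J' (L i x ?h - L i x' ?h)"
    using dual_space_diff[OF duality_map_spec(1)[OF Y r' r] Y(1) LY] by simp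
  also have "\<dots> \<le> e * norm (L i x ?h) + ?c * norm (L i x ?h - L i x' ?h)"
    using J[OF LY(1)] duality_map_bound[OF Y r' r dY] by linarith
  also have "\<dots> \<le> e * (B0 * norm ?h) + ?c * (norm (L i x - L i x') * norm ?h)"
    using norm_blinfun[of "L i x - L i x'" ?h] norm_L_le[OF i x] e
    by (intro add_mono mult_left_mono) (auto simp: blinfun.diff_left)
  finally have "norm ?h * norm ?h \<le> (e * B0 + ?c * norm (L i x - L i x')) * norm ?h"
    by (simp add: algebra_simps)
  moreover have "0 \<le> e * B0 + ?c * norm (L i x - L i x')" using e B0(1) by simp
  ultimately show ?thesis by (cases "?h = 0") auto
qed

lemma grd_tendsto:
  assumes i: "i \<in> {1..N}" and x: "\<And>l. x l \<in> Bl" "x \<longlonglongrightarrow> x'" and yd: "(\<lambda>l. yd l i) \<longlonglongrightarrow> y i"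
    and nz: "\<And>l. noise (yd l) (d l)" and R: "res y i x' \<noteq> 0"
  shows "(\<lambda>l. grd (yd l) i (x l)) \<longlonglongrightarrow> grd y i x'"
proof (rule tendstoI)
  fix e :: real assume e: "e > 0"
  have x'B: "x' \<in> Bl" using F_tendsto(1)[OF i x] .
  let ?c = "norm (res y i x') powr (r - 1)"
  have "e / (2 * B0) > 0" using e B0(1) by simp
  from duality_map_continuous[OF Y_subspace[OF i] Y_smooth[OF i] r res_in_Y[OF noise_exact i x'B] R
      res_in_Y[OF nz i x(1)] resid_tendsto[where yd=yd and x=x, OF i x yd] this]
  have 1: "\<forall>\<^sub>F l in sequentially. \<forall>w\<in>Y i. \<bar>duality_map r (Y i) (res (yd l) i (x l)) w
      - duality_map r (Y i) (res y i x') w\<bar> \<le> e / (2 * B0) * norm w" .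
  have "(\<lambda>l. L i (x l)) \<longlonglongrightarrow> L i x'"
    by (rule continuous_on_tendsto_compose[OF L_continuous[OF i] x(2) x'B]) (use x in simp)
  then have "(\<lambda>l. ?c * norm (L i (x l) - L i x')) \<longlonglongrightarrow> ?c * norm (L i x' - L i x')"
    by (intro tendsto_intros)
  then have "(\<lambda>l. ?c * norm (L i (x l) - L i x')) \<longlonglongrightarrow> 0" by simp
  then have 2: "\<forall>\<^sub>F l in sequentially. ?c * norm (L i (x l) - L i x') < e / 2"
    by (rule order_tendstoD) (use e in simp)
  from 1 2 show "\<forall>\<^sub>F l in sequentially. dist (grd (yd l) i (x l)) (grd y i x') < e"
  proof eventually_elim
    case (elim l)
    have "norm (grd (yd l) i (x l) - grd y i x') \<le> e / (2 * B0) * B0 + ?c * norm (L i (x l) - L i x')"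
      by (rule grd_difference_le[OF i nz noise_exact x(1) x'B]) (use elim e B0(1) in auto)
    also have "\<dots> < e" using elim(2) B0(1) by (simp add: field_simps)
    finally show ?case by (simp add: dist_norm)
  qed
qed

definition state_tendsto :: "(nat \<Rightarrow> 'a shb_state) \<Rightarrow> 'a shb_state \<Rightarrow> bool" where
  "state_tendsto S s \<longleftrightarrow> (\<lambda>l. dual_it (S l)) \<longlonglongrightarrow> dual_it s \<and> (\<lambda>l. primal_it (S l)) \<longlonglongrightarrow> primal_it s
     \<and> (\<lambda>l. momentum (S l)) \<longlonglongrightarrow> momentum s \<and> (\<lambda>l. gam (S l)) \<longlonglongrightarrow> gam s"

text \<open>The step size is discontinuous where the residual vanishes, but there the step itself tends to zero,
  being bounded by \<open>\<mu>1 * B0 * R\<close>. Elsewhere the gradient does not vanish, by \<open>grd_pairing_lower\<close>, and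
  the formula for the step size is continuous.\<close>
lemma step_tendsto:
  assumes i: "i \<in> {1..N}" and x: "\<And>l. x l \<in> Bl" "x \<longlonglongrightarrow> x'"
    and nz: "\<And>l. noise (yd l) (d l)" and d: "(\<lambda>l. d l i) \<longlonglongrightarrow> 0" and yd: "(\<lambda>l. yd l i) \<longlonglongrightarrow> y i"
  shows "(\<lambda>l. tsz (yd l) (d l) i (x l) *\<^sub>R grd (yd l) i (x l)) \<longlonglongrightarrow> tsz y (\<lambda>_. 0) i x' *\<^sub>R grd y i x'"
    and "(\<lambda>l. loss (yd l) (d l) i (x l)) \<longlonglongrightarrow> loss y (\<lambda>_. 0) i x'"
proof -
  define R where "R l = norm (res (yd l) i (x l))" for l
  define t where "t l = tsz (yd l) (d l) i (x l)" for l
  let ?R = "norm (res y i x')"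
  have x'B: "x' \<in> Bl" using F_tendsto(1)[OF i x] .
  have R: "R \<longlonglongrightarrow> ?R" unfolding R_def by (intro tendsto_norm resid_tendsto[where yd=yd] i x yd)
  have "(\<lambda>l. t l *\<^sub>R grd (yd l) i (x l)) \<longlonglongrightarrow> tsz y (\<lambda>_. 0) i x' *\<^sub>R grd y i x' \<and>
      (\<lambda>l. t l * ((1 - \<eta>) * R l - (1 + \<eta>) * d l i) * R l powr (r - 1)) \<longlonglongrightarrow> loss y (\<lambda>_. 0) i x'"
  proof (cases "?R = 0")
    case True
    have t0: "tsz y (\<lambda>_. 0) i x' = 0" using tsz_zero[OF noise_exact i x'B] True by simp
    have R0: "R \<longlonglongrightarrow> 0" using R True by simp
    have tR: "t l * R l powr (r - 1) \<le> \<mu>1 * R l" "0 \<le> t l" for l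
      unfolding t_def R_def using tsz_upper[OF nz i x(1)] tsz_nonneg[OF nz i x(1)] by auto
    have m0: "(\<lambda>l. \<mu>1 * R l) \<longlonglongrightarrow> 0" using tendsto_mult[OF tendsto_const R0, of \<mu>1] by simp
    have tR0: "(\<lambda>l. t l * R l powr (r - 1)) \<longlonglongrightarrow> 0"
      by (rule tendsto_sandwich[OF _ _ tendsto_const m0]) (use tR in auto)
    have "(\<lambda>l. t l *\<^sub>R grd (yd l) i (x l)) \<longlonglongrightarrow> 0"
    proof (rule Lim_null_comparison)
      have "norm (t l *\<^sub>R grd (yd l) i (x l)) \<le> t l * R l powr (r - 1) * B0" for l
        using mult_left_mono[OF norm_grd_le[OF nz i x(1), of l l] tR(2)[of l]] tR(2)[of l]
        by (simp add: R_def mult.assoc)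
      then show "\<forall>\<^sub>F l in sequentially. norm (t l *\<^sub>R grd (yd l) i (x l)) \<le> t l * R l powr (r - 1) * B0" by simp
      show "(\<lambda>l. t l * R l powr (r - 1) * B0) \<longlonglongrightarrow> 0" using tendsto_mult[OF tR0 tendsto_const, of B0] by simp
    qed
    moreover have "(\<lambda>l. (t l * R l powr (r - 1)) * ((1 - \<eta>) * R l - (1 + \<eta>) * d l i)) \<longlonglongrightarrow> 0 * ((1 - \<eta>) * 0 - (1 + \<eta>) * 0)"
      by (intro tendsto_intros tR0 R0 d)
    ultimately show ?thesis using t0 by (simp add: loss_def mult_ac)
  next
    case False
    then have Rpos: "?R > 0" by simp
    have g: "(\<lambda>l. grd (yd l) i (x l)) \<longlonglongrightarrow> grd y i x'"
      by (rule grd_tendsto[where yd=yd and d=d and x=x, OF i x yd nz]) (use False in simp)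
    have "0 < ((1 - \<eta>) * ?R - (1 + \<eta>) * 0) * ?R powr (r - 1)" using Rpos \<eta> by simp
    also have "\<dots> \<le> inner (grd y i x') (x' - zsol)"
      by (rule grd_pairing_lower[OF noise_exact i x'B zsol_Sol])
    finally have g0: "grd y i x' \<noteq> 0" by auto
    have g0l: "\<forall>\<^sub>F l in sequentially. grd (yd l) i (x l) \<noteq> 0" using g g0 by (rule tendsto_imp_eventually_ne)
    have "(\<lambda>l. R l - \<tau> * d l i) \<longlonglongrightarrow> ?R - \<tau> * 0" by (intro tendsto_intros R d)
    then have "\<forall>\<^sub>F l in sequentially. 0 < R l - \<tau> * d l i" by (rule order_tendstoD) (use Rpos in simp)
    with g0l have teq: "\<forall>\<^sub>F l in sequentially. min (\<mu>0 * ((1 - \<eta>) * R l - (1 + \<eta>) * d l i) * R l powr (r - 1)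
        / (norm (grd (yd l) i (x l)))\<^sup>2) (\<mu>1 * R l powr (2 - r)) = t l"
      by eventually_elim (simp add: t_def R_def heavy_ball.step_size_def Let_def)
    have t': "tsz y (\<lambda>_. 0) i x' = min (\<mu>0 * ((1 - \<eta>) * ?R - (1 + \<eta>) * 0) * ?R powr (r - 1)
        / (norm (grd y i x'))\<^sup>2) (\<mu>1 * ?R powr (2 - r))"
      using g0 Rpos by (simp add: heavy_ball.step_size_def Let_def)
    have "(\<lambda>l. min (\<mu>0 * ((1 - \<eta>) * R l - (1 + \<eta>) * d l i) * R l powr (r - 1)
        / (norm (grd (yd l) i (x l)))\<^sup>2) (\<mu>1 * R l powr (2 - r))) \<longlonglongrightarrow> tsz y (\<lambda>_. 0) i x'"
      unfolding t' by (intro tendsto_intros R d g) (use g0 Rpos in auto)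
    then have t: "t \<longlonglongrightarrow> tsz y (\<lambda>_. 0) i x'" by (rule Lim_transform_eventually[OF _ teq])
    have "(\<lambda>l. t l * ((1 - \<eta>) * R l - (1 + \<eta>) * d l i) * R l powr (r - 1))
        \<longlonglongrightarrow> tsz y (\<lambda>_. 0) i x' * ((1 - \<eta>) * ?R - (1 + \<eta>) * 0) * ?R powr (r - 1)"
      by (intro tendsto_intros t R d) (use Rpos in auto)
    then show ?thesis using tendsto_scaleR[OF t g] by (simp add: loss_def)
  qed
  then show "(\<lambda>l. tsz (yd l) (d l) i (x l) *\<^sub>R grd (yd l) i (x l)) \<longlonglongrightarrow> tsz y (\<lambda>_. 0) i x' *\<^sub>R grd y i x'"
    "(\<lambda>l. loss (yd l) (d l) i (x l)) \<longlonglongrightarrow> loss y (\<lambda>_. 0) i x'"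
    unfolding t_def R_def loss_def by auto
qed

text \<open>The momentum coefficient is discontinuous as well, but its products with the momentum and with
  \<open>gam\<close> are not. If the limiting momentum is nonzero, the coefficient is continuous, as its formula tends
  to zero at the border of the case distinction. If the limiting momentum is zero, the coefficient may
  fail to converge; but then \<open>gam s \<ge> 0\<close> by admissibility, so either \<open>gam\<close> tends to zero or the coefficient
  is eventually zero.\<close>
lemma mom_tendsto:
  assumes i: "i \<in> {1..N}" and S: "\<And>l. admissible (S l)" "admissible s" "state_tendsto S s"
    and nz: "\<And>l. noise (yd l) (d l)" and d: "(\<lambda>l. d l i) \<longlonglongrightarrow> 0" and yd: "(\<lambda>l. yd l i) \<longlonglongrightarrow> y i"
  shows "(\<lambda>l. mom (yd l) (d l) i (S l) *\<^sub>R momentum (S l)) \<longlonglongrightarrow> mom y (\<lambda>_. 0) i s *\<^sub>R momentum s"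
    and "(\<lambda>l. mom (yd l) (d l) i (S l) * gam (S l)) \<longlonglongrightarrow> mom y (\<lambda>_. 0) i s * gam s"
proof -
  define b where "b l = mom (yd l) (d l) i (S l)" for l
  define m where "m l = momentum (S l)" for l
  define \<gamma> where "\<gamma> l = gam (S l)" for l
  define p where "p l = inner (tsz (yd l) (d l) i (primal_it (S l)) *\<^sub>R grd (yd l) i (primal_it (S l))) (m l)" for l
  define q where "q l = \<gamma> l - p l / (2 * \<sigma>)" for l
  let ?p = "inner (tsz y (\<lambda>_. 0) i (primal_it s) *\<^sub>R grd y i (primal_it s)) (momentum s)"
  let ?q = "gam s - ?p / (2 * \<sigma>)" and ?b = "mom y (\<lambda>_. 0) i s"
  have m: "m \<longlonglongrightarrow> momentum s" and \<gamma>: "\<gamma> \<longlonglongrightarrow> gam s" and x: "(\<lambda>l. primal_it (S l)) \<longlonglongrightarrow> primal_it s"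
    using S(3) unfolding state_tendsto_def m_def \<gamma>_def by auto
  have p: "p \<longlonglongrightarrow> ?p" unfolding p_def
    by (intro tendsto_inner m step_tendsto(1)[where yd=yd and d=d, OF i _ x nz d yd] admissible_Bl S)
  have q: "q \<longlonglongrightarrow> ?q" unfolding q_def by (intro tendsto_intros \<gamma> p) (use \<sigma> in simp)
  have bb: "0 \<le> b l" "b l \<le> \<beta>" for l unfolding b_def using mom_bounds[OF nz i] by auto
  have b: "b l = (if norm (m l) > \<upsilon>0 * d l i \<and> q l < - \<upsilon>1 * d l i * (norm (m l))\<^sup>2
      then min ((p l - 2 * \<sigma> * \<gamma> l) / (norm (m l))\<^sup>2) \<beta> else 0)" for l
    unfolding b_def heavy_ball.momentum_coeff_def by (simp add: Let_def m_def p_def q_def \<gamma>_def)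
  have b': "?b = (if norm (momentum s) > 0 \<and> ?q < 0
      then min ((?p - 2 * \<sigma> * gam s) / (norm (momentum s))\<^sup>2) \<beta> else 0)"
    unfolding heavy_ball.momentum_coeff_def by (simp add: Let_def)
  have nm: "(\<lambda>l. norm (m l)) \<longlonglongrightarrow> norm (momentum s)" by (intro tendsto_norm m)
  have thr: "(\<lambda>l. q l + \<upsilon>1 * d l i * (norm (m l))\<^sup>2) \<longlonglongrightarrow> ?q + \<upsilon>1 * 0 * (norm (momentum s))\<^sup>2"
    by (intro tendsto_intros q d m)
  have inactive: "\<forall>\<^sub>F l in sequentially. b l = 0" if "?q > 0"
  proof -
    have "\<forall>\<^sub>F l in sequentially. 0 < q l + \<upsilon>1 * d l i * (norm (m l))\<^sup>2"
      by (rule order_tendstoD(1)[OF thr]) (use that in simp)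
    then show ?thesis by eventually_elim (simp add: b)
  qed
  have "(\<lambda>l. b l *\<^sub>R m l) \<longlonglongrightarrow> ?b *\<^sub>R momentum s \<and> (\<lambda>l. b l * \<gamma> l) \<longlonglongrightarrow> ?b * gam s"
  proof (cases "momentum s = 0")
    case True
    have bm: "(\<lambda>l. b l *\<^sub>R m l) \<longlonglongrightarrow> 0"
    proof (rule Lim_null_comparison)
      show "\<forall>\<^sub>F l in sequentially. norm (b l *\<^sub>R m l) \<le> \<beta> * norm (m l)"
        using bb by (auto intro!: always_eventually mult_right_mono)
      show "(\<lambda>l. \<beta> * norm (m l)) \<longlonglongrightarrow> 0" using tendsto_mult[OF tendsto_const nm, of \<beta>] True by simp
    qed
    have "inner (momentum s) (primal_it s - zsol) \<le> gam s" using S(2) zsol_Sol unfolding admissible_def by blast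
    then have g0: "0 \<le> gam s" using True by simp
    have qg: "?q = gam s" using True by simp
    have "(\<lambda>l. b l * \<gamma> l) \<longlonglongrightarrow> 0"
    proof (cases "gam s = 0")
      case True
      show ?thesis
      proof (rule Lim_null_comparison)
        show "\<forall>\<^sub>F l in sequentially. norm (b l * \<gamma> l) \<le> \<beta> * \<bar>\<gamma> l\<bar>"
          using bb by (auto intro!: always_eventually mult_right_mono simp: abs_mult)
        show "(\<lambda>l. \<beta> * \<bar>\<gamma> l\<bar>) \<longlonglongrightarrow> 0"
          using tendsto_mult[OF tendsto_const tendsto_rabs[OF \<gamma>], of \<beta>] True by simp
      qed
    next
      case False
      then have "?q > 0" unfolding qg using g0 by linarith
      then have "\<forall>\<^sub>F l in sequentially. b l = 0" by (rule inactive)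
      then have "\<forall>\<^sub>F l in sequentially. b l * \<gamma> l = 0" by eventually_elim simp
      then show ?thesis by (rule tendsto_eventually)
    qed
    then show ?thesis using bm True b' by simp
  next
    case False
    then have mp: "norm (momentum s) > 0" by simp
    have "b \<longlonglongrightarrow> ?b"
    proof -
      consider "?q < 0" | "?q = 0" | "?q > 0" by linarith
      then show ?thesis
      proof cases
        case 1
        have "\<forall>\<^sub>F l in sequentially. q l + \<upsilon>1 * d l i * (norm (m l))\<^sup>2 < 0"
          by (rule order_tendstoD(2)[OF thr]) (use 1 in simp)
        moreover have "(\<lambda>l. norm (m l) - \<upsilon>0 * d l i) \<longlonglongrightarrow> norm (momentum s) - \<upsilon>0 * 0"
          by (intro tendsto_intros nm d)
        then have "\<forall>\<^sub>F l in sequentially. 0 < norm (m l) - \<upsilon>0 * d l i"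
          by (rule order_tendstoD) (use mp in simp)
        ultimately have "\<forall>\<^sub>F l in sequentially. min ((p l - 2 * \<sigma> * \<gamma> l) / (norm (m l))\<^sup>2) \<beta> = b l"
          by eventually_elim (simp add: b)
        moreover have "(\<lambda>l. min ((p l - 2 * \<sigma> * \<gamma> l) / (norm (m l))\<^sup>2) \<beta>) \<longlonglongrightarrow> ?b"
        proof -
          have "?b = min ((?p - 2 * \<sigma> * gam s) / (norm (momentum s))\<^sup>2) \<beta>" using b' mp 1 by simp
          then show ?thesis by (simp only:) (intro tendsto_intros p \<gamma> nm, use False in simp)
        qed
        ultimately show ?thesis by (rule Lim_transform_eventually[rotated])
      next
        case 2
        have b0: "?b = 0" using b' 2 by simp
        have "b \<longlonglongrightarrow> 0"
        proof (rule tendsto_sandwich[OF _ _ tendsto_const])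
          have le: "b l \<le> \<bar>2 * \<sigma> * q l\<bar> / (norm (m l))\<^sup>2" for l
          proof (cases "norm (m l) > \<upsilon>0 * d l i \<and> q l < - \<upsilon>1 * d l i * (norm (m l))\<^sup>2")
            case True
            have "p l - 2 * \<sigma> * \<gamma> l = - (2 * \<sigma> * q l)" using \<sigma> by (simp add: q_def field_simps)
            also have "\<dots> \<le> \<bar>2 * \<sigma> * q l\<bar>" by linarith
            finally have "(p l - 2 * \<sigma> * \<gamma> l) / (norm (m l))\<^sup>2 \<le> \<bar>2 * \<sigma> * q l\<bar> / (norm (m l))\<^sup>2"
              by (intro divide_right_mono) auto
            then show ?thesis using b[of l] True by simp
          next
            case False
            then have "b l = 0" unfolding b by (rule if_not_P)
            then show ?thesis by simp
          qed
          then show "\<forall>\<^sub>F l in sequentially. b l \<le> \<bar>2 * \<sigma> * q l\<bar> / (norm (m l))\<^sup>2" by simp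
          have "(\<lambda>l. \<bar>2 * \<sigma> * q l\<bar> / (norm (m l))\<^sup>2) \<longlonglongrightarrow> \<bar>2 * \<sigma> * ?q\<bar> / (norm (momentum s))\<^sup>2"
            by (intro tendsto_intros q nm) (use False in simp)
          then show "(\<lambda>l. \<bar>2 * \<sigma> * q l\<bar> / (norm (m l))\<^sup>2) \<longlonglongrightarrow> 0" unfolding 2 by simp
        qed (use bb in auto)
        then show ?thesis using b0 by simp
      next
        case 3
        then have "?b = 0" using b' by simp
        then show ?thesis using tendsto_eventually[OF inactive[OF 3]] by simp
      qed
    qed
    then show ?thesis using m \<gamma> by (auto intro: tendsto_intros)
  qed
  then show "(\<lambda>l. mom (yd l) (d l) i (S l) *\<^sub>R momentum (S l)) \<longlonglongrightarrow> mom y (\<lambda>_. 0) i s *\<^sub>R momentum s"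
    "(\<lambda>l. mom (yd l) (d l) i (S l) * gam (S l)) \<longlonglongrightarrow> mom y (\<lambda>_. 0) i s * gam s"
    unfolding b_def m_def \<gamma>_def by auto
qed

definition data_converge :: "(nat \<Rightarrow> nat \<Rightarrow> 'b) \<Rightarrow> (nat \<Rightarrow> nat \<Rightarrow> real) \<Rightarrow> bool" where
  "data_converge yd d \<longleftrightarrow> (\<forall>l. noise (yd l) (d l)) \<and> (\<forall>i\<in>{1..N}. (\<lambda>l. d l i) \<longlonglongrightarrow> 0)"

lemma data_converge_yd:
  assumes "data_converge yd d" "i \<in> {1..N}" shows "(\<lambda>l. yd l i) \<longlonglongrightarrow> y i"
proof (rule LIM_zero_cancel, rule Lim_null_comparison)
  show "\<forall>\<^sub>F l in sequentially. norm (yd l i - y i) \<le> d l i"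
    using assms by (auto simp: data_converge_def noise_def)
  show "(\<lambda>l. d l i) \<longlonglongrightarrow> 0" using assms by (auto simp: data_converge_def)
qed

text \<open>Induction on the number of steps: although neither the step size nor the momentum coefficient is a
  continuous function of the state, the updates of the state are continuous along admissible states.\<close>
lemma stability:
  assumes dc: "data_converge yd d" and j: "\<forall>n. j n \<in> {1..N}"
  shows "state_tendsto (\<lambda>l. run (yd l) (d l) j n) (erun j n)"
proof (induction n)
  case 0
  then show ?case by (simp add: state_tendsto_def heavy_ball.shb.simps)
next
  case (Suc n)
  let ?S = "\<lambda>l. run (yd l) (d l) j n" and ?s = "erun j n" and ?i = "j n"
  have i: "?i \<in> {1..N}" using j by blast
  have nz: "\<And>l. noise (yd l) (d l)" and d: "(\<lambda>l. d l ?i) \<longlonglongrightarrow> 0"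
    using dc i by (auto simp: data_converge_def)
  note yd = data_converge_yd[OF dc i]
  have S: "admissible (?S l)" "admissible ?s" for l using admissible_run[OF nz j] admissible_erun[OF j] by auto
  have x: "(\<lambda>l. primal_it (?S l)) \<longlonglongrightarrow> primal_it ?s" using Suc by (simp add: state_tendsto_def)
  note st = step_tendsto[where yd=yd and d=d and x="\<lambda>l. primal_it (?S l)", OF i admissible_Bl[OF S(1)] x nz d yd]
    and mt = mom_tendsto[where yd=yd and d=d and S="?S", OF i S Suc nz d yd]
  have dual: "(\<lambda>l. dual_it (stp (yd l) (d l) ?i (?S l))) \<longlonglongrightarrow> dual_it (stp y (\<lambda>_. 0) ?i ?s)"
    unfolding stp_simps(1) using Suc by (intro tendsto_intros st mt) (simp add: state_tendsto_def)
  have mom: "(\<lambda>l. momentum (stp (yd l) (d l) ?i (?S l))) \<longlonglongrightarrow> momentum (stp y (\<lambda>_. 0) ?i ?s)"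
    unfolding stp_simps(3) scaleR_minus_left by (intro tendsto_intros st mt)
  have prim: "(\<lambda>l. primal_it (stp (yd l) (d l) ?i (?S l))) \<longlonglongrightarrow> primal_it (stp y (\<lambda>_. 0) ?i ?s)"
    by (rule breg_tendsto(1)[OF _ _ dual]) (simp_all add: stp_simps(2) subgrad_conj_grad)
  have "(\<lambda>l. gam (stp (yd l) (d l) ?i (?S l))) \<longlonglongrightarrow> gam (stp y (\<lambda>_. 0) ?i ?s)"
    unfolding stp_simps(4) by (intro tendsto_intros mom prim x st mt)
  then show ?case using dual mom prim by (simp add: state_tendsto_def heavy_ball.shb.simps)
qed

section \<open>Stopping of the noisy method\<close>

text \<open>A step that resets the active indices decreases the Bregman distance to \<open>zsol\<close> by an amount that is
  bounded below in terms of the least noise level. So there are finitely many resets, and after the last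
  one every index is eventually drawn and removed.\<close>
lemma terminates:
  assumes nz: "noise yd d" and d: "\<And>i. i \<in> {1..N} \<Longrightarrow> d i > 0" and j: "\<forall>n. j n \<in> {1..N}"
    and inf: "\<And>i n. i \<in> {1..N} \<Longrightarrow> \<exists>k\<ge>n. j k = i"
  shows "\<exists>n. active (run yd d j n) = {}"
proof -
  define s where "s n = run yd d j n" for n
  have s_Suc: "s (Suc n) = stp yd d (j n) (s n)" for n by (simp add: s_def heavy_ball.shb.simps)
  have admissible: "admissible (s n)" for n unfolding s_def by (rule admissible_run[OF nz j])
  have jn: "j n \<in> {1..N}" for n using j by blast
  define \<Delta> where "\<Delta> n = breg (dual_it (s n)) zsol (primal_it (s n))" for n
  have dec: "decseq \<Delta>" unfolding \<Delta>_def s_def by (rule run_breg_mono[OF nz j zsol_Sol])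
  have "0 \<le> \<Delta> n" for n unfolding \<Delta>_def
    using breg_nonneg Sol_edom[OF zsol_Sol] admissible unfolding admissible_def by blast
  then obtain l where l: "\<Delta> \<longlonglongrightarrow> l" using decseq_convergent[OF dec] by blast
  have diff: "(\<lambda>n. \<Delta> n - \<Delta> (Suc n)) \<longlonglongrightarrow> 0" using tendsto_diff[OF l LIMSEQ_Suc[OF l]] by simp
  define dm where "dm = Min (d ` {1..N})"
  have "dm \<in> d ` {1..N}" unfolding dm_def using N by (intro Min_in) auto
  then have dm: "dm > 0" using d by blast
  have dm_le: "dm \<le> d (j n)" for n unfolding dm_def using jn by (intro Min_le) auto
  have ls: "0 \<le> \<theta> * loss yd d (j n) (primal_it (s n))"
    "0 \<le> (mom yd d (j n) (s n))\<^sup>2 * (norm (momentum (s n)))\<^sup>2 / (4 * \<sigma>)" for n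
    using loss_nonneg[OF nz jn admissible_Bl[OF admissible]] \<theta> \<sigma> by auto
  have desc: "\<theta> * loss yd d (j n) (primal_it (s n)) + (mom yd d (j n) (s n))\<^sup>2 * (norm (momentum (s n)))\<^sup>2 / (4 * \<sigma>)
      \<le> \<Delta> n - \<Delta> (Suc n)" for n
    using breg_decrease[OF nz jn admissible zsol_Sol, of n n] unfolding \<Delta>_def s_Suc by linarith
  have "\<forall>\<^sub>F n in sequentially. \<Delta> n - \<Delta> (Suc n) < \<theta> * (c0 * c1 * (\<tau> * dm)\<^sup>2)"
    by (rule order_tendstoD(2)[OF diff]) (use \<theta> c0 c1 \<tau> dm in simp)
  then have t0: "\<forall>\<^sub>F n in sequentially. tsz yd d (j n) (primal_it (s n)) = 0"
  proof eventually_elim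
    case (elim n)
    let ?R = "norm (res yd (j n) (primal_it (s n)))"
    have "?R \<le> \<tau> * d (j n)"
    proof (rule ccontr)
      assume *: "\<not> ?R \<le> \<tau> * d (j n)"
      moreover have "\<tau> * dm \<le> \<tau> * d (j n)" using dm_le[of n] \<tau> by simp
      ultimately have "\<tau> * dm \<le> ?R" by linarith
      then have "(\<tau> * dm)\<^sup>2 \<le> ?R\<^sup>2" using \<tau> dm by (intro power_mono) auto
      then have "c0 * c1 * (\<tau> * dm)\<^sup>2 \<le> c0 * c1 * ?R\<^sup>2" using c0 c1 by (intro mult_left_mono) auto
      also have "\<dots> \<le> loss yd d (j n) (primal_it (s n))"
        using loss_lower[OF nz jn admissible_Bl[OF admissible]] * by simp
      finally have "\<theta> * (c0 * c1 * (\<tau> * dm)\<^sup>2) \<le> \<theta> * loss yd d (j n) (primal_it (s n))"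
        using \<theta> by (intro mult_left_mono) auto
      then show False using elim desc[of n] ls(2)[of n] by linarith
    qed
    then show ?case by (rule tsz_zero[OF nz jn admissible_Bl[OF admissible]])
  qed
  have b0: "\<forall>\<^sub>F n in sequentially. mom yd d (j n) (s n) = 0"
  proof (cases "\<beta> = 0")
    case True
    then have "mom yd d (j n) (s n) = 0" for n using mom_bounds[OF nz jn, of n "s n"] by simp
    then show ?thesis by simp
  next
    case False
    define K where "K = min (2 * \<sigma> * \<upsilon>1 * dm) \<beta> * (\<upsilon>0 * dm)"
    have K: "K > 0" unfolding K_def using False \<beta> \<sigma> \<upsilon>0 \<upsilon>1 dm by simp
    have "\<forall>\<^sub>F n in sequentially. \<Delta> n - \<Delta> (Suc n) < K\<^sup>2 / (4 * \<sigma>)"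
      by (rule order_tendstoD(2)[OF diff]) (use K \<sigma> in simp)
    then show ?thesis
    proof eventually_elim
      case (elim n)
      let ?b = "mom yd d (j n) (s n)" and ?m = "norm (momentum (s n))"
      show ?case
      proof (rule ccontr)
        assume b: "?b \<noteq> 0"
        note ml = mom_lower[OF nz jn b]
        have "2 * \<sigma> * \<upsilon>1 * dm \<le> 2 * \<sigma> * \<upsilon>1 * d (j n)" using dm_le[of n] \<sigma> \<upsilon>1 by simp
        then have "min (2 * \<sigma> * \<upsilon>1 * dm) \<beta> \<le> ?b" using ml by linarith
        moreover have "\<upsilon>0 * dm \<le> ?m" using ml mult_left_mono[OF dm_le[of n], of \<upsilon>0] \<upsilon>0 by linarith
        ultimately have "K \<le> ?b * ?m" unfolding K_def
          using mom_bounds(1)[OF nz jn] \<upsilon>0 dm by (intro mult_mono) auto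
        then have "K\<^sup>2 \<le> (?b * ?m)\<^sup>2" using K by (intro power_mono) auto
        then have "K\<^sup>2 / (4 * \<sigma>) \<le> ?b\<^sup>2 * ?m\<^sup>2 / (4 * \<sigma>)" using \<sigma> by (simp add: power_mult_distrib divide_right_mono)
        then show False using elim desc[of n] ls(1)[of n] by linarith
      qed
    qed
  qed
  from t0 b0 have "\<forall>\<^sub>F n in sequentially. active (s (Suc n)) = active (s n) - {j n}"
    by eventually_elim (simp add: s_Suc stp_simps(5))
  then obtain n0 where n0: "\<And>n. n \<ge> n0 \<Longrightarrow> active (s (Suc n)) = active (s n) - {j n}"
    by (auto simp: eventually_sequentially)
  have sub: "active (s n) \<subseteq> {1..N}" for n
  proof (induction n)
    case (Suc n)
    then show ?case unfolding s_Suc stp_simps(5) by auto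
  qed (simp add: s_def heavy_ball.shb.simps)
  have mono: "active (s n) \<subseteq> active (s k)" if "n0 \<le> k" "k \<le> n" for k n
    using that(2,1) by (induction n rule: dec_induct) (auto simp: n0)
  have "\<forall>\<^sub>F n in sequentially. i \<notin> active (s n)" if i: "i \<in> {1..N}" for i
  proof -
    obtain k where k: "k \<ge> n0" "j k = i" using inf[OF i] by blast
    then have "i \<notin> active (s (Suc k))" using n0 by auto
    then have "i \<notin> active (s n)" if "n \<ge> Suc k" for n using mono[of "Suc k" n] that k by auto
    then show ?thesis by (auto simp: eventually_sequentially)
  qed
  then have "\<forall>\<^sub>F n in sequentially. \<forall>i\<in>{1..N}. i \<notin> active (s n)" by (intro eventually_ball_finite) auto
  then obtain n where "\<forall>i\<in>{1..N}. i \<notin> active (s n)" by (auto simp: eventually_sequentially)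
  then have "active (s n) = {}" using sub[of n] by blast
  then show ?thesis unfolding s_def by blast
qed

text \<open>An index is removed only when its residual is below the threshold, and since the last reset the
  iterate has not moved.\<close>
lemma inactive_resid:
  assumes nz: "noise yd d" and j: "\<forall>n. j n \<in> {1..N}"
  shows "i \<in> {1..N} \<Longrightarrow> i \<notin> active (run yd d j n) \<Longrightarrow> norm (res yd i (primal_it (run yd d j n))) \<le> \<tau> * d i"
proof (induction n arbitrary: i)
  case 0
  then show ?case by (simp add: heavy_ball.shb.simps)
next
  case (Suc n)
  let ?s = "run yd d j n"
  have jn: "j n \<in> {1..N}" using j by blast
  note admissible = admissible_run[OF nz j, of n]
  have run_Suc: "run yd d j (Suc n) = stp yd d (j n) ?s" by (simp add: heavy_ball.shb.simps)
  have t0: "tsz yd d (j n) (primal_it ?s) = 0" "mom yd d (j n) ?s = 0" and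
    act: "i \<in> active ?s \<Longrightarrow> i = j n"
    using Suc.prems unfolding run_Suc stp_simps(5) by (auto split: if_splits)
  have "dual_it (stp yd d (j n) ?s) = dual_it ?s" by (simp add: stp_simps(1) t0)
  then have "subgrad (dual_it ?s) (primal_it (stp yd d (j n) ?s))"
    unfolding stp_simps(2) using subgrad_conj_grad by metis
  then have same: "primal_it (stp yd d (j n) ?s) = primal_it ?s"
    using subgrad_unique admissible unfolding admissible_def by blast
  show ?case
  proof (cases "i \<in> active ?s")
    case False
    then show ?thesis using Suc.IH Suc.prems(1) unfolding run_Suc same by blast
  next
    case True
    then have i: "i = j n" by (rule act)
    show ?thesis
    proof (rule ccontr)
      assume "\<not> ?thesis"
      then have R: "norm (res yd (j n) (primal_it ?s)) > \<tau> * d (j n)" unfolding run_Suc same i by simp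
      then have "c1 * norm (res yd (j n) (primal_it ?s)) \<le> 0"
        using tsz_lower[OF nz jn admissible_Bl[OF admissible] R] t0(1) by simp
      moreover have "0 \<le> \<tau> * d (j n)" using nz jn \<tau> by (simp add: noise_def)
      ultimately show False using R c1 by (simp add: mult_le_0_iff)
    qed
  qed
qed

text \<open>Fix a large \<open>n0\<close>. Runs that stop at \<open>n0\<close> or later are at the stopping time at least as close to \<open>xs\<close>
  as at step \<open>n0\<close>, where stability applies. If infinitely many runs stop at the same earlier step \<open>n\<close>,
  then the exact iterate at step \<open>n\<close> solves the system, so the exact run stays there and the iterate
  is \<open>xs\<close>; again stability applies at step \<open>n\<close>.\<close>
theorem stopped_convergence:
  assumes dc: "data_converge yd d" and j: "\<forall>n. j n \<in> {1..N}"
    and stop: "\<And>l. active (run (yd l) (d l) j (k l)) = {}"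
    and xs: "xs \<in> Sol" "(\<lambda>n. primal_it (erun j n)) \<longlonglongrightarrow> xs"
      "(\<lambda>n. breg (dual_it (erun j n)) xs (primal_it (erun j n))) \<longlonglongrightarrow> 0"
  shows "(\<lambda>l. breg (dual_it (run (yd l) (d l) j (k l))) xs (primal_it (run (yd l) (d l) j (k l)))) \<longlonglongrightarrow> 0"
proof -
  define Bg where "Bg l n = breg (dual_it (run (yd l) (d l) j n)) xs (primal_it (run (yd l) (d l) j n))" for l n
  have nz: "noise (yd l) (d l)" for l using dc by (simp add: data_converge_def)
  have admissible: "admissible (run (yd l) (d l) j n)" for l n by (rule admissible_run[OF nz j])
  have Bg_lim: "(\<lambda>l. Bg l n) \<longlonglongrightarrow> breg (dual_it (erun j n)) xs (primal_it (erun j n))" for n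
    unfolding Bg_def using stability[OF dc j, of n] admissible erun_subgrad[OF j]
    by (intro breg_tendsto(2)) (auto simp: state_tendsto_def admissible_def)
  have Bg0: "0 \<le> Bg l n" for l n
    unfolding Bg_def using breg_nonneg[OF _ Sol_edom[OF xs(1)]] admissible unfolding admissible_def by blast
  show ?thesis
  proof (rule order_tendstoI)
    fix a :: real assume "a < 0"
    then show "\<forall>\<^sub>F l in sequentially. a < breg (dual_it (run (yd l) (d l) j (k l))) xs (primal_it (run (yd l) (d l) j (k l)))"
      using Bg0 unfolding Bg_def by (intro always_eventually allI) (meson less_le_trans)
  next
    fix e :: real assume e: "0 < e"
    obtain n0 where n0: "breg (dual_it (erun j n0)) xs (primal_it (erun j n0)) < e"
      using order_tendstoD(2)[OF xs(3) e] by (auto simp: eventually_sequentially)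
    have late: "\<forall>\<^sub>F l in sequentially. Bg l n0 < e" using order_tendstoD(2)[OF Bg_lim n0] .
    have early: "\<forall>\<^sub>F l in sequentially. k l = n \<longrightarrow> Bg l n < e" for n
    proof (cases "\<exists>\<^sub>F l in sequentially. k l = n")
      case False
      then have "\<forall>\<^sub>F l in sequentially. k l \<noteq> n" by (simp add: not_frequently)
      then show ?thesis by eventually_elim simp
    next
      case True
      let ?x = "primal_it (erun j n)"
      have "F i ?x = y i" if i: "i \<in> {1..N}" for i
      proof (rule ccontr)
        assume "F i ?x \<noteq> y i"
        then have pos: "0 < norm (res y i ?x) - \<tau> * 0" by (simp add: heavy_ball.resid_def)
        have "(\<lambda>l. res (yd l) i (primal_it (run (yd l) (d l) j n))) \<longlonglongrightarrow> res y i ?x"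
          using stability[OF dc j, of n] unfolding state_tendsto_def
          by (intro resid_tendsto i admissible_Bl admissible data_converge_yd[OF dc i]) blast
        then have "(\<lambda>l. norm (res (yd l) i (primal_it (run (yd l) (d l) j n))) - \<tau> * d l i) \<longlonglongrightarrow> norm (res y i ?x) - \<tau> * 0"
          using dc i by (intro tendsto_intros) (auto simp: data_converge_def)
        then have "\<forall>\<^sub>F l in sequentially. 0 < norm (res (yd l) i (primal_it (run (yd l) (d l) j n))) - \<tau> * d l i"
          by (rule order_tendstoD(1)[OF _ pos])
        with True have "\<exists>\<^sub>F l in sequentially. k l = n \<and> 0 < norm (res (yd l) i (primal_it (run (yd l) (d l) j n))) - \<tau> * d l i"
          by (rule frequently_eventually_frequently)
        then obtain l where "k l = n" "0 < norm (res (yd l) i (primal_it (run (yd l) (d l) j n))) - \<tau> * d l i"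
          using frequently_ex by blast
        then show False using inactive_resid[OF nz j i, of l n] stop[of l] by simp
      qed
      then have P: "Phi ?x = 0" by (simp add: Phi_eq_0)
      have "(\<lambda>n. primal_it (erun j n)) \<longlonglongrightarrow> ?x"
        by (rule tendsto_eventually, unfold eventually_sequentially) (use erun_stays[OF j P] in blast)
      then have "xs = ?x" using xs(2) LIMSEQ_unique by blast
      then have "breg (dual_it (erun j n)) xs ?x < e" using e by simp
      then have "\<forall>\<^sub>F l in sequentially. Bg l n < e" by (rule order_tendstoD(2)[OF Bg_lim])
      then show ?thesis by eventually_elim simp
    qed
    have "\<forall>\<^sub>F l in sequentially. \<forall>n\<in>{..<n0}. k l = n \<longrightarrow> Bg l n < e"
      by (intro eventually_ball_finite) (use early in auto)
    with late have "\<forall>\<^sub>F l in sequentially. Bg l (k l) < e"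
    proof eventually_elim
      case (elim l)
      show ?case
      proof (cases "k l < n0")
        case False
        then have "Bg l (k l) \<le> Bg l n0"
          unfolding Bg_def using decseqD[OF run_breg_mono[OF nz j xs(1)], of n0 "k l" l] by simp
        then show ?thesis using elim by simp
      qed (use elim in auto)
    qed
    then show "\<forall>\<^sub>F l in sequentially. breg (dual_it (run (yd l) (d l) j (k l))) xs (primal_it (run (yd l) (d l) j (k l))) < e"
      unfolding Bg_def .
  qed
qed

end

section \<open>The random index sequence\<close>

locale uniform_indices = prob_space M
  for M :: "'w measure" and N :: nat and \<iota> :: "nat \<Rightarrow> 'w \<Rightarrow> nat" +
  assumes N_pos: "N \<ge> 1" and iid: "uniform_iid_indices M N \<iota>"
begin

lemma idx_measurable: "\<iota> n \<in> measurable M (count_space {1..N})"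
  using iid unfolding uniform_iid_indices_def indep_vars_def by blast

lemma idx_range: "\<omega> \<in> space M \<Longrightarrow> \<iota> n \<omega> \<in> {1..N}"
  using measurable_space[OF idx_measurable] by simp

lemma idx_sets: "{\<omega> \<in> space M. \<iota> n \<omega> \<in> A} \<in> sets M"
proof -
  have "\<iota> n -` (A \<inter> {1..N}) \<inter> space M \<in> sets M" by (rule measurable_sets[OF idx_measurable]) simp
  moreover have "\<iota> n -` (A \<inter> {1..N}) \<inter> space M = {\<omega> \<in> space M. \<iota> n \<omega> \<in> A}" using idx_range by auto
  ultimately show ?thesis by simp
qed

lemma prob_cylinder:
  assumes J: "finite J" and A: "\<And>k. k \<in> J \<Longrightarrow> A k \<subseteq> {1..N}"
  shows "prob {\<omega> \<in> space M. \<forall>k\<in>J. \<iota> k \<omega> \<in> A k} = (\<Prod>k\<in>J. real (card (A k)) / real N)"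
proof (cases "J = {}")
  case True then show ?thesis by (simp add: prob_space)
next
  case False
  have one: "prob (\<iota> k -` A k \<inter> space M) = real (card (A k)) / real N" if "k \<in> J" for k
  proof -
    have "prob (\<iota> k -` A k \<inter> space M) = measure (distr M (count_space {1..N}) (\<iota> k)) (A k)"
      using A[OF that] by (intro measure_distr[symmetric] idx_measurable) auto
    also have "\<dots> = measure (uniform_count_measure {1..N}) (A k)"
      using iid by (simp add: uniform_iid_indices_def)
    also have "\<dots> = real (card (A k)) / real N"
      using A[OF that] by (subst measure_uniform_count_measure) auto
    finally show ?thesis .
  qed
  have "{\<omega> \<in> space M. \<forall>k\<in>J. \<iota> k \<omega> \<in> A k} = (\<Inter>k\<in>J. \<iota> k -` A k \<inter> space M)" using False by auto
  also have "prob \<dots> = (\<Prod>k\<in>J. prob (\<iota> k -` A k \<inter> space M))"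
    by (rule indep_varsD[of "\<lambda>_. count_space {1..N}" \<iota> UNIV])
      (use iid False J A in \<open>auto simp: uniform_iid_indices_def\<close>)
  also have "\<dots> = (\<Prod>k\<in>J. real (card (A k)) / real N)" by (rule prod.cong) (use one in auto)
  finally show ?thesis .
qed

text \<open>Everything the method does in \<open>n\<close> steps is a function of this list, which has countably many values.
  So measurability is immediate, also in a nonseparable Hilbert space.\<close>
definition prefix_of :: "nat \<Rightarrow> 'w \<Rightarrow> nat list" where "prefix_of n \<omega> = map (\<lambda>k. \<iota> k \<omega>) [0..<n]"

lemma length_prefix [simp]: "length (prefix_of n \<omega>) = n" by (simp add: prefix_of_def)

lemma nth_prefix: "k < n \<Longrightarrow> prefix_of n \<omega> ! k = \<iota> k \<omega>" by (simp add: prefix_of_def)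

lemma prefix_eq_iff: "prefix_of n \<omega> = l \<longleftrightarrow> length l = n \<and> (\<forall>k\<in>{..<n}. \<iota> k \<omega> \<in> {l ! k})"
  by (auto simp: prefix_of_def list_eq_iff_nth_eq)

lemma prefix_measurable: "prefix_of n \<in> measurable M (count_space UNIV)"
proof -
  have "prefix_of n -` {l} \<inter> space M \<in> sets M" for l
  proof (cases "length l = n")
    case True
    then have "prefix_of n -` {l} \<inter> space M = {\<omega> \<in> space M. \<forall>k\<in>{..<n}. \<iota> k \<omega> \<in> {l ! k}}"
      using prefix_eq_iff by (auto simp del: singleton_iff)
    also have "\<dots> \<in> sets M" by (intro sets.sets_Collect_finite_All idx_sets) auto
    finally show ?thesis .
  next
    case False
    then have "prefix_of n -` {l} \<inter> space M = {}" by auto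
    then show ?thesis by simp
  qed
  then show ?thesis by (subst measurable_count_space_eq2_countable) auto
qed

definition words :: "nat \<Rightarrow> nat list set" where
  "words n = {l. set l \<subseteq> {1..N} \<and> length l = n}"

lemma finite_words: "finite (words n)"
  unfolding words_def by (rule finite_lists_length_eq) simp

lemma prefix_in_words: "\<omega> \<in> space M \<Longrightarrow> prefix_of n \<omega> \<in> words n"
  using idx_range by (auto simp: prefix_of_def words_def)

lemma nn_integral_prefix:
  "(\<integral>\<^sup>+\<omega>. g (prefix_of n \<omega>) \<partial>M) = (\<Sum>l\<in>words n. g l) * ennreal (1 / real N) ^ n"
proof -
  have e: "emeasure M (prefix_of n -` {l} \<inter> space M) = ennreal (1 / real N) ^ n" if l: "l \<in> words n" for l
  proof -
    have "prefix_of n -` {l} \<inter> space M = {\<omega> \<in> space M. \<forall>k\<in>{..<n}. \<iota> k \<omega> \<in> {l ! k}}"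
      using l prefix_eq_iff[of n _ l] by (auto simp: words_def)
    also have "prob \<dots> = (\<Prod>k<n. real (card {l ! k}) / real N)"
      by (rule prob_cylinder) (use l nth_mem in \<open>fastforce simp: words_def\<close>)+
    finally have "prob (prefix_of n -` {l} \<inter> space M) = (1 / real N) ^ n" by (simp add: power_divide)
    then show ?thesis by (simp add: emeasure_eq_measure ennreal_power)
  qed
  have s: "prefix_of n -` {l} \<inter> space M \<in> sets M" for l by (rule measurable_sets[OF prefix_measurable]) simp
  have "(\<integral>\<^sup>+\<omega>. g (prefix_of n \<omega>) \<partial>M) = (\<integral>\<^sup>+\<omega>. (\<Sum>l\<in>words n. g l * indicator (prefix_of n -` {l} \<inter> space M) \<omega>) \<partial>M)"
  proof (rule nn_integral_cong)
    fix \<omega> assume w: "\<omega> \<in> space M"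
    have "(\<Sum>l\<in>words n. g l * indicator (prefix_of n -` {l} \<inter> space M) \<omega>) = (\<Sum>l\<in>words n. if prefix_of n \<omega> = l then g l else 0)"
      using w by (intro sum.cong) (auto simp: indicator_def)
    also have "\<dots> = g (prefix_of n \<omega>)" using finite_words prefix_in_words[OF w] by simp
    finally show "g (prefix_of n \<omega>) = (\<Sum>l\<in>words n. g l * indicator (prefix_of n -` {l} \<inter> space M) \<omega>)" ..
  qed
  also have "\<dots> = (\<Sum>l\<in>words n. g l * emeasure M (prefix_of n -` {l} \<inter> space M))"
    using s by (subst nn_integral_sum) (auto intro!: sum.cong nn_integral_cmult_indicator)
  also have "\<dots> = (\<Sum>l\<in>words n. g l) * ennreal (1 / real N) ^ n" using e by (simp add: sum_distrib_right)
  finally show ?thesis .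
qed

lemma words_Suc: "words (Suc n) = (\<lambda>(l, i). l @ [i]) ` (words n \<times> {1..N})"
proof (intro equalityI subsetI)
  fix l assume l: "l \<in> words (Suc n)"
  then have "l \<noteq> []" by (auto simp: words_def)
  then have "l = butlast l @ [last l]" "last l \<in> set l" by simp_all
  moreover have "butlast l \<in> words n" using l by (auto simp: words_def dest: in_set_butlastD)
  ultimately show "l \<in> (\<lambda>(l, i). l @ [i]) ` (words n \<times> {1..N})"
    using l by (intro image_eqI[of _ _ "(butlast l, last l)"]) (auto simp: words_def)
qed (auto simp: words_def)

text \<open>Conditionally on the past, the next index is uniform. So the expectation of a quantity at the drawn
  index is the average over all indices.\<close>
lemma next_index_uniform:
  fixes h :: "nat \<Rightarrow> (nat \<Rightarrow> nat) \<Rightarrow> ennreal"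
  assumes dep: "\<And>i j j'. (\<And>k. k < n \<Longrightarrow> j k = j' k) \<Longrightarrow> h i j = h i j'"
  shows "(\<Sum>i\<in>{1..N}. \<integral>\<^sup>+\<omega>. h i (\<lambda>k. \<iota> k \<omega>) \<partial>M) = of_nat N * (\<integral>\<^sup>+\<omega>. h (\<iota> n \<omega>) (\<lambda>k. \<iota> k \<omega>) \<partial>M)"
proof -
  define H where "H i l = h i (nth l)" for i l
  let ?c = "ennreal (1 / real N)"
  have h: "h i (\<lambda>k. \<iota> k \<omega>) = H i (prefix_of n \<omega>)" for i \<omega>
    unfolding H_def by (rule dep) (simp add: nth_prefix)
  have "(\<integral>\<^sup>+\<omega>. h (\<iota> n \<omega>) (\<lambda>k. \<iota> k \<omega>) \<partial>M) = (\<integral>\<^sup>+\<omega>. (\<lambda>l. H (last l) (butlast l)) (prefix_of (Suc n) \<omega>) \<partial>M)"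
    by (simp add: h prefix_of_def)
  also have "\<dots> = (\<Sum>l\<in>words (Suc n). H (last l) (butlast l)) * ?c ^ Suc n"
    by (rule nn_integral_prefix)
  also have "(\<Sum>l\<in>words (Suc n). H (last l) (butlast l)) = (\<Sum>(l, i)\<in>words n \<times> {1..N}. H i l)"
    unfolding words_Suc by (subst sum.reindex) (auto simp: inj_on_def intro!: sum.cong)
  also have "\<dots> = (\<Sum>i\<in>{1..N}. \<Sum>l\<in>words n. H i l)"
    by (subst sum.cartesian_product[symmetric], rule sum.swap)
  finally have "(\<integral>\<^sup>+\<omega>. h (\<iota> n \<omega>) (\<lambda>k. \<iota> k \<omega>) \<partial>M) = ?c * (\<Sum>i\<in>{1..N}. (\<Sum>l\<in>words n. H i l) * ?c ^ n)"
    unfolding sum_distrib_right[symmetric] by (simp only: power_Suc mult_ac)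
  also have "(\<Sum>i\<in>{1..N}. (\<Sum>l\<in>words n. H i l) * ?c ^ n) = (\<Sum>i\<in>{1..N}. \<integral>\<^sup>+\<omega>. h i (\<lambda>k. \<iota> k \<omega>) \<partial>M)"
    by (simp add: h nn_integral_prefix)
  finally have "of_nat N * (\<integral>\<^sup>+\<omega>. h (\<iota> n \<omega>) (\<lambda>k. \<iota> k \<omega>) \<partial>M)
      = (of_nat N * ?c) * (\<Sum>i\<in>{1..N}. \<integral>\<^sup>+\<omega>. h i (\<lambda>k. \<iota> k \<omega>) \<partial>M)" by (simp add: mult_ac)
  moreover have "of_nat N * ?c = 1"
    using N_pos by (simp add: ennreal_of_nat_eq_real_of_nat ennreal_mult[symmetric])
  ultimately show ?thesis by simp
qed

text \<open>Avoiding \<open>i\<close> for \<open>m\<close> draws has probability \<open>((N - 1) / N)\<^sup>m\<close>.\<close>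
lemma AE_infinitely_often: "AE \<omega> in M. \<forall>i\<in>{1..N}. \<forall>n. \<exists>k\<ge>n. \<iota> k \<omega> = i"
proof -
  have "AE \<omega> in M. \<exists>k\<ge>n. \<iota> k \<omega> = i" if i: "i \<in> {1..N}" for i n
  proof -
    let ?B = "{\<omega> \<in> space M. \<forall>k. k \<ge> n \<longrightarrow> \<iota> k \<omega> \<in> - {i}}"
    have B: "?B \<in> sets M" by (intro sets.sets_Collect_countable_All sets.sets_Collect_imp idx_sets) auto
    have le: "prob ?B \<le> (real (N - 1) / real N) ^ m" for m
    proof -
      let ?J = "{n..<n + m}"
      have Cs: "{\<omega> \<in> space M. \<forall>k\<in>?J. \<iota> k \<omega> \<in> {1..N} - {i}} \<in> sets M"
        by (intro sets.sets_Collect_finite_All idx_sets) auto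
      have "prob ?B \<le> prob {\<omega> \<in> space M. \<forall>k\<in>?J. \<iota> k \<omega> \<in> {1..N} - {i}}"
        by (rule finite_measure_mono[OF _ Cs]) (use idx_range in auto)
      also have "\<dots> = (\<Prod>k\<in>?J. real (card ({1..N} - {i})) / real N)" by (rule prob_cylinder) auto
      also have "\<dots> = (real (N - 1) / real N) ^ m" using i by simp
      finally show ?thesis .
    qed
    have "(\<lambda>m. (real (N - 1) / real N) ^ m) \<longlonglongrightarrow> 0"
      by (rule LIMSEQ_realpow_zero) (use N_pos in simp_all)
    from LIMSEQ_le_const[OF this, of "prob ?B"] have "prob ?B \<le> 0" using le by blast
    then have "emeasure M ?B = 0" by (simp only: emeasure_eq_measure measure_le_0_iff ennreal_0)
    then have "?B \<in> null_sets M" using B by (intro null_setsI)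
    then show ?thesis by (rule AE_I') auto
  qed
  then show ?thesis by (simp add: AE_ball_countable AE_all_countable)
qed

end

context shb_setting
begin

lemma run_cong: "(\<And>k. k < n \<Longrightarrow> j k = j' k) \<Longrightarrow> run yd d j n = run yd d j' n"
  by (induction n) (simp_all add: heavy_ball.shb.simps)

text \<open>The decrease in one step dominates the squared residual of the drawn equation, and the decreases
  telescope. The bound does not depend on the path.\<close>
lemma sampled_residuals_sum_le:
  assumes j: "\<forall>n. j n \<in> {1..N}"
  shows "(\<Sum>k<n. (norm (F (j k) (primal_it (erun j k)) - y (j k)))\<^sup>2) \<le> \<sigma> * \<rho>\<^sup>2 / (\<theta> * (c0 * c1))"
proof -
  define \<Delta> where "\<Delta> n = breg (dual_it (erun j n)) zsol (primal_it (erun j n))" for n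
  let ?R = "\<lambda>k. norm (F (j k) (primal_it (erun j k)) - y (j k))"
  have step: "\<theta> * (c0 * c1) * (?R k)\<^sup>2 \<le> \<Delta> k - \<Delta> (Suc k)" for k
  proof -
    let ?s = "erun j k"
    have jk: "j k \<in> {1..N}" using j by blast
    have R: "?R k = norm (res y (j k) (primal_it ?s))" by (simp add: heavy_ball.resid_def)
    have "c0 * c1 * (?R k)\<^sup>2 \<le> loss y (\<lambda>_. 0) (j k) (primal_it ?s)"
    proof (cases "?R k = 0")
      case True
      then show ?thesis using loss_nonneg[OF noise_exact jk erun_Bl[OF j]] by simp
    next
      case False
      then have "norm (res y (j k) (primal_it ?s)) > \<tau> * 0" unfolding R by simp
      then show ?thesis unfolding R by (rule loss_lower[OF noise_exact jk erun_Bl[OF j]])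
    qed
    then have "\<theta> * (c0 * c1 * (?R k)\<^sup>2) \<le> \<theta> * loss y (\<lambda>_. 0) (j k) (primal_it ?s)"
      using \<theta> by (intro mult_left_mono) auto
    moreover have "0 \<le> (mom y (\<lambda>_. 0) (j k) ?s)\<^sup>2 * (norm (momentum ?s))\<^sup>2 / (4 * \<sigma>)" using \<sigma> by simp
    ultimately show ?thesis using breg_decrease[OF noise_exact jk admissible_erun[OF j] zsol_Sol, of k]
      by (simp add: \<Delta>_def heavy_ball.shb.simps mult.assoc)
  qed
  have "\<theta> * (c0 * c1) * (\<Sum>k<n. (?R k)\<^sup>2) = (\<Sum>k<n. \<theta> * (c0 * c1) * (?R k)\<^sup>2)" by (simp add: sum_distrib_left)
  also have "\<dots> \<le> (\<Sum>k<n. \<Delta> k - \<Delta> (Suc k))" by (intro sum_mono step)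
  also have "\<dots> = \<Delta> 0 - \<Delta> n" by (rule sum_lessThan_telescope')
  also have "\<dots> \<le> \<sigma> * \<rho>\<^sup>2"
    using zsol_spec(2) breg_nonneg[OF erun_subgrad[OF j] Sol_edom[OF zsol_Sol], of n]
    by (simp add: \<Delta>_def heavy_ball.shb.simps)
  finally show ?thesis using \<theta> c0 c1 by (simp add: field_simps)
qed

end

locale random_shb = shb_setting N Y A F L y \<Theta> r \<sigma> \<rho> \<eta> \<mu>0 \<mu>1 \<upsilon>0 \<upsilon>1 \<tau> \<beta> x0 \<xi>0 + uniform_indices M N \<iota>
  for N :: nat
    and Y :: "nat \<Rightarrow> 'b::real_normed_vector set"
    and A :: "nat \<Rightarrow> 'a::{real_inner,complete_space} set"
    and F L y \<Theta> r \<sigma> \<rho> \<eta> \<mu>0 \<mu>1 \<upsilon>0 \<upsilon>1 \<tau> \<beta> x0 \<xi>0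
    and M :: "'w measure" and \<iota> :: "nat \<Rightarrow> 'w \<Rightarrow> nat"
begin

abbreviation draws :: "'w \<Rightarrow> nat \<Rightarrow> nat" where "draws \<omega> \<equiv> (\<lambda>n. \<iota> n \<omega>)"

lemma draws_range: "\<omega> \<in> space M \<Longrightarrow> \<forall>n. draws \<omega> n \<in> {1..N}"
  using idx_range by blast

lemma run_prefix: "run yd d (draws \<omega>) n = run yd d (nth (prefix_of n \<omega>)) n"
  by (rule run_cong) (simp add: nth_prefix)

lemma run_measurable:
  assumes "\<And>s. f s \<in> space K"
  shows "(\<lambda>\<omega>. f (run yd d (draws \<omega>) n)) \<in> measurable M K"
  unfolding run_prefix by (rule measurable_compose[OF prefix_measurable]) (use assms in simp)

text \<open>In expectation the squared residual of the drawn equation is \<open>1 / N\<close> times \<open>Phi\<close>. Hence the pathwise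
  bound on the former gives a bound on the expected sum of the latter.\<close>
lemma AE_summable_Phi:
  shows "AE \<omega> in M. summable (\<lambda>n. Phi (primal_it (erun (draws \<omega>) n)))"
    and "integrable M (\<lambda>\<omega>. \<Sum>n. Phi (primal_it (erun (draws \<omega>) n)))"
proof -
  define C where "C = \<sigma> * \<rho>\<^sup>2 / (\<theta> * (c0 * c1))"
  let ?P = "\<lambda>n \<omega>. Phi (primal_it (erun (draws \<omega>) n))"
  let ?R = "\<lambda>i n \<omega>. (norm (F i (primal_it (erun (draws \<omega>) n)) - y i))\<^sup>2"
  have Pm[measurable]: "?P n \<in> borel_measurable M" for n
    by (rule run_measurable[of "\<lambda>s. Phi (primal_it s)"]) simp
  have Rm: "?R i n \<in> borel_measurable M" for i n
    by (rule run_measurable[of "\<lambda>s. (norm (F i (primal_it s) - y i))\<^sup>2"]) simp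
  have eq: "(\<integral>\<^sup>+\<omega>. ennreal (?P n \<omega>) \<partial>M) = of_nat N * (\<integral>\<^sup>+\<omega>. ennreal (?R (\<iota> n \<omega>) n \<omega>) \<partial>M)" for n
  proof -
    have "(\<integral>\<^sup>+\<omega>. ennreal (?P n \<omega>) \<partial>M) = (\<integral>\<^sup>+\<omega>. (\<Sum>i\<in>{1..N}. ennreal (?R i n \<omega>)) \<partial>M)"
      by (simp add: Phi_def sum_ennreal)
    also have "\<dots> = (\<Sum>i\<in>{1..N}. \<integral>\<^sup>+\<omega>. ennreal (?R i n \<omega>) \<partial>M)"
      using Rm by (intro nn_integral_sum) simp
    also have "\<dots> = of_nat N * (\<integral>\<^sup>+\<omega>. ennreal (?R (\<iota> n \<omega>) n \<omega>) \<partial>M)"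
      by (rule next_index_uniform[where h="\<lambda>i j. ennreal ((norm (F i (primal_it (erun j n)) - y i))\<^sup>2)"])
        (metis run_cong)
    finally show ?thesis .
  qed
  have Rm2: "(\<lambda>\<omega>. ?R (\<iota> n \<omega>) n \<omega>) \<in> borel_measurable M" for n
  proof -
    have "(\<lambda>\<omega>. ?R (\<iota> n \<omega>) n \<omega>) = (\<lambda>\<omega>. (\<lambda>l. (norm (F (l ! n) (primal_it (erun (nth l) n)) - y (l ! n)))\<^sup>2) (prefix_of (Suc n) \<omega>))"
    proof
      fix \<omega>
      have "erun (nth (prefix_of (Suc n) \<omega>)) n = erun (draws \<omega>) n" by (rule run_cong) (simp add: nth_prefix)
      then show "?R (\<iota> n \<omega>) n \<omega> = (\<lambda>l. (norm (F (l ! n) (primal_it (erun (nth l) n)) - y (l ! n)))\<^sup>2) (prefix_of (Suc n) \<omega>)"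
        by (simp add: nth_prefix)
    qed
    also have "\<dots> \<in> borel_measurable M" by (rule measurable_compose[OF prefix_measurable]) simp
    finally show ?thesis .
  qed
  have bound: "(\<Sum>n. ennreal (?R (\<iota> n \<omega>) n \<omega>)) \<le> ennreal C" if "\<omega> \<in> space M" for \<omega>
  proof (rule suminf_le_const)
    fix n
    have "(\<Sum>k<n. ennreal (?R (\<iota> k \<omega>) k \<omega>)) = ennreal (\<Sum>k<n. ?R (\<iota> k \<omega>) k \<omega>)" by (simp add: sum_ennreal)
    also have "\<dots> \<le> ennreal C" unfolding C_def
      using sampled_residuals_sum_le[OF draws_range[OF that], of n] by (intro ennreal_leI)
    finally show "(\<Sum>k<n. ennreal (?R (\<iota> k \<omega>) k \<omega>)) \<le> ennreal C" .
  qed simp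
  have "(\<integral>\<^sup>+\<omega>. (\<Sum>n. ennreal (?P n \<omega>)) \<partial>M) = (\<Sum>n. \<integral>\<^sup>+\<omega>. ennreal (?P n \<omega>) \<partial>M)"
    by (rule nn_integral_suminf) measurable
  also have "\<dots> = of_nat N * (\<Sum>n. \<integral>\<^sup>+\<omega>. ennreal (?R (\<iota> n \<omega>) n \<omega>) \<partial>M)" by (simp add: eq)
  also have "(\<Sum>n. \<integral>\<^sup>+\<omega>. ennreal (?R (\<iota> n \<omega>) n \<omega>) \<partial>M) = (\<integral>\<^sup>+\<omega>. (\<Sum>n. ennreal (?R (\<iota> n \<omega>) n \<omega>)) \<partial>M)"
    using Rm2 by (intro nn_integral_suminf[symmetric]) simp
  also have "\<dots> \<le> (\<integral>\<^sup>+\<omega>. ennreal C \<partial>M)" using bound by (rule nn_integral_mono)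
  also have "\<dots> = ennreal C" by (simp add: emeasure_space_1)
  finally have le: "(\<integral>\<^sup>+\<omega>. (\<Sum>n. ennreal (?P n \<omega>)) \<partial>M) \<le> of_nat N * ennreal C"
    by (simp add: mult_left_mono)
  also have "\<dots> < \<infinity>" by (simp add: ennreal_of_nat_eq_real_of_nat ennreal_mult_less_top)
  finally have fin: "(\<integral>\<^sup>+\<omega>. (\<Sum>n. ennreal (?P n \<omega>)) \<partial>M) < \<infinity>" .
  then have "AE \<omega> in M. (\<Sum>n. ennreal (?P n \<omega>)) \<noteq> \<infinity>"
    by (intro nn_integral_PInf_AE) auto
  then show AE: "AE \<omega> in M. summable (\<lambda>n. ?P n \<omega>)"
    by eventually_elim (rule summable_suminf_not_top, use Phi_nonneg in auto)
  show "integrable M (\<lambda>\<omega>. \<Sum>n. ?P n \<omega>)"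
  proof (rule integrableI_bounded)
    show "(\<lambda>\<omega>. \<Sum>n. ?P n \<omega>) \<in> borel_measurable M" by measurable
    have "(\<integral>\<^sup>+\<omega>. ennreal (norm (\<Sum>n. ?P n \<omega>)) \<partial>M) = (\<integral>\<^sup>+\<omega>. (\<Sum>n. ennreal (?P n \<omega>)) \<partial>M)"
      using AE by (intro nn_integral_cong_AE) (auto elim!: eventually_mono simp: suminf_ennreal2 Phi_nonneg suminf_nonneg)
    then show "(\<integral>\<^sup>+\<omega>. ennreal (norm (\<Sum>n. ?P n \<omega>)) \<partial>M) < \<infinity>" using fin by simp
  qed
qed

end

section \<open>The solution nearest to the initial guess\<close>

context shb_setting
begin

abbreviation "xdag \<equiv> x_dagger N A F y \<Theta> x0 \<xi>0"

text \<open>By the tangential cone condition, \<open>z\<close> in the ball solves \<open>F i z = F i x\<close> iff \<open>x - z\<close> lies in the kernel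
  of \<open>L i x\<close>. So the solutions in the ball are the intersection of the ball with an affine subspace,
  although the equations are nonlinear.\<close>
lemma Sol_closed_midpoint_convex:
  defines "C \<equiv> {z \<in> Bl. \<forall>i\<in>{1..N}. F i z = y i}"
  shows "closed C" and "x \<in> C \<Longrightarrow> z \<in> C \<Longrightarrow> (1/2) *\<^sub>R (x + z) \<in> C" and "Sol = C \<inter> edom \<Theta>"
proof -
  show "Sol = C \<inter> edom \<Theta>" unfolding C_def using SolI Sol_F Sol_Bl Sol_edom by blast
  show "closed C"
    unfolding closed_sequential_limits
  proof (intro allI impI)
    fix X l assume X: "(\<forall>n. X n \<in> C) \<and> X \<longlonglongrightarrow> l"
    then have XB: "X n \<in> Bl" and XF: "i \<in> {1..N} \<Longrightarrow> F i (X n) = y i" for n i by (auto simp: C_def)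
    have "l \<in> Bl" using F_tendsto(1)[of 1 X l] N XB X by auto
    moreover have "F i l = y i" if i: "i \<in> {1..N}" for i
    proof -
      have "(\<lambda>n. F i (X n)) \<longlonglongrightarrow> F i l" by (rule F_tendsto(2)[OF i XB]) (use X in simp)
      then show ?thesis using XF[OF i] LIMSEQ_unique[OF _ tendsto_const] by fastforce
    qed
    ultimately show "l \<in> C" by (simp add: C_def)
  qed
  assume x: "x \<in> C" and z: "z \<in> C"
  let ?w = "(1/2) *\<^sub>R (x + z)"
  have xB: "x \<in> Bl" and zB: "z \<in> Bl" using x z by (auto simp: C_def)
  have "(1/2) *\<^sub>R x + (1/2) *\<^sub>R z \<in> Bl" by (rule convexD[OF convex_cball xB zB]) auto
  then have w: "?w \<in> Bl" by (simp add: scaleR_right_distrib)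
  have "F i ?w = y i" if i: "i \<in> {1..N}" for i
  proof -
    have "norm (L i x (x - z)) \<le> 0" using L_difference_le[OF i xB zB] x z i by (simp add: C_def)
    then have L0: "L i x (x - z) = 0" by simp
    have "x - ?w = (1/2) *\<^sub>R (x - z)"
      by (simp add: algebra_simps flip: scaleR_left_distrib)
    then have "L i x (x - ?w) = 0" using L0 by (simp add: blinfun.scaleR_right)
    then have "(1 - \<eta>) * norm (F i x - F i ?w) \<le> 0" using F_difference_le[OF i xB w] by simp
    then have "norm (F i x - F i ?w) \<le> 0" using \<eta> by (simp add: mult_le_0_iff)
    then show ?thesis using x i by (simp add: C_def)
  qed
  then show "?w \<in> C" using w by (simp add: C_def)
qed

text \<open>Minimisation over all solutions reduces to those in the ball, because solutions outside of it are
  farther from \<open>x0\<close> than \<open>zsol\<close>. This also shows that the definite description in \<open>x_dagger\<close> denotes.\<close>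
lemma xdag:
  shows xdag_Sol: "xdag \<in> Sol"
    and xdag_unique: "z \<in> Sol \<Longrightarrow> breg \<xi>0 z x0 \<le> breg \<xi>0 xdag x0 \<Longrightarrow> z = xdag"
proof -
  note C = Sol_closed_midpoint_convex
  have x0e: "x0 \<in> edom \<Theta>" using subgrad0 subgrad_edom by blast
  have tilt: "breg \<xi>0 a x0 \<le> breg \<xi>0 b x0 \<longleftrightarrow> th a - inner \<xi>0 a \<le> th b - inner \<xi>0 b" for a b
    by (simp add: breg_def inner_diff_right)
  have ne: "{z \<in> Bl. \<forall>i\<in>{1..N}. F i z = y i} \<inter> edom \<Theta> \<noteq> {}" using zsol_Sol C(3) by blast
  have ex1: "\<exists>!x. x \<in> Sol \<and> (\<forall>z\<in>Sol. breg \<xi>0 x x0 \<le> breg \<xi>0 z x0)"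
    using minimizer_on[OF ne C(1) C(2), of \<xi>0] unfolding C(3) tilt by simp
  let ?S = "solutions N A F y \<inter> edom \<Theta>"
  let ?P = "\<lambda>x. x \<in> ?S \<and> (\<forall>z\<in>?S. bregman \<Theta> \<xi>0 x x0 \<le> bregman \<Theta> \<xi>0 z x0)"
  have SS: "Sol \<subseteq> ?S" by (auto simp: Sol_def)
  have near: "z \<in> Sol" if "z \<in> ?S" "breg \<xi>0 z x0 \<le> \<sigma> * \<rho>\<^sup>2" for z
    using that near_of_breg[OF subgrad0, of z] \<rho> by (auto simp: Sol_def dist_norm norm_minus_commute)
  have P_iff: "?P x \<longleftrightarrow> x \<in> Sol \<and> (\<forall>z\<in>Sol. breg \<xi>0 x x0 \<le> breg \<xi>0 z x0)" for x
  proof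
    assume P: "?P x"
    have le: "breg \<xi>0 x x0 \<le> breg \<xi>0 z x0" if "z \<in> ?S" for z
      using P that bregman_eq[OF _ x0e] by auto
    have "breg \<xi>0 x x0 \<le> \<sigma> * \<rho>\<^sup>2" using le[OF zsol_spec(1)] zsol_spec(2) by (rule order_trans)
    then have "x \<in> Sol" using P by (intro near) blast+
    then show "x \<in> Sol \<and> (\<forall>z\<in>Sol. breg \<xi>0 x x0 \<le> breg \<xi>0 z x0)" using SS le by blast
  next
    assume x: "x \<in> Sol \<and> (\<forall>z\<in>Sol. breg \<xi>0 x x0 \<le> breg \<xi>0 z x0)"
    have "breg \<xi>0 x x0 \<le> breg \<xi>0 z x0" if z: "z \<in> ?S" for z
    proof (cases "breg \<xi>0 z x0 \<le> \<sigma> * \<rho>\<^sup>2")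
      case True then show ?thesis using near[OF z] x by blast
    next
      case False
      have "breg \<xi>0 x x0 \<le> breg \<xi>0 zsol x0" using x zsol_Sol by blast
      then show ?thesis using False zsol_spec(2) by linarith
    qed
    then show "?P x" using x SS bregman_eq[OF _ x0e] by (auto dest: subsetD)
  qed
  have "?P xdag" unfolding x_dagger_def by (rule theI') (use ex1 P_iff in simp)
  then have d: "xdag \<in> Sol \<and> (\<forall>z\<in>Sol. breg \<xi>0 xdag x0 \<le> breg \<xi>0 z x0)" using P_iff by blast
  then show "xdag \<in> Sol" by blast
  assume "z \<in> Sol" "breg \<xi>0 z x0 \<le> breg \<xi>0 xdag x0"
  then have "z \<in> Sol \<and> (\<forall>u\<in>Sol. breg \<xi>0 z x0 \<le> breg \<xi>0 u x0)" using d order_trans by blast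
  then show "z = xdag" using ex1 d by blast
qed

text \<open>The difference \<open>xs - xdag\<close> of two solutions lies in the kernel of each \<open>L i xdag\<close>, hence is orthogonal
  to the closures of the ranges of the adjoints, and under the range condition to all steps. So the
  Bregman distances of \<open>xs\<close> and \<open>xdag\<close> differ by the same amount at step \<open>0\<close> as in the limit, where \<open>xs\<close>
  has distance \<open>0\<close>; thus \<open>xs\<close> is no farther from \<open>x0\<close> than \<open>xdag\<close>.\<close>
lemma limit_eq_xdag:
  assumes j: "\<forall>n. j n \<in> {1..N}" and xs: "xs \<in> Sol"
    and lim: "(\<lambda>n. breg (dual_it (erun j n)) xs (primal_it (erun j n))) \<longlonglongrightarrow> 0"
    and ran: "\<forall>i\<in>{1..N}. \<forall>z\<in>Bl. ran_adjoint (Y i) (L i z) \<subseteq> closure (ran_adjoint (Y i) (L i xdag))"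
  shows "xs = xdag"
proof -
  let ?w = "xs - xdag"
  have orth: "inner (grd y i x) ?w = 0" if i: "i \<in> {1..N}" and x: "x \<in> Bl" for i x
  proof -
    have "norm (L i xdag (xdag - xs)) \<le> 0"
      using L_difference_le[OF i Sol_Bl[OF xdag_Sol] Sol_Bl[OF xs]] Sol_F[OF xdag_Sol i] Sol_F[OF xs i] by simp
    then have "L i xdag (xdag - xs) = 0" by simp
    then have L0: "L i xdag ?w = 0" by (simp add: blinfun.diff_right)
    have "inner g ?w = 0" if "g \<in> ran_adjoint (Y i) (L i xdag)" for g
    proof -
      obtain f where f: "f \<in> dual_space (Y i)" "g = dual_adjoint (L i xdag) f"
        using \<open>g \<in> ran_adjoint (Y i) (L i xdag)\<close> unfolding ran_adjoint_def by blast
      then show ?thesis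
        using dual_adjoint_inner[OF f(1) L_range[OF i Sol_Bl[OF xdag_Sol]]] L0 dual_space_zero[OF f(1) Y_subspace[OF i]]
        by simp
    qed
    then have "ran_adjoint (Y i) (L i xdag) \<subseteq> {g. inner ?w g = 0}" by (auto simp: inner_commute)
    then have "closure (ran_adjoint (Y i) (L i xdag)) \<subseteq> {g. inner ?w g = 0}"
      by (rule closure_minimal) (rule closed_hyperplane)
    moreover have "grd y i x \<in> ran_adjoint (Y i) (L i x)"
      unfolding heavy_ball.grad_def ran_adjoint_def
      by (intro imageI duality_map_spec(1) Y_subspace Y_smooth res_in_Y[OF noise_exact] i x r)
    ultimately show ?thesis using ran i x by (force simp: inner_commute)
  qed
  have le: "breg \<xi>0 xs x0 - breg \<xi>0 xdag x0 \<le> breg (dual_it (erun j n)) xs (primal_it (erun j n))" for n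
  proof -
    let ?D = "dual_it (erun j n)" and ?X = "primal_it (erun j n)"
    have "inner (?D - \<xi>0) ?w = 0" using erun_orthogonal[OF j orth] by blast
    then have "breg \<xi>0 xs x0 - breg \<xi>0 xdag x0 = breg ?D xs ?X - breg ?D xdag ?X"
      by (simp add: breg_def inner_diff_left inner_diff_right)
    then show ?thesis using breg_nonneg[OF erun_subgrad[OF j] Sol_edom[OF xdag_Sol], of n] by linarith
  qed
  have "breg \<xi>0 xs x0 - breg \<xi>0 xdag x0 \<le> 0" using LIMSEQ_le_const[OF lim] le by blast
  then show ?thesis using xdag_unique[OF xs] by simp
qed

section \<open>Convergence of the stopped iterates\<close>

abbreviation "stop_ix \<equiv> heavy_ball.stop_index N Y F L \<Theta> r \<sigma> \<eta> \<mu>0 \<mu>1 \<upsilon>0 \<upsilon>1 \<tau> \<beta> x0 \<xi>0"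
abbreviation "stopped \<equiv> heavy_ball.shb_stopped N Y F L \<Theta> r \<sigma> \<eta> \<mu>0 \<mu>1 \<upsilon>0 \<upsilon>1 \<tau> \<beta> x0 \<xi>0"

lemma stopped_eq: "stopped yd d j = run yd d j (the_enat (stop_ix yd d j))"
  by (rule heavy_ball.shb_stopped_def)

lemma stop_ix_Least:
  assumes "\<exists>n. active (run yd d j n) = {}"
  shows "stop_ix yd d j = enat (LEAST n. active (run yd d j n) = {})"
proof -
  let ?n = "LEAST n. active (run yd d j n) = {}"
  have n: "active (run yd d j ?n) = {}" using assms by (rule LeastI_ex)
  show ?thesis unfolding heavy_ball.stop_index_def
  proof (rule antisym)
    show "Inf (enat ` {n. active (run yd d j n) = {}}) \<le> enat ?n" using n by (intro Inf_lower) simp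
    show "enat ?n \<le> Inf (enat ` {n. active (run yd d j n) = {}})"
      by (rule Inf_greatest) (auto intro: Least_le)
  qed
qed

text \<open>Paths on which the method never stops are read off at a fixed but unspecified step, so that the
  stopped state is defined and measurable everywhere.\<close>
lemma the_enat_stop_ix:
  "the_enat (stop_ix yd d j) = (if \<exists>n. active (run yd d j n) = {}
     then LEAST n. active (run yd d j n) = {} else the_enat \<infinity>)"
proof (cases "\<exists>n. active (run yd d j n) = {}")
  case False
  then show ?thesis by (simp add: heavy_ball.stop_index_def top_enat_def)
qed (simp add: stop_ix_Least)

end

context random_shb
begin

lemma stop_time_measurable:
  "(\<lambda>\<omega>. the_enat (stop_ix yd d (draws \<omega>))) \<in> measurable M (count_space UNIV)"
proof -
  have [measurable]: "Measurable.pred M (\<lambda>\<omega>. active (run yd d (draws \<omega>) n) = {})" for n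
    by (rule run_measurable[of "\<lambda>s. active s = {}"]) simp
  show ?thesis unfolding the_enat_stop_ix by measurable
qed

lemma stopped_measurable:
  assumes f: "\<And>s. f s \<in> measurable M K"
  shows "(\<lambda>\<omega>. f (stopped yd d (draws \<omega>)) \<omega>) \<in> measurable M K"
proof -
  have "(\<lambda>\<omega>. f (run yd d (draws \<omega>) n) \<omega>) \<in> measurable M K" for n
    unfolding run_prefix by (rule measurable_compose_countable[OF f prefix_measurable])
  from measurable_compose_countable[OF this stop_time_measurable] show ?thesis unfolding stopped_eq .
qed

text \<open>Outside a null set the limit is obtained path by path; on the null set any reference solution will do.\<close>
lemma exact_limit:
  obtains xs where "xs \<in> borel_measurable M" "\<And>\<omega>. xs \<omega> \<in> Sol"
    "AE \<omega> in M. (\<lambda>n. primal_it (erun (draws \<omega>) n)) \<longlonglongrightarrow> xs \<omega>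
      \<and> (\<lambda>n. breg (dual_it (erun (draws \<omega>) n)) (xs \<omega>) (primal_it (erun (draws \<omega>) n))) \<longlonglongrightarrow> 0
      \<and> breg \<xi>0 (xs \<omega>) x0 \<le> \<sigma> * \<rho>\<^sup>2 + Cpair / (1 - \<beta>) * (\<Sum>n. Phi (primal_it (erun (draws \<omega>) n)))"
proof -
  let ?X = "\<lambda>n \<omega>. primal_it (erun (draws \<omega>) n)"
  define Q where "Q \<omega> x \<longleftrightarrow> x \<in> Sol \<and> (\<lambda>n. ?X n \<omega>) \<longlonglongrightarrow> x
      \<and> (\<lambda>n. breg (dual_it (erun (draws \<omega>) n)) x (?X n \<omega>)) \<longlonglongrightarrow> 0
      \<and> breg \<xi>0 x x0 \<le> \<sigma> * \<rho>\<^sup>2 + Cpair / (1 - \<beta>) * (\<Sum>n. Phi (?X n \<omega>))" for \<omega> x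
  obtain Z where Z: "{\<omega> \<in> space M. \<not> summable (\<lambda>n. Phi (?X n \<omega>))} \<subseteq> Z" "emeasure M Z = 0" "Z \<in> sets M"
    using AE_summable_Phi(1) by (rule AE_E)
  have "\<exists>x. Q \<omega> x" if "\<omega> \<in> space M - Z" for \<omega>
  proof -
    have "summable (\<lambda>n. Phi (?X n \<omega>))" "\<omega> \<in> space M" using that Z(1) by auto
    then show ?thesis unfolding Q_def Bex_def[symmetric] by (intro exact_convergence[OF draws_range])
  qed
  then obtain x where x: "\<And>\<omega>. \<omega> \<in> space M - Z \<Longrightarrow> Q \<omega> (x \<omega>)" by metis
  define xs where "xs \<omega> = (if \<omega> \<in> space M - Z then x \<omega> else zsol)" for \<omega>
  have "xs \<in> borel_measurable M"
  proof (rule borel_measurable_LIMSEQ_metric)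
    have "?X n \<in> borel_measurable M" for n by (rule run_measurable[of primal_it]) simp
    then show "(\<lambda>\<omega>. if \<omega> \<in> space M - Z then ?X n \<omega> else zsol) \<in> borel_measurable M" for n
      using Z(3) by (intro measurable_If) auto
    show "(\<lambda>n. if \<omega> \<in> space M - Z then ?X n \<omega> else zsol) \<longlonglongrightarrow> xs \<omega>" if "\<omega> \<in> space M" for \<omega>
      using x[of \<omega>] by (cases "\<omega> \<in> space M - Z") (simp_all add: xs_def Q_def del: Diff_iff)
  qed
  moreover have "xs \<omega> \<in> Sol" for \<omega> using x zsol_Sol by (simp add: xs_def Q_def)
  moreover have "AE \<omega> in M. Q \<omega> (xs \<omega>)"
  proof (rule AE_I'[of Z])
    show "Z \<in> null_sets M" using Z(2,3) by (rule null_setsI)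
    show "{\<omega> \<in> space M. \<not> Q \<omega> (xs \<omega>)} \<subseteq> Z" using x by (auto simp: xs_def)
  qed
  then have "AE \<omega> in M. (\<lambda>n. ?X n \<omega>) \<longlonglongrightarrow> xs \<omega>
      \<and> (\<lambda>n. breg (dual_it (erun (draws \<omega>) n)) (xs \<omega>) (?X n \<omega>)) \<longlonglongrightarrow> 0
      \<and> breg \<xi>0 (xs \<omega>) x0 \<le> \<sigma> * \<rho>\<^sup>2 + Cpair / (1 - \<beta>) * (\<Sum>n. Phi (?X n \<omega>))"
    by (rule eventually_mono) (simp add: Q_def)
  ultimately show thesis by (rule that)
qed

text \<open>The almost sure statement is \<open>stopped_convergence\<close> applied to almost every path. For the expectations,
  the Bregman distance to \<open>xs\<close> at the stopping time is at most the one at \<open>x0\<close>, which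
  \<open>exact_convergence\<close> bounds by the integrable function \<open>W\<close>; squared norms are dominated by Bregman
  distances.\<close>
theorem noisy_convergence:
  assumes dc: "data_converge yd d" and dpos: "\<forall>l. \<forall>i\<in>{1..N}. d l i > 0"
  defines "x \<equiv> \<lambda>l \<omega>. primal_it (stopped (yd l) (d l) (draws \<omega>))"
    and "\<xi> \<equiv> \<lambda>l \<omega>. dual_it (stopped (yd l) (d l) (draws \<omega>))"
  shows "\<exists>xs \<in> borel_measurable M. (\<forall>\<omega>. xs \<omega> \<in> Sol) \<and>
     (AE \<omega> in M. (\<forall>l. stop_ix (yd l) (d l) (draws \<omega>) < \<infinity>) \<and>
        (\<lambda>l. norm (x l \<omega> - xs \<omega>)) \<longlonglongrightarrow> 0 \<and> (\<lambda>l. breg (\<xi> l \<omega>) (xs \<omega>) (x l \<omega>)) \<longlonglongrightarrow> 0) \<and>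
     (\<forall>l. integrable M (\<lambda>\<omega>. (norm (x l \<omega> - xs \<omega>))\<^sup>2)) \<and>
     (\<lambda>l. expectation (\<lambda>\<omega>. (norm (x l \<omega> - xs \<omega>))\<^sup>2)) \<longlonglongrightarrow> 0 \<and>
     (\<forall>l. integrable M (\<lambda>\<omega>. breg (\<xi> l \<omega>) (xs \<omega>) (x l \<omega>))) \<and>
     (\<lambda>l. expectation (\<lambda>\<omega>. breg (\<xi> l \<omega>) (xs \<omega>) (x l \<omega>))) \<longlonglongrightarrow> 0 \<and>
     ((\<forall>i\<in>{1..N}. \<forall>z\<in>Bl. ran_adjoint (Y i) (L i z) \<subseteq> closure (ran_adjoint (Y i) (L i xdag))) \<longrightarrow>
       (AE \<omega> in M. xs \<omega> = xdag))"
proof -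
  obtain xs where xs: "xs \<in> borel_measurable M" "\<And>\<omega>. xs \<omega> \<in> Sol"
    and lim: "AE \<omega> in M. (\<lambda>n. primal_it (erun (draws \<omega>) n)) \<longlonglongrightarrow> xs \<omega>
      \<and> (\<lambda>n. breg (dual_it (erun (draws \<omega>) n)) (xs \<omega>) (primal_it (erun (draws \<omega>) n))) \<longlonglongrightarrow> 0
      \<and> breg \<xi>0 (xs \<omega>) x0 \<le> \<sigma> * \<rho>\<^sup>2 + Cpair / (1 - \<beta>) * (\<Sum>n. Phi (primal_it (erun (draws \<omega>) n)))"
    by (rule exact_limit) (rule that)
  have nz: "noise (yd l) (d l)" for l using dc by (simp add: data_converge_def)
  define W where "W \<omega> = \<sigma> * \<rho>\<^sup>2 + Cpair / (1 - \<beta>) * (\<Sum>n. Phi (primal_it (erun (draws \<omega>) n)))" for \<omega>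
  have W: "integrable M W" unfolding W_def     by (intro Bochner_Integration.integrable_add Bochner_Integration.integrable_mult_right
        AE_summable_Phi(2) integrable_const)
  define B where "B l \<omega> = breg (\<xi> l \<omega>) (xs \<omega>) (x l \<omega>)" for l \<omega>
  have sg: "subgrad (\<xi> l \<omega>) (x l \<omega>)" if "\<omega> \<in> space M" for l \<omega>
    using admissible_run[OF nz draws_range[OF that]] unfolding x_def \<xi>_def stopped_eq admissible_def by blast
  have B0: "0 \<le> B l \<omega>" if "\<omega> \<in> space M" for l \<omega>
    unfolding B_def by (rule breg_nonneg[OF sg[OF that] Sol_edom[OF xs(2)]])
  have B_le: "B l \<omega> \<le> breg \<xi>0 (xs \<omega>) x0" if "\<omega> \<in> space M" for l \<omega>
    using decseqD[OF run_breg_mono[OF nz[of l] draws_range[OF that] xs(2)[of \<omega>]], of 0]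
    unfolding B_def x_def \<xi>_def stopped_eq by (simp add: heavy_ball.shb.simps)
  have norm_le: "(norm (x l \<omega> - xs \<omega>))\<^sup>2 \<le> B l \<omega> / \<sigma>" if "\<omega> \<in> space M" for l \<omega>
    using breg_lower[OF sg[OF that, of l] Sol_edom[OF xs(2)[of \<omega>]]] \<sigma> unfolding B_def
    by (simp add: field_simps norm_minus_commute)
  have main: "AE \<omega> in M. (\<forall>l. stop_ix (yd l) (d l) (draws \<omega>) < \<infinity>) \<and>
      (\<lambda>l. norm (x l \<omega> - xs \<omega>)) \<longlonglongrightarrow> 0 \<and> (\<lambda>l. B l \<omega>) \<longlonglongrightarrow> 0"
    using lim AE_infinitely_often AE_space
  proof eventually_elim
    case (elim \<omega>)
    note j = draws_range[OF elim(3)]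
    have ex: "\<exists>n. active (run (yd l) (d l) (draws \<omega>) n) = {}" for l
      by (rule terminates[OF nz _ j]) (use dpos elim(2) in auto)
    have stop: "active (run (yd l) (d l) (draws \<omega>) (the_enat (stop_ix (yd l) (d l) (draws \<omega>)))) = {}" for l
      using LeastI_ex[OF ex] by (simp add: stop_ix_Least[OF ex])
    have BL: "(\<lambda>l. B l \<omega>) \<longlonglongrightarrow> 0"
      unfolding B_def x_def \<xi>_def stopped_eq
      by (rule stopped_convergence[OF dc j stop xs(2)]) (use elim(1) in auto)
    have "(\<lambda>l. x l \<omega>) \<longlonglongrightarrow> xs \<omega>"
      by (rule tendsto_of_breg_tendsto_0[OF sg[OF elim(3)] Sol_edom[OF xs(2)] BL[unfolded B_def]])
    then have "(\<lambda>l. norm (x l \<omega> - xs \<omega>)) \<longlonglongrightarrow> 0" by (simp add: tendsto_norm_zero_iff LIM_zero_iff)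
    then show ?case using BL by (simp add: stop_ix_Least[OF ex])
  qed
  have \<Theta>m: "\<Theta> \<in> borel_measurable borel"
    by (rule lower_semicont_borel_measurable) (use A in \<open>simp add: assumption_A_def\<close>)
  have th_xs: "(\<lambda>\<omega>. th (xs \<omega>)) \<in> borel_measurable M"
    unfolding th_def by (intro borel_measurable_real_of_ereal measurable_compose[OF xs(1) \<Theta>m])
  have cont: "(\<lambda>\<omega>. f (xs \<omega>)) \<in> borel_measurable M" if "continuous_on UNIV f" for f :: "'a \<Rightarrow> real"
    by (rule measurable_compose[OF xs(1) borel_measurable_continuous_onI[OF that]])
  have Bm: "B l \<in> borel_measurable M" for l
    unfolding B_def x_def \<xi>_def
  proof (rule stopped_measurable[of "\<lambda>s \<omega>. breg (dual_it s) (xs \<omega>) (primal_it s)"])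
    show "(\<lambda>\<omega>. breg (dual_it s) (xs \<omega>) (primal_it s)) \<in> borel_measurable M" for s
      unfolding breg_def
      by (intro borel_measurable_diff th_xs borel_measurable_const cont continuous_intros)
  qed
  have nm: "(\<lambda>\<omega>. (norm (x l \<omega> - xs \<omega>))\<^sup>2) \<in> borel_measurable M" for l
    unfolding x_def
  proof (rule stopped_measurable[of "\<lambda>s \<omega>. (norm (primal_it s - xs \<omega>))\<^sup>2"])
    show "(\<lambda>\<omega>. (norm (primal_it s - xs \<omega>))\<^sup>2) \<in> borel_measurable M" for s
      by (intro cont continuous_intros)
  qed
  have dom: "AE \<omega> in M. norm (B l \<omega>) \<le> W \<omega>" for l
    using lim AE_space
  proof eventually_elim
    case (elim \<omega>)
    then show ?case using B0[of \<omega> l] B_le[of \<omega> l] unfolding W_def by simp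
  qed
  have B_lim: "AE \<omega> in M. (\<lambda>l. B l \<omega>) \<longlonglongrightarrow> 0" using main by eventually_elim blast
  have "(\<lambda>l. expectation (B l)) \<longlonglongrightarrow> expectation (\<lambda>\<omega>. 0)"
    by (rule integral_dominated_convergence[OF _ Bm W B_lim dom]) simp
  then have EB: "(\<lambda>l. expectation (B l)) \<longlonglongrightarrow> 0" by simp
  have IB: "integrable M (B l)" for l
    by (rule Bochner_Integration.integrable_bound[OF W Bm]) (use dom[of l] in \<open>auto elim!: eventually_mono\<close>)
  have In: "integrable M (\<lambda>\<omega>. (norm (x l \<omega> - xs \<omega>))\<^sup>2)" for l
    by (rule Bochner_Integration.integrable_bound[OF integrable_divide_zero[of \<sigma> M "B l"] nm])
      (use IB norm_le B0 \<sigma> in \<open>auto intro!: AE_I2\<close>)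
  have En_le: "expectation (\<lambda>\<omega>. (norm (x l \<omega> - xs \<omega>))\<^sup>2) \<le> expectation (B l) / \<sigma>" for l
  proof -
    have "expectation (\<lambda>\<omega>. (norm (x l \<omega> - xs \<omega>))\<^sup>2) \<le> expectation (\<lambda>\<omega>. B l \<omega> / \<sigma>)"
      by (rule integral_mono[OF In _ norm_le]) (use IB in simp_all)
    then show ?thesis by simp
  qed
  have En: "(\<lambda>l. expectation (\<lambda>\<omega>. (norm (x l \<omega> - xs \<omega>))\<^sup>2)) \<longlonglongrightarrow> 0"
  proof (rule tendsto_sandwich[OF _ _ tendsto_const])
    show "\<forall>\<^sub>F l in sequentially. 0 \<le> expectation (\<lambda>\<omega>. (norm (x l \<omega> - xs \<omega>))\<^sup>2)"
      by (intro always_eventually allI integral_nonneg_AE AE_I2) simp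
    show "\<forall>\<^sub>F l in sequentially. expectation (\<lambda>\<omega>. (norm (x l \<omega> - xs \<omega>))\<^sup>2) \<le> expectation (B l) / \<sigma>"
      by (intro always_eventually allI En_le)
    show "(\<lambda>l. expectation (B l) / \<sigma>) \<longlonglongrightarrow> 0" using tendsto_divide[OF EB tendsto_const, of \<sigma>] \<sigma> by simp
  qed
  have dag: "AE \<omega> in M. xs \<omega> = xdag"
    if ran: "\<forall>i\<in>{1..N}. \<forall>z\<in>Bl. ran_adjoint (Y i) (L i z) \<subseteq> closure (ran_adjoint (Y i) (L i xdag))"
    using lim AE_space
  proof eventually_elim
    case (elim \<omega>)
    then show ?case using limit_eq_xdag[OF draws_range xs(2) _ ran] by blast
  qed
  show ?thesis
    by (intro bexI[of _ xs] conjI allI impI xs main[unfolded B_def] In En IB[unfolded B_def[abs_def]]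
        EB[unfolded B_def[abs_def]] dag)
qed

end

theorem theorem3p8:
  fixes N :: nat
    and Y :: "nat \<Rightarrow> 'b::real_normed_vector set"
    and A :: "nat \<Rightarrow> 'a::{real_inner,complete_space} set"
    and F :: "nat \<Rightarrow> 'a \<Rightarrow> 'b"
    and L :: "nat \<Rightarrow> 'a \<Rightarrow> 'a \<Rightarrow>\<^sub>L 'b"
    and y :: "nat \<Rightarrow> 'b"
    and \<Theta> :: "'a \<Rightarrow> ereal"
    and x0 \<xi>0 :: 'a
    and r \<sigma> \<rho> \<eta> \<mu>0 \<mu>1 \<upsilon>0 \<upsilon>1 \<tau> \<beta> :: real
    and M :: "'w measure"
    and \<iota> :: "nat \<Rightarrow> 'w \<Rightarrow> nat"
    and yd :: "nat \<Rightarrow> nat \<Rightarrow> 'b"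
    and \<delta> :: "nat \<Rightarrow> nat \<Rightarrow> real"
    and stop :: "nat \<Rightarrow> 'w \<Rightarrow> enat"
    and x \<xi> :: "nat \<Rightarrow> 'w \<Rightarrow> 'a"
  assumes "N \<ge> 1"
    and "\<forall>i\<in>{1..N}. F i ` A i \<subseteq> Y i"
    and "x0 \<in> dom_subdifferential \<Theta>" and "\<xi>0 \<in> subdifferential \<Theta> x0"
    and "assumption_A \<Theta> \<sigma>"
    and "assumption_B N Y A F L y \<Theta> \<sigma> \<rho> \<eta> x0 \<xi>0"
    and "1 < r"
    and "0 < \<mu>0" and "\<mu>0 < 4 * \<sigma>" and "\<mu>1 > 0" and "\<upsilon>0 > 0" and "\<upsilon>1 > 0"
    and "0 \<le> \<beta>" and "\<beta> < 1" and "\<tau> > (1 + \<eta>) / (1 - \<eta>)"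
    and "uniform_iid_indices M N \<iota>"
    and "\<forall>l. \<forall>i\<in>{1..N}. yd l i \<in> Y i \<and> \<delta> l i > 0 \<and> norm (yd l i - y i) \<le> \<delta> l i"
    and "(\<lambda>l. Max (\<delta> l ` {1..N})) \<longlonglongrightarrow> 0"
    and "\<And>l \<omega>. stop l \<omega> = heavy_ball.stop_index N Y F L \<Theta> r \<sigma> \<eta> \<mu>0 \<mu>1 \<upsilon>0 \<upsilon>1 \<tau> \<beta>
            x0 \<xi>0 (yd l) (\<delta> l) (\<lambda>n. \<iota> n \<omega>)"
    and "\<And>l \<omega>. x l \<omega> = primal_it (heavy_ball.shb_stopped N Y F L \<Theta> r \<sigma> \<eta> \<mu>0 \<mu>1 \<upsilon>0 \<upsilon>1 \<tau> \<beta>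
            x0 \<xi>0 (yd l) (\<delta> l) (\<lambda>n. \<iota> n \<omega>))"
    and "\<And>l \<omega>. \<xi> l \<omega> = dual_it (heavy_ball.shb_stopped N Y F L \<Theta> r \<sigma> \<eta> \<mu>0 \<mu>1 \<upsilon>0 \<upsilon>1 \<tau> \<beta>
            x0 \<xi>0 (yd l) (\<delta> l) (\<lambda>n. \<iota> n \<omega>))"
  shows "\<exists>xs \<in> borel_measurable M.
     (\<forall>\<omega>\<in>space M. xs \<omega> \<in> solutions N A F y \<inter> cball x0 (2 * \<rho>) \<inter> edom \<Theta>) \<and>
     (AE \<omega> in M. (\<forall>l. stop l \<omega> < \<infinity>) \<and>
        (\<lambda>l. norm (x l \<omega> - xs \<omega>)) \<longlonglongrightarrow> 0 \<and>
        (\<lambda>l. bregman \<Theta> (\<xi> l \<omega>) (xs \<omega>) (x l \<omega>)) \<longlonglongrightarrow> 0) \<and>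
     (\<forall>l. integrable M (\<lambda>\<omega>. (norm (x l \<omega> - xs \<omega>))\<^sup>2)) \<and>
     (\<lambda>l. prob_space.expectation M (\<lambda>\<omega>. (norm (x l \<omega> - xs \<omega>))\<^sup>2)) \<longlonglongrightarrow> 0 \<and>
     (\<forall>l. integrable M (\<lambda>\<omega>. real_of_ereal (bregman \<Theta> (\<xi> l \<omega>) (xs \<omega>) (x l \<omega>)))) \<and>
     (\<lambda>l. prob_space.expectation M (\<lambda>\<omega>. real_of_ereal (bregman \<Theta> (\<xi> l \<omega>) (xs \<omega>) (x l \<omega>))))
        \<longlonglongrightarrow> 0 \<and>
     ((\<forall>i\<in>{1..N}. \<forall>z \<in> cball x0 (2 * \<rho>). ran_adjoint (Y i) (L i z)
          \<subseteq> closure (ran_adjoint (Y i) (L i (x_dagger N A F y \<Theta> x0 \<xi>0)))) \<longrightarrow>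
       (AE \<omega> in M. xs \<omega> = x_dagger N A F y \<Theta> x0 \<xi>0))"
proof -
  interpret prob_space M using assms(16) by (simp add: uniform_iid_indices_def)
  interpret random_shb N Y A F L y \<Theta> r \<sigma> \<rho> \<eta> \<mu>0 \<mu>1 \<upsilon>0 \<upsilon>1 \<tau> \<beta> x0 \<xi>0 M \<iota>
    by unfold_locales (use assms(1-16) in auto)
  have "(\<lambda>l. \<delta> l i) \<longlonglongrightarrow> 0" if i: "i \<in> {1..N}" for i
  proof (rule tendsto_sandwich[OF _ _ tendsto_const assms(18)])
    show "\<forall>\<^sub>F l in sequentially. 0 \<le> \<delta> l i"
      using assms(17) i by (intro always_eventually allI less_imp_le) blast
    show "\<forall>\<^sub>F l in sequentially. \<delta> l i \<le> Max (\<delta> l ` {1..N})"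
      using i by (intro always_eventually allI Max_ge) auto
  qed
  then have dc: "data_converge yd \<delta>"
    using assms(17) by (auto simp: data_converge_def noise_def less_imp_le)
  have pos: "\<forall>l. \<forall>i\<in>{1..N}. \<delta> l i > 0" using assms(17) by blast
  obtain xs where xs: "xs \<in> borel_measurable M" "\<And>\<omega>. xs \<omega> \<in> Sol"
    and AE: "AE \<omega> in M. (\<forall>l. stop l \<omega> < \<infinity>) \<and>
        (\<lambda>l. norm (x l \<omega> - xs \<omega>)) \<longlonglongrightarrow> 0 \<and> (\<lambda>l. breg (\<xi> l \<omega>) (xs \<omega>) (x l \<omega>)) \<longlonglongrightarrow> 0"
    and norm: "\<forall>l. integrable M (\<lambda>\<omega>. (norm (x l \<omega> - xs \<omega>))\<^sup>2)"
      "(\<lambda>l. expectation (\<lambda>\<omega>. (norm (x l \<omega> - xs \<omega>))\<^sup>2)) \<longlonglongrightarrow> 0"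
    and breg: "\<forall>l. integrable M (\<lambda>\<omega>. breg (\<xi> l \<omega>) (xs \<omega>) (x l \<omega>))"
      "(\<lambda>l. expectation (\<lambda>\<omega>. breg (\<xi> l \<omega>) (xs \<omega>) (x l \<omega>))) \<longlonglongrightarrow> 0"
    and dag: "(\<forall>i\<in>{1..N}. \<forall>z\<in>Bl. ran_adjoint (Y i) (L i z) \<subseteq> closure (ran_adjoint (Y i) (L i xdag)))
       \<longrightarrow> (AE \<omega> in M. xs \<omega> = xdag)"
    using noisy_convergence[OF dc pos, folded assms(19-21)]
    by (elim bexE conjE) (rule that, (assumption | erule spec)+)
  have eq: "bregman \<Theta> (\<xi> l \<omega>) (xs \<omega>) (x l \<omega>) = ereal (breg (\<xi> l \<omega>) (xs \<omega>) (x l \<omega>))"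
    if "\<omega> \<in> space M" for l \<omega>
  proof (rule bregman_eq[OF Sol_edom[OF xs(2)]])
    show "x l \<omega> \<in> edom \<Theta>"
      using admissible_run[OF _ draws_range[OF that]] dc subgrad_edom
      unfolding assms(20) stopped_eq admissible_def data_converge_def by blast
  qed
  have "AE \<omega> in M. (\<forall>l. stop l \<omega> < \<infinity>) \<and> (\<lambda>l. norm (x l \<omega> - xs \<omega>)) \<longlonglongrightarrow> 0
      \<and> (\<lambda>l. bregman \<Theta> (\<xi> l \<omega>) (xs \<omega>) (x l \<omega>)) \<longlonglongrightarrow> 0"
    using AE AE_space
  proof eventually_elim
    case (elim \<omega>)
    then have "(\<lambda>l. ereal (breg (\<xi> l \<omega>) (xs \<omega>) (x l \<omega>))) \<longlonglongrightarrow> ereal 0" by (intro tendsto_ereal) blast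
    then show ?case using elim by (simp add: eq zero_ereal_def)
  qed
  moreover have "integrable M (\<lambda>\<omega>. real_of_ereal (bregman \<Theta> (\<xi> l \<omega>) (xs \<omega>) (x l \<omega>)))" for l
    using breg(1) by (subst Bochner_Integration.integrable_cong[OF refl, where g="\<lambda>\<omega>. breg (\<xi> l \<omega>) (xs \<omega>) (x l \<omega>)"]) (simp_all add: eq)
  moreover have "expectation (\<lambda>\<omega>. real_of_ereal (bregman \<Theta> (\<xi> l \<omega>) (xs \<omega>) (x l \<omega>)))
      = expectation (\<lambda>\<omega>. breg (\<xi> l \<omega>) (xs \<omega>) (x l \<omega>))" for l
    by (rule Bochner_Integration.integral_cong) (simp_all add: eq)
  moreover have "xs \<omega> \<in> solutions N A F y \<inter> cball x0 (2 * \<rho>) \<inter> edom \<Theta>" for \<omega>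
    using xs(2) by (simp add: Sol_def)
  ultimately show ?thesis
    using xs(1) norm breg(2) dag by (intro bexI[of _ xs]) simp_all
qed

end
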